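(* The $m$-Brownian motion $\{\widetilde B_m(t),\,t\in\mathbb R\}$ has the following properties: (1) $E\big(\widetilde B_m(t)\,\widetilde B_m(s)^*\big)=K_r(s,t)$; (2) $E\big(|\widetilde B_m(t)-\widetilde B_m(s)|^2\big)=2\,\mathrm{Re}\,r(t-s)$; (3) $\mathrm{Re}\,r(t)\le C_1t^2+C_2t$ for some positive constants $C_1$ and $C_2$.
   Context: $m$ is a positive measurable function on $\mathbb R$ with $\int_{\mathbb R}\frac{m(u)}{u^2+1}du<\infty$. Set $d\sigma(u)=m(u)\,du$ and $$r(t)=r(0)+i\gamma t-\int_{\mathbb R}\Big\{e^{itu}-1-\frac{itu}{u^2+1}\Big\}\frac{d\sigma(u)}{u^2},\qquad t\in\mathbb R,$$ with $\gamma\in\mathbb R$ and the normalization $r(0)=0$, and let $K_r(t,s)=r(t)+r(s)^*-r(t-s)-r(0)$ for $t,s\in\mathbb R$ ($*$ denotes complex conjugation). The Fourier transform is $\widehat f(u)=\int_{\mathbb R}e^{-iux}f(x)\,dx$. $T_m$ is the operator in $\mathbf L_2(\mathbb R)$ defined by $\widehat{T_mf}(u)=\sqrt{m(u)}\,\widehat f(u)$ with domain $\{f\in\mathbf L_2(\mathbb R):\int_{\mathbb R}m(u)|\widehat f(u)|^2du<\infty\}$. Set $I_t=1_{[0,t]}$ for $t>0$, $I_t=1_{[t,0]}$ for $t<0$, and $I_0=0$; these functions belong to the domain of $T_m$. White noise space: $\Omega=\mathcal S_{\mathbb R}(\mathbb R)'$ is the dual of the space $\mathcal S_{\mathbb R}(\mathbb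 R)$ of real-valued Schwartz functions, with Borel $\sigma$-algebra $\mathcal F$ and the probability measure $P$ (given by the Bochner–Minlos theorem) such that $E(e^{iQ_s})=e^{-\|s\|^2_{\mathbf L_2(\mathbb R)}/2}$ for all $s\in\mathcal S_{\mathbb R}(\mathbb R)$, where $Q_s(\omega)=\langle\omega,s\rangle$. The map $s\mapsto Q_s$ extends to an isometry from real $\mathbf L_2(\mathbb R)$ into real $\mathbf L_2(\Omega,\mathcal F,P)$, and then to an isometry $f\mapsto Q_f$ between the complexified spaces. The $m$-Brownian motion is the process $\widetilde B_m(t,\omega)=Q_{T_mI_t}(\omega)$, $t\in\mathbb R$, $\omega\in\Omega$.
   Formalization: Here dσ = m(u)du/(2π) and I_t = −1_[t,0] for t<0. In (3), t becomes |t|: C_1t²+C_2 max(1,|t|) is proved for every m, and C_1t²+C_2|t| when R∫_{|u|>R} m(u)u^{-2}du is bounded for R≥1 (it fails e.g. for m=|u|^{1/2}). *)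

theory Defs
  imports "HOL-Analysis.Analysis" "HOL-Probability.Probability"
begin

section \<open>Square-integrable functions\<close>

text \<open>Elements of $L_2$ are represented by functions; equality in $L_2$ is equality almost
  everywhere.\<close>

definition L2 :: "'a measure \<Rightarrow> ('a \<Rightarrow> 'b::euclidean_space) set" where
  "L2 M = {f. f \<in> borel_measurable M \<and> integrable M (\<lambda>x. (norm (f x))\<^sup>2)}"

definition L2_norm :: "'a measure \<Rightarrow> ('a \<Rightarrow> 'b::euclidean_space) \<Rightarrow> real" where
  "L2_norm M f = sqrt (\<integral>x. (norm (f x))\<^sup>2 \<partial>M)"

definition tendsto_L2 :: "'a measure \<Rightarrow> (nat \<Rightarrow> 'a \<Rightarrow> 'b::euclidean_space) \<Rightarrow> ('a \<Rightarrow> 'b) \<Rightarrow> bool" where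
  "tendsto_L2 M F f \<longleftrightarrow> (\<forall>n. F n \<in> L2 M) \<and> f \<in> L2 M \<and>
     (\<lambda>n. L2_norm M (\<lambda>x. F n x - f x)) \<longlonglongrightarrow> 0"


section \<open>The Fourier transform and the operator $T_m$\<close>

definition fourier :: "(real \<Rightarrow> complex) \<Rightarrow> real \<Rightarrow> complex" where
  "fourier f u = (\<integral>x. exp (- \<i> * of_real (u * x)) * f x \<partial>lborel)"

text \<open>The Fourier transform of a general $f \in L_2$ is the $L_2$-limit of the transforms of the
  truncations of $f$ to $[-n,n]$; for $f \in L_1 \cap L_2$ it agrees a.e. with \<open>fourier f\<close>.\<close>

definition fourier_L2 :: "(real \<Rightarrow> complex) \<Rightarrow> real \<Rightarrow> complex" where
  "fourier_L2 f = (SOME F.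
     tendsto_L2 lborel (\<lambda>n. fourier (\<lambda>x. indicator {- real n..real n} x * f x)) F)"

definition T_dom :: "(real \<Rightarrow> real) \<Rightarrow> (real \<Rightarrow> complex) set" where
  "T_dom m = {f \<in> L2 lborel. integrable lborel (\<lambda>u. m u * (cmod (fourier_L2 f u))\<^sup>2)}"

definition T_op :: "(real \<Rightarrow> real) \<Rightarrow> (real \<Rightarrow> complex) \<Rightarrow> real \<Rightarrow> complex" where
  "T_op m f = (if f \<in> T_dom m
     then (SOME g. g \<in> L2 lborel \<and>
             (AE u in lborel. fourier_L2 g u = of_real (sqrt (m u)) * fourier_L2 f u))
     else undefined)"

text \<open>The sign for $t < 0$ makes $I_t - I_s$ the signed indicator of the interval from $s$ to $t$,
  for all real $s$, $t$. Without it the covariance of the process defined below would be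
  $-K_r(s,t)$ whenever $s$ and $t$ have opposite signs.\<close>

definition I_fun :: "real \<Rightarrow> real \<Rightarrow> complex" where
  "I_fun t = (if t > 0 then indicator {0..t}
              else if t < 0 then (\<lambda>x. - indicator {t..0} x)
              else (\<lambda>x. 0))"


section \<open>The functions $r$ and $K_r$\<close>

text \<open>The measure $du$ on the frequency side is normalised by $1/(2\pi)$. With the Fourier
  transform $\widehat f(u) = \int e^{-iux} f(x)\,dx$, Plancherel's identity reads
  $\int |f|^2\,dx = \int |\widehat f|^2\,du/(2\pi)$, so this is the normalisation for which
  $K_r(s,t)$ is the inner product of $T_m I_t$ and $T_m I_s$.\<close>

definition sigma_m :: "(real \<Rightarrow> real) \<Rightarrow> real measure" where
  "sigma_m m = density lborel (\<lambda>u. ennreal (m u / (2 * pi)))"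

definition r_fun :: "(real \<Rightarrow> real) \<Rightarrow> real \<Rightarrow> real \<Rightarrow> complex" where
  "r_fun m \<gamma> t = \<i> * of_real (\<gamma> * t) -
     (\<integral>u. (exp (\<i> * of_real (t * u)) - 1 - \<i> * of_real (t * u / (u\<^sup>2 + 1))) / of_real (u\<^sup>2)
        \<partial>(sigma_m m))"

definition K_fun :: "(real \<Rightarrow> complex) \<Rightarrow> real \<Rightarrow> real \<Rightarrow> complex" where
  "K_fun r t s = r t + cnj (r s) - r (t - s) - r 0"


section \<open>Schwartz functions and tempered distributions\<close>

definition is_schwartz :: "(real \<Rightarrow> real) \<Rightarrow> bool" where
  "is_schwartz f \<longleftrightarrow>
     (\<forall>k x. (deriv ^^ k) f field_differentiable (at x)) \<and>
     (\<forall>j k. \<exists>C. \<forall>x. \<bar>x ^ j * (deriv ^^ k) f x\<bar> \<le> C)"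

lemma higher_deriv_zero: "(deriv ^^ k) (\<lambda>x::real. 0) = (\<lambda>x. 0::real)"
  by (induction k) auto

lemma higher_deriv_add:
  fixes f g :: "real \<Rightarrow> real"
  assumes "\<And>k x. (deriv ^^ k) f field_differentiable (at x)"
    and "\<And>k x. (deriv ^^ k) g field_differentiable (at x)"
  shows "(deriv ^^ k) (\<lambda>x. f x + g x) = (\<lambda>x. (deriv ^^ k) f x + (deriv ^^ k) g x)"
proof (induction k)
  case (Suc k)
  have "(deriv ^^ Suc k) (\<lambda>x. f x + g x) = deriv (\<lambda>x. (deriv ^^ k) f x + (deriv ^^ k) g x)"
    by (simp only: funpow.simps o_def Suc.IH)
  also have "\<dots> = (\<lambda>x. deriv ((deriv ^^ k) f) x + deriv ((deriv ^^ k) g) x)"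
    by (intro ext deriv_add assms)
  finally show ?case by simp
qed simp

lemma higher_deriv_scale:
  fixes f :: "real \<Rightarrow> real"
  assumes "\<And>k x. (deriv ^^ k) f field_differentiable (at x)"
  shows "(deriv ^^ k) (\<lambda>x. c * f x) = (\<lambda>x. c * (deriv ^^ k) f x)"
proof (induction k)
  case (Suc k)
  have "(deriv ^^ Suc k) (\<lambda>x. c * f x) = deriv (\<lambda>x. c * (deriv ^^ k) f x)"
    by (simp only: funpow.simps o_def Suc.IH)
  also have "\<dots> = (\<lambda>x. c * deriv ((deriv ^^ k) f) x)"
    by (intro ext deriv_cmult assms)
  finally show ?case by simp
qed simp

lemma is_schwartz_zero: "is_schwartz (\<lambda>x. 0)"
  by (auto simp: is_schwartz_def higher_deriv_zero)

lemma is_schwartz_add: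
  assumes "is_schwartz f" "is_schwartz g"
  shows "is_schwartz (\<lambda>x. f x + g x)"
proof -
  have d: "(deriv ^^ k) f field_differentiable (at x)" "(deriv ^^ k) g field_differentiable (at x)"
    for k x using assms by (auto simp: is_schwartz_def)
  have "\<exists>C. \<forall>x. \<bar>x ^ j * ((deriv ^^ k) f x + (deriv ^^ k) g x)\<bar> \<le> C" for j k
  proof -
    obtain A B where A: "\<And>x. \<bar>x ^ j * (deriv ^^ k) f x\<bar> \<le> A"
      and B: "\<And>x. \<bar>x ^ j * (deriv ^^ k) g x\<bar> \<le> B"
      using assms unfolding is_schwartz_def by meson
    have "\<bar>x ^ j * ((deriv ^^ k) f x + (deriv ^^ k) g x)\<bar> \<le> A + B" for x
      using abs_triangle_ineq[of "x ^ j * (deriv ^^ k) f x" "x ^ j * (deriv ^^ k) g x"] A[of x] B[of x]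
      by (simp add: distrib_left)
    then show ?thesis by blast
  qed
  with d show ?thesis
    by (auto simp: is_schwartz_def higher_deriv_add intro!: field_differentiable_add)
qed

lemma is_schwartz_scale:
  assumes "is_schwartz f"
  shows "is_schwartz (\<lambda>x. c * f x)"
proof -
  have d: "(deriv ^^ k) f field_differentiable (at x)" for k x
    using assms by (auto simp: is_schwartz_def)
  have "\<exists>C. \<forall>x. \<bar>x ^ j * (c * (deriv ^^ k) f x)\<bar> \<le> C" for j k
  proof -
    obtain A where A: "\<And>x. \<bar>x ^ j * (deriv ^^ k) f x\<bar> \<le> A"
      using assms unfolding is_schwartz_def by meson
    have "\<bar>x ^ j * (c * (deriv ^^ k) f x)\<bar> \<le> \<bar>c\<bar> * A" for x
      using mult_left_mono[OF A[of x], of "\<bar>c\<bar>"] by (simp add: abs_mult mult_ac)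
    then show ?thesis by blast
  qed
  with d show ?thesis
    by (auto simp: is_schwartz_def higher_deriv_scale
        intro!: field_differentiable_mult field_differentiable_const)
qed

typedef schwartz = "{f. is_schwartz f}"
  using is_schwartz_zero by blast

setup_lifting type_definition_schwartz

instantiation schwartz :: real_vector
begin

lift_definition zero_schwartz :: schwartz is "\<lambda>x. 0"
  by (rule is_schwartz_zero)

lift_definition plus_schwartz :: "schwartz \<Rightarrow> schwartz \<Rightarrow> schwartz" is "\<lambda>f g x. f x + g x"
  by (rule is_schwartz_add)

lift_definition uminus_schwartz :: "schwartz \<Rightarrow> schwartz" is "\<lambda>f x. - f x"
  using is_schwartz_scale[of _ "-1"] by simp

lift_definition minus_schwartz :: "schwartz \<Rightarrow> schwartz \<Rightarrow> schwartz" is "\<lambda>f g x. f x - g x"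
  using is_schwartz_add is_schwartz_scale[of _ "-1"] by fastforce

lift_definition scaleR_schwartz :: "real \<Rightarrow> schwartz \<Rightarrow> schwartz" is "\<lambda>c f x. c * f x"
  by (rule is_schwartz_scale)

instance
  by standard (transfer; auto simp: algebra_simps)+

end

definition schwartz_seminorm :: "nat \<Rightarrow> nat \<Rightarrow> schwartz \<Rightarrow> real" where
  "schwartz_seminorm j k f = (SUP x. \<bar>x ^ j * (deriv ^^ k) (Rep_schwartz f) x\<bar>)"

instantiation schwartz :: topological_space
begin

definition open_schwartz :: "schwartz set \<Rightarrow> bool" where
  "open_schwartz U \<longleftrightarrow> (\<forall>f\<in>U. \<exists>N. \<exists>e>0. \<forall>g.
     (\<forall>j\<le>N. \<forall>k\<le>N. schwartz_seminorm j k (g - f) < e) \<longrightarrow> g \<in> U)"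

instance
proof
  show "open (UNIV :: schwartz set)"
    by (auto simp: open_schwartz_def intro: exI[of _ 1])
next
  fix S T :: "schwartz set"
  assume S: "open S" and T: "open T"
  show "open (S \<inter> T)"
    unfolding open_schwartz_def
  proof
    fix f assume f: "f \<in> S \<inter> T"
    obtain N e where e: "e > 0"
      "\<And>g. (\<forall>j\<le>N. \<forall>k\<le>N. schwartz_seminorm j k (g - f) < e) \<Longrightarrow> g \<in> S"
      using S f unfolding open_schwartz_def by blast
    obtain N' e' where e': "e' > 0"
      "\<And>g. (\<forall>j\<le>N'. \<forall>k\<le>N'. schwartz_seminorm j k (g - f) < e') \<Longrightarrow> g \<in> T"
      using T f unfolding open_schwartz_def by blast
    show "\<exists>N. \<exists>e>0. \<forall>g. (\<forall>j\<le>N. \<forall>k\<le>N. schwartz_seminorm j k (g - f) < e) \<longrightarrow> g \<in> S \<inter> T"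
      by (rule exI[of _ "max N N'"], rule exI[of _ "min e e'"]) (use e e' in auto)
  qed
next
  fix K :: "schwartz set set"
  assume K: "\<forall>S\<in>K. open S"
  show "open (\<Union>K)"
    unfolding open_schwartz_def
  proof
    fix f assume "f \<in> \<Union>K"
    then obtain S where S: "S \<in> K" "f \<in> S" by blast
    then obtain N e where "e > 0"
      "\<forall>g. (\<forall>j\<le>N. \<forall>k\<le>N. schwartz_seminorm j k (g - f) < e) \<longrightarrow> g \<in> S"
      using K unfolding open_schwartz_def by meson
    then show "\<exists>N. \<exists>e>0. \<forall>g. (\<forall>j\<le>N. \<forall>k\<le>N. schwartz_seminorm j k (g - f) < e) \<longrightarrow> g \<in> \<Union>K"
      using S(1) by (metis UnionI)
  qed
qed

end

definition tempered :: "(schwartz \<Rightarrow> real) set" where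
  "tempered = {\<omega>. linear \<omega> \<and> continuous_on UNIV \<omega>}"


section \<open>White noise space and the $m$-Brownian motion\<close>

text \<open>The topology of the function type is the product topology, whose trace on \<open>tempered\<close> is
  the weak-star topology. So \<open>restrict_space borel tempered\<close> is the weak-star Borel sigma-algebra
  of the dual space, which coincides with the strong one.\<close>

definition white_noise_measure :: "(schwartz \<Rightarrow> real) measure \<Rightarrow> bool" where
  "white_noise_measure P \<longleftrightarrow> prob_space P \<and>
     sets P = sets (restrict_space borel tempered) \<and>
     (\<forall>s. (\<integral>\<omega>. exp (\<i> * of_real (\<omega> s)) \<partial>P)
            = of_real (exp (- (L2_norm lborel (Rep_schwartz s))\<^sup>2 / 2)))"

text \<open>Extension of the isometry $s \mapsto Q_s$, $Q_s(\omega) = \omega(s)$, by density of the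
  Schwartz functions, first to real and then complex-linearly to complex $L_2$. The choice fixes
  a representative of the class of $Q_f$ modulo null sets.\<close>

definition Q_real :: "(schwartz \<Rightarrow> real) measure \<Rightarrow> (real \<Rightarrow> real) \<Rightarrow> (schwartz \<Rightarrow> real) \<Rightarrow> real" where
  "Q_real P f = (SOME X. \<exists>s :: nat \<Rightarrow> schwartz.
     tendsto_L2 lborel (\<lambda>n. Rep_schwartz (s n)) f \<and>
     tendsto_L2 P (\<lambda>n \<omega>. \<omega> (s n)) X)"

definition Q :: "(schwartz \<Rightarrow> real) measure \<Rightarrow> (real \<Rightarrow> complex) \<Rightarrow> (schwartz \<Rightarrow> real) \<Rightarrow> complex" where
  "Q P f \<omega> = of_real (Q_real P (\<lambda>x. Re (f x)) \<omega>) + \<i> * of_real (Q_real P (\<lambda>x. Im (f x)) \<omega>)"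

definition m_brownian ::
  "(schwartz \<Rightarrow> real) measure \<Rightarrow> (real \<Rightarrow> real) \<Rightarrow> real \<Rightarrow> (schwartz \<Rightarrow> real) \<Rightarrow> complex" where
  "m_brownian P m t = Q P (T_op m (I_fun t))"

end

theory Submission
  imports Defs
begin

text \<open>Since \<open>f \<mapsto> Q P f\<close> is an isometry and $T_m$ acts on the Fourier side as multiplication by
  $\sqrt m$, Parseval's identity turns the covariance of the process into
  $$\langle T_m I_t, T_m I_s \rangle = \frac{1}{2\pi} \int m(u)\,\widehat{I_t}(u)\,\overline{\widehat{I_s}(u)}\,du,
    \qquad \widehat{I_t}(u) = \frac{1 - e^{-itu}}{iu}.$$
  Expanding the product gives $(1 - e^{-itu} - e^{isu} + e^{i(s-t)u})/u^2$, and this is exactly what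
  the integrands of $r(s)$, $\overline{r(t)}$ and $r(s-t)$ contribute to $K_r(s,t)$: their compensating
  linear terms cancel, as they are additive in the time parameter (\<open>r_kernel_combination\<close>, \<open>T_op_inner_eq_K\<close>).
  The variance of an increment follows by expanding the square. The growth of
  $\mathrm{Re}\,r(t) = \frac{1}{2\pi}\int m(u)\,(1 - \cos tu)/u^2\,du$ follows from
  $(1 - \cos tu)/u^2 \le \min(t^2/2,\, 2/u^2)$. The minimum is at most $(t^2 + 4)/(u^2 + 1)$, which gives
  a multiple of $t^2 + 4$. If the tails $\int_{|u| > R} m/u^2$ are $O(1/R)$ and $|t| < 1$, splitting
  the integral at $|u| \approx 1/|t|$ replaces the constant term by a multiple of $|t|$
  (\<open>Re_r_fun_linear_bound\<close>).

  The operator $T_m$, the transform on $L_2$ and the map $Q$ are all given by choice, so the bulk of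
  the work is to show that the objects chosen exist. Three facts are needed.

  Parseval's identity on $L_2(\<real>)$ (\<open>Parseval\<close>). For two intervals it is an explicit
  computation based on $\int (1 - \cos tu)/u^2\,du = \pi |t|$, which is Dirichlet's integral after an
  integration by parts. It extends to step functions by bilinearity and to $L_2$ by density
  (\<open>step_functions_dense\<close>) and completeness (\<open>L2_complete\<close>).

  Surjectivity of the transform (\<open>fourier_L2_surj\<close>), which makes $T_m I_t$ exist. The candidate for
  the preimage of $F$ is, up to the factor $2\pi$, the conjugate of the transform of $\overline F$. The multiplication formula
  $\int \widehat f g = \int f \widehat g$ shows that the error is orthogonal to the transforms of all
  intervals, and such a function vanishes by Parseval's identity again.

  The isometry of $Q$ (\<open>Q_isometry\<close>). The characteristic functional determines the law of
  $\omega \mapsto \omega(s)$ as a centred Gaussian of variance $\|s\|^2$, and the Schwartz functions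
  are dense (\<open>schwartz_dense\<close>), because the convolution of the indicator of an interval with a
  narrow Gaussian is a Schwartz function.\<close>

section \<open>Norms, limits and completeness in $L_2$\<close>

lemma L2_D:
  assumes "f \<in> L2 M"
  shows "f \<in> borel_measurable M" "integrable M (\<lambda>x. (norm (f x))\<^sup>2)"
  using assms by (auto simp: L2_def)

lemma L2_I:
  "f \<in> borel_measurable M \<Longrightarrow> integrable M (\<lambda>x. (norm (f x))\<^sup>2) \<Longrightarrow> f \<in> L2 M"
  by (auto simp: L2_def)

lemma L2_bound:
  fixes f :: "'a \<Rightarrow> 'b::euclidean_space" and g :: "'a \<Rightarrow> 'c::euclidean_space"
  assumes "g \<in> L2 M" "f \<in> borel_measurable M" "AE x in M. norm (f x) \<le> C * norm (g x)"
  shows "f \<in> L2 M"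
proof (rule L2_I)
  note [measurable] = assms(2) L2_D(1)[OF assms(1)]
  show "integrable M (\<lambda>x. (norm (f x))\<^sup>2)"
  proof (rule Bochner_Integration.integrable_bound)
    show "integrable M (\<lambda>x. C\<^sup>2 * (norm (g x))\<^sup>2)"
      using L2_D(2)[OF assms(1)] by simp
    show "AE x in M. norm ((norm (f x))\<^sup>2) \<le> norm (C\<^sup>2 * (norm (g x))\<^sup>2)"
      using assms(3)
    proof eventually_elim
      case (elim x)
      have "(norm (f x))\<^sup>2 \<le> (C * norm (g x))\<^sup>2"
        using elim by (intro power_mono) auto
      then show ?case by (simp add: power_mult_distrib)
    qed
  qed measurable
qed (fact assms(2))

lemma L2_zero [simp]: "(\<lambda>x. 0) \<in> L2 M"
  by (simp add: L2_def)

lemma L2_add: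
  assumes "f \<in> L2 M" "g \<in> L2 M"
  shows "(\<lambda>x. f x + g x) \<in> L2 M"
proof (rule L2_I)
  note [measurable] = L2_D(1)[OF assms(1)] L2_D(1)[OF assms(2)]
  show "(\<lambda>x. f x + g x) \<in> borel_measurable M" by measurable
  show "integrable M (\<lambda>x. (norm (f x + g x))\<^sup>2)"
  proof (rule Bochner_Integration.integrable_bound)
    show "integrable M (\<lambda>x. 2 * (norm (f x))\<^sup>2 + 2 * (norm (g x))\<^sup>2)"
      using L2_D(2)[OF assms(1)] L2_D(2)[OF assms(2)] by simp
    show "AE x in M. norm ((norm (f x + g x))\<^sup>2) \<le> norm (2 * (norm (f x))\<^sup>2 + 2 * (norm (g x))\<^sup>2)"
    proof (rule AE_I2)
      fix x
      have "(norm (f x + g x))\<^sup>2 \<le> (norm (f x) + norm (g x))\<^sup>2"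
        by (intro power_mono norm_triangle_ineq) simp
      also have "\<dots> \<le> 2 * (norm (f x))\<^sup>2 + 2 * (norm (g x))\<^sup>2"
        using sum_squares_bound[of "norm (f x)" "norm (g x)"] by (simp add: power2_sum)
      finally show "norm ((norm (f x + g x))\<^sup>2) \<le> norm (2 * (norm (f x))\<^sup>2 + 2 * (norm (g x))\<^sup>2)"
        by simp
    qed
  qed measurable
qed

lemma L2_linear_image:
  assumes "bounded_linear h" "f \<in> L2 M"
  shows "(\<lambda>x. h (f x)) \<in> L2 M"
proof -
  obtain K where K: "\<And>x. norm (h x) \<le> norm x * K"
    using bounded_linear.bounded[OF assms(1)] by blast
  note [measurable] = L2_D(1)[OF assms(2)] 
  have [measurable]: "h \<in> borel_measurable borel"
    by (intro borel_measurable_continuous_onI bounded_linear.continuous_on[OF assms(1)] continuous_on_id)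
  show ?thesis
    by (rule L2_bound[OF assms(2), where C=K]) (use K in \<open>auto simp: mult.commute\<close>)
qed

lemma L2_minus: "f \<in> L2 M \<Longrightarrow> (\<lambda>x. - f x) \<in> L2 M"
  by (rule L2_linear_image) (intro bounded_linear_minus bounded_linear_ident)

lemma L2_diff: "f \<in> L2 M \<Longrightarrow> g \<in> L2 M \<Longrightarrow> (\<lambda>x. f x - g x) \<in> L2 M"
  using L2_add[OF _ L2_minus] by fastforce

lemma L2_cmult:
  fixes c :: "'b::{real_normed_algebra,euclidean_space}"
  shows "f \<in> L2 M \<Longrightarrow> (\<lambda>x. c * f x) \<in> L2 M"
  by (rule L2_linear_image) (rule bounded_linear_mult_right)

lemma L2_cnj: "f \<in> L2 M \<Longrightarrow> (\<lambda>x. cnj (f x)) \<in> L2 M"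
  by (rule L2_linear_image) (rule bounded_linear_cnj)

lemma L2_Re: "f \<in> L2 M \<Longrightarrow> (\<lambda>x. Re (f x)) \<in> L2 M"
  by (rule L2_linear_image) (rule bounded_linear_Re)

lemma L2_Im: "f \<in> L2 M \<Longrightarrow> (\<lambda>x. Im (f x)) \<in> L2 M"
  by (rule L2_linear_image) (rule bounded_linear_Im)

lemma L2_of_real: "f \<in> L2 M \<Longrightarrow> (\<lambda>x. complex_of_real (f x)) \<in> L2 M"
  by (rule L2_linear_image) (rule bounded_linear_of_real)

lemma L2_indicator_mult:
  fixes f :: "'a \<Rightarrow> 'b::{real_normed_algebra_1,euclidean_space}"
  assumes "f \<in> L2 M" "A \<in> sets M"
  shows "(\<lambda>x. indicator A x * f x) \<in> L2 M"
  using assms L2_D(1)[OF assms(1)]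
  by (intro L2_bound[OF assms(1), where C=1]) (auto simp: indicator_def)

lemma L2_norm_nonneg [simp]: "0 \<le> L2_norm M f"
  by (simp add: L2_norm_def)

lemma L2_norm_sq: "(L2_norm M f)\<^sup>2 = (\<integral>x. (norm (f x))\<^sup>2 \<partial>M)"
  by (simp add: L2_norm_def)

lemma nn_integral_L2_norm:
  "f \<in> L2 M \<Longrightarrow> (\<integral>\<^sup>+x. ennreal ((norm (f x))\<^sup>2) \<partial>M) = ennreal ((L2_norm M f)\<^sup>2)"
  unfolding L2_norm_sq by (intro nn_integral_eq_integral L2_D(2)) auto

lemma L2_norm_mono:
  assumes "g \<in> L2 M" "f \<in> borel_measurable M" "AE x in M. norm (f x) \<le> norm (g x)"
  shows "L2_norm M f \<le> L2_norm M g"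
proof -
  have f: "f \<in> L2 M" by (rule L2_bound[OF assms(1,2), where C=1]) (use assms(3) in simp)
  show ?thesis
    unfolding L2_norm_def
    by (intro real_sqrt_le_mono integral_mono_AE L2_D(2) f assms(1))
      (use assms(3) in \<open>auto elim!: eventually_mono intro: power_mono\<close>)
qed

lemma L2_norm_cong_norm:
  assumes "AE x in M. norm (f x) = norm (g x)" "f \<in> borel_measurable M" "g \<in> borel_measurable M"
  shows "L2_norm M f = L2_norm M g"
  unfolding L2_norm_def using assms
  by (intro arg_cong[where f=sqrt] integral_cong_AE) (auto elim!: eventually_mono)

lemma ennreal_power2_le_imp_le:
  fixes a b :: ennreal
  assumes "a\<^sup>2 \<le> b\<^sup>2"
  shows "a \<le> b"
proof (cases b)
  case (real y)
  note y = this
  show ?thesis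
  proof (cases a)
    case (real x)
    have "x\<^sup>2 \<le> y\<^sup>2" using assms real y by (simp add: ennreal_power ennreal_le_iff)
    then have "x \<le> y" by (rule power2_le_imp_le) (use y in simp)
    then show ?thesis using real y by (simp add: ennreal_leI)
  next
    case top
    then have "(\<infinity>::ennreal) \<le> ennreal (y\<^sup>2)" using assms y by (simp add: ennreal_power top_power_ennreal)
    then show ?thesis by (simp add: top_unique)
  qed
qed simp

lemma ennreal_le_suminf: "a k \<le> (\<Sum>k. a k)" for a :: "nat \<Rightarrow> ennreal"
proof -
  have "sum a {k} \<le> suminf a" by (rule sum_le_suminf) auto
  then show ?thesis by simp
qed

lemma L2_Cauchy_Schwarz:
  fixes f :: "'a \<Rightarrow> 'b::euclidean_space" and g :: "'a \<Rightarrow> 'c::euclidean_space"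
  assumes f: "f \<in> L2 M" and g: "g \<in> L2 M"
  shows "integrable M (\<lambda>x. norm (f x) * norm (g x))"
    and "(\<integral>x. norm (f x) * norm (g x) \<partial>M) \<le> L2_norm M f * L2_norm M g"
proof -
  note [measurable] = L2_D(1)[OF f] L2_D(1)[OF g]
  have "(\<integral>\<^sup>+x. ennreal (norm (f x)) * ennreal (norm (g x)) \<partial>M)\<^sup>2
      \<le> (\<integral>\<^sup>+x. (ennreal (norm (f x)))\<^sup>2 \<partial>M) * (\<integral>\<^sup>+x. (ennreal (norm (g x)))\<^sup>2 \<partial>M)"
    by (rule Cauchy_Schwarz_nn_integral) measurable
  also have "\<dots> = ennreal ((L2_norm M f)\<^sup>2) * ennreal ((L2_norm M g)\<^sup>2)"
    by (simp add: ennreal_power nn_integral_L2_norm f g)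
  also have "\<dots> = (ennreal (L2_norm M f * L2_norm M g))\<^sup>2"
    by (simp add: ennreal_power ennreal_mult[symmetric] power_mult_distrib)
  finally have le: "(\<integral>\<^sup>+x. ennreal (norm (f x) * norm (g x)) \<partial>M) \<le> ennreal (L2_norm M f * L2_norm M g)"
    by (simp add: ennreal_mult ennreal_power2_le_imp_le)
  have [measurable]: "(\<lambda>x. norm (f x) * norm (g x)) \<in> borel_measurable M" by measurable
  show int: "integrable M (\<lambda>x. norm (f x) * norm (g x))"
    using le by (intro integrableI_bounded) (auto intro: le_less_trans)
  show "(\<integral>x. norm (f x) * norm (g x) \<partial>M) \<le> L2_norm M f * L2_norm M g"
    using le nn_integral_eq_integral[OF int] by simp
qed

lemma L2_norm_triangle:
  assumes f: "f \<in> L2 M" and g: "g \<in> L2 M"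
  shows "L2_norm M (\<lambda>x. f x + g x) \<le> L2_norm M f + L2_norm M g"
proof (rule power2_le_imp_le)
  note int = L2_D(2)[OF f] L2_D(2)[OF g] L2_Cauchy_Schwarz(1)[OF f g]
  have "(L2_norm M (\<lambda>x. f x + g x))\<^sup>2
      \<le> (\<integral>x. (norm (f x))\<^sup>2 + (norm (g x))\<^sup>2 + 2 * (norm (f x) * norm (g x)) \<partial>M)"
    unfolding L2_norm_sq
  proof (intro integral_mono)
    fix x
    show "(norm (f x + g x))\<^sup>2 \<le> (norm (f x))\<^sup>2 + (norm (g x))\<^sup>2 + 2 * (norm (f x) * norm (g x))"
      using power_mono[OF norm_triangle_ineq[of "f x" "g x"], of 2] by (simp add: power2_sum)
  qed (use int L2_D(2)[OF L2_add[OF f g]] in auto)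
  also have "\<dots> = (L2_norm M f)\<^sup>2 + (L2_norm M g)\<^sup>2 + 2 * (\<integral>x. norm (f x) * norm (g x) \<partial>M)"
    using int by (simp add: L2_norm_sq)
  also have "\<dots> \<le> (L2_norm M f + L2_norm M g)\<^sup>2"
    using L2_Cauchy_Schwarz(2)[OF f g] by (simp add: power2_sum)
  finally show "(L2_norm M (\<lambda>x. f x + g x))\<^sup>2 \<le> (L2_norm M f + L2_norm M g)\<^sup>2" .
qed simp

lemma L2_norm_minus_commute: "L2_norm M (\<lambda>x. f x - g x) = L2_norm M (\<lambda>x. g x - f x)"
  by (simp add: L2_norm_def norm_minus_commute)

lemma L2_norm_triangle_diff:
  assumes "f \<in> L2 M" "g \<in> L2 M" "h \<in> L2 M"
  shows "L2_norm M (\<lambda>x. f x - h x) \<le> L2_norm M (\<lambda>x. f x - g x) + L2_norm M (\<lambda>x. g x - h x)"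
  using L2_norm_triangle[OF L2_diff[OF assms(1,2)] L2_diff[OF assms(2,3)]] by simp

lemma L2_integrable_bilinear:
  fixes b :: "'b::euclidean_space \<Rightarrow> 'c::euclidean_space \<Rightarrow> 'd::euclidean_space"
  assumes b: "bounded_bilinear b" and f: "f \<in> L2 M" and g: "g \<in> L2 M"
  shows "integrable M (\<lambda>x. b (f x) (g x))"
proof -
  interpret bounded_bilinear b by fact
  obtain K where K: "\<And>a c. norm (b a c) \<le> norm a * norm c * K"
    using bounded by blast
  have "integrable M (\<lambda>x. (norm (f x) * norm (g x)) * K)"
    using L2_Cauchy_Schwarz(1)[OF f g] by simp
  then show ?thesis
  proof (rule Bochner_Integration.integrable_bound)
    show "(\<lambda>x. b (f x) (g x)) \<in> borel_measurable M"
      by (rule borel_measurable_continuous_Pair[OF L2_D(1)[OF f] L2_D(1)[OF g]])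
        (intro continuous_on continuous_on_fst continuous_on_snd continuous_on_id)
    show "AE x in M. norm (b (f x) (g x)) \<le> norm (norm (f x) * norm (g x) * K)"
      using K by (auto intro!: AE_I2 order_trans[OF K])
  qed
qed

text \<open>One bound serves the real product, the complex product and the Hermitian product
  $a\,\overline b$.\<close>

lemma L2_integral_bilinear_bound:
  fixes b :: "'b::euclidean_space \<Rightarrow> 'c::euclidean_space \<Rightarrow> 'd::euclidean_space"
  assumes b: "bounded_bilinear b" and K: "\<And>a c. norm (b a c) \<le> norm a * norm c * K"
    and f: "f \<in> L2 M" and g: "g \<in> L2 M"
  shows "norm (\<integral>x. b (f x) (g x) \<partial>M) \<le> L2_norm M f * L2_norm M g * \<bar>K\<bar>"
proof -
  have "norm (\<integral>x. b (f x) (g x) \<partial>M) \<le> (\<integral>x. norm (f x) * norm (g x) * \<bar>K\<bar> \<partial>M)"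
  proof (rule order_trans[OF integral_norm_bound integral_mono])
    show "norm (b (f x) (g x)) \<le> norm (f x) * norm (g x) * \<bar>K\<bar>" for x
      using K[of "f x" "g x"] by (rule order_trans) (simp add: mult_left_mono)
  qed (use L2_integrable_bilinear[OF b f g] L2_Cauchy_Schwarz(1)[OF f g] in auto)
  also have "\<dots> \<le> L2_norm M f * L2_norm M g * \<bar>K\<bar>"
    using L2_Cauchy_Schwarz(2)[OF f g] by (simp add: mult_right_mono)
  finally show ?thesis .
qed

lemma tendsto_L2_D:
  assumes "tendsto_L2 M F f"
  shows "F n \<in> L2 M" "f \<in> L2 M" "(\<lambda>n. L2_norm M (\<lambda>x. F n x - f x)) \<longlonglongrightarrow> 0"
  using assms by (auto simp: tendsto_L2_def)

lemma tendsto_L2_I: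
  assumes "\<And>n. F n \<in> L2 M" "f \<in> L2 M"
    and "B \<longlonglongrightarrow> 0" "eventually (\<lambda>n. L2_norm M (\<lambda>x. F n x - f x) \<le> B n) sequentially"
  shows "tendsto_L2 M F f"
  unfolding tendsto_L2_def
  by (intro conjI allI assms(1,2) tendsto_sandwich[OF _ assms(4) tendsto_const assms(3)]) auto

lemma tendsto_L2_const: "f \<in> L2 M \<Longrightarrow> tendsto_L2 M (\<lambda>_. f) f"
  by (simp add: tendsto_L2_def L2_norm_def)

lemma tendsto_L2_linear_image:
  assumes h: "bounded_linear h" and F: "tendsto_L2 M F f"
  shows "tendsto_L2 M (\<lambda>n x. h (F n x)) (\<lambda>x. h (f x))"
proof -
  obtain K where K: "\<And>x. norm (h x) \<le> norm x * K" "K > 0"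
    using bounded_linear.pos_bounded[OF h] by blast
  note F' = tendsto_L2_D[OF F]
  have d: "(\<lambda>x. F n x - f x) \<in> L2 M" for n by (intro L2_diff F')
  show ?thesis
  proof (rule tendsto_L2_I)
    show "(\<lambda>n. K * L2_norm M (\<lambda>x. F n x - f x)) \<longlonglongrightarrow> 0"
      using tendsto_mult_right_zero[OF F'(3)] by (simp add: mult.commute)
    show "\<forall>\<^sub>F n in sequentially. L2_norm M (\<lambda>x. h (F n x) - h (f x)) \<le> K * L2_norm M (\<lambda>x. F n x - f x)"
    proof (rule always_eventually, rule allI)
      fix n
      have "L2_norm M (\<lambda>x. h (F n x) - h (f x)) \<le> L2_norm M (\<lambda>x. K *\<^sub>R (F n x - f x))"
        by (rule L2_norm_mono)
          (use K F' d h in \<open>auto intro!: L2_linear_image[OF bounded_linear_scaleR_right]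
            L2_D(1)[OF L2_linear_image[OF h d]]
            simp: linear_diff[OF bounded_linear.linear[OF h], symmetric] mult.commute\<close>)
      also have "\<dots> = K * L2_norm M (\<lambda>x. F n x - f x)"
        using K(2) by (simp add: L2_norm_def power_mult_distrib real_sqrt_mult)
      finally show "L2_norm M (\<lambda>x. h (F n x) - h (f x)) \<le> K * L2_norm M (\<lambda>x. F n x - f x)" .
    qed
  qed (intro L2_linear_image[OF h] F')+
qed

lemma tendsto_L2_add:
  assumes F: "tendsto_L2 M F f" and G: "tendsto_L2 M G g"
  shows "tendsto_L2 M (\<lambda>n x. F n x + G n x) (\<lambda>x. f x + g x)"
proof (rule tendsto_L2_I)
  note F' = tendsto_L2_D[OF F] and G' = tendsto_L2_D[OF G]
  show "(\<lambda>n. L2_norm M (\<lambda>x. F n x - f x) + L2_norm M (\<lambda>x. G n x - g x)) \<longlonglongrightarrow> 0"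
    using tendsto_add_zero[OF F'(3) G'(3)] .
  show "\<forall>\<^sub>F n in sequentially. L2_norm M (\<lambda>x. F n x + G n x - (f x + g x))
      \<le> L2_norm M (\<lambda>x. F n x - f x) + L2_norm M (\<lambda>x. G n x - g x)"
    using L2_norm_triangle[OF L2_diff[OF F'(1,2)] L2_diff[OF G'(1,2)]]
    by (auto simp: algebra_simps)
qed (intro L2_add tendsto_L2_D[OF F] tendsto_L2_D[OF G])+

lemma tendsto_L2_norm:
  assumes "tendsto_L2 M F f"
  shows "(\<lambda>n. L2_norm M (F n)) \<longlonglongrightarrow> L2_norm M f"
proof (rule LIM_zero_cancel, rule Lim_null_comparison)
  note F = tendsto_L2_D[OF assms]
  show "(\<lambda>n. L2_norm M (\<lambda>x. F n x - f x)) \<longlonglongrightarrow> 0" by fact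
  have "L2_norm M (F n) \<le> L2_norm M (\<lambda>x. F n x - f x) + L2_norm M f" for n
    using L2_norm_triangle[OF L2_diff[OF F(1,2)] F(2)] by simp
  moreover have "L2_norm M f \<le> L2_norm M (\<lambda>x. F n x - f x) + L2_norm M (F n)" for n
    using L2_norm_triangle[OF L2_diff[OF F(2) F(1)] F(1), of n n] by (simp add: L2_norm_minus_commute)
  ultimately show "\<forall>\<^sub>F n in sequentially. norm (L2_norm M (F n) - L2_norm M f)
      \<le> L2_norm M (\<lambda>x. F n x - f x)"
    by (intro always_eventually allI) (auto simp: abs_le_iff algebra_simps)
qed

lemma tendsto_L2_bilinear:
  fixes b :: "'b::euclidean_space \<Rightarrow> 'c::euclidean_space \<Rightarrow> 'd::euclidean_space"
  assumes b: "bounded_bilinear b" and F: "tendsto_L2 M F f" and G: "tendsto_L2 M G g"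
  shows "(\<lambda>n. \<integral>x. b (F n x) (G n x) \<partial>M) \<longlonglongrightarrow> (\<integral>x. b (f x) (g x) \<partial>M)"
proof -
  note F' = tendsto_L2_D[OF F] and G' = tendsto_L2_D[OF G]
  obtain K where K: "\<And>a c. norm (b a c) \<le> norm a * norm c * K"
    using bounded_bilinear.bounded[OF b] by blast
  note bound = L2_integral_bilinear_bound[OF b K] and int = L2_integrable_bilinear[OF b]
  have "\<forall>\<^sub>F n in sequentially. norm ((\<integral>x. b (F n x) (G n x) \<partial>M) - (\<integral>x. b (f x) (g x) \<partial>M))
    \<le> L2_norm M (\<lambda>x. F n x - f x) * L2_norm M (G n) * \<bar>K\<bar> + L2_norm M f * L2_norm M (\<lambda>x. G n x - g x) * \<bar>K\<bar>"
  proof (rule always_eventually, rule allI)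
    fix n
    have "(\<integral>x. b (F n x) (G n x) \<partial>M) - (\<integral>x. b (f x) (g x) \<partial>M)
      = (\<integral>x. b (F n x - f x) (G n x) \<partial>M) + (\<integral>x. b (f x) (G n x - g x) \<partial>M)"
      by (simp add: int F' G' bounded_bilinear.diff_left[OF b] bounded_bilinear.diff_right[OF b])
    also have "norm \<dots> \<le> norm (\<integral>x. b (F n x - f x) (G n x) \<partial>M) + norm (\<integral>x. b (f x) (G n x - g x) \<partial>M)"
      by (rule norm_triangle_ineq)
    also have "\<dots> \<le> L2_norm M (\<lambda>x. F n x - f x) * L2_norm M (G n) * \<bar>K\<bar>
        + L2_norm M f * L2_norm M (\<lambda>x. G n x - g x) * \<bar>K\<bar>"
      by (intro add_mono bound L2_diff F' G')
    finally show "norm ((\<integral>x. b (F n x) (G n x) \<partial>M) - (\<integral>x. b (f x) (g x) \<partial>M)) \<le> \<dots>" .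
  qed
  moreover have "(\<lambda>n. L2_norm M (\<lambda>x. F n x - f x) * L2_norm M (G n) * \<bar>K\<bar>
        + L2_norm M f * L2_norm M (\<lambda>x. G n x - g x) * \<bar>K\<bar>)
      \<longlonglongrightarrow> 0 * L2_norm M g * \<bar>K\<bar> + L2_norm M f * 0 * \<bar>K\<bar>"
    by (intro tendsto_intros F' G' tendsto_L2_norm[OF G])
  ultimately show ?thesis by (simp only: mult_zero_left mult_zero_right add_0_left) (rule LIM_zero_cancel[OF Lim_null_comparison])
qed

lemma L2_norm_zero_AE:
  assumes "f \<in> L2 M" "L2_norm M f = 0"
  shows "AE x in M. f x = 0"
proof -
  have "(\<integral>x. (norm (f x))\<^sup>2 \<partial>M) = 0" using assms(2) by (simp add: L2_norm_def)
  then have "AE x in M. (norm (f x))\<^sup>2 = 0"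
    using integral_nonneg_eq_0_iff_AE[OF L2_D(2)[OF assms(1)]] by simp
  then show ?thesis by simp
qed

lemma L2_Fatou:
  assumes F: "\<And>n. F n \<in> L2 M" and h: "h \<in> borel_measurable M"
    and lim: "AE x in M. (\<lambda>n. F n x) \<longlonglongrightarrow> h x"
    and B: "eventually (\<lambda>n. L2_norm M (F n) \<le> B) sequentially" "0 \<le> B"
  shows "h \<in> L2 M" "L2_norm M h \<le> B"
proof -
  note [measurable] = L2_D(1)[OF F] h
  have "(\<integral>\<^sup>+x. ennreal ((norm (h x))\<^sup>2) \<partial>M) = (\<integral>\<^sup>+x. liminf (\<lambda>n. ennreal ((norm (F n x))\<^sup>2)) \<partial>M)"
  proof (rule nn_integral_cong_AE)
    show "AE x in M. ennreal ((norm (h x))\<^sup>2) = liminf (\<lambda>n. ennreal ((norm (F n x))\<^sup>2))"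
      using lim
    proof eventually_elim
      case (elim x)
      have "(\<lambda>n. ennreal ((norm (F n x))\<^sup>2)) \<longlonglongrightarrow> ennreal ((norm (h x))\<^sup>2)"
        by (intro tendsto_ennrealI tendsto_intros elim)
      then show ?case by (rule lim_imp_Liminf[OF sequentially_bot, symmetric])
    qed
  qed
  also have "\<dots> \<le> liminf (\<lambda>n. \<integral>\<^sup>+x. ennreal ((norm (F n x))\<^sup>2) \<partial>M)"
    by (rule nn_integral_liminf) measurable
  also have "\<dots> \<le> ennreal (B\<^sup>2)"
  proof -
    have "\<forall>\<^sub>F n in sequentially. (\<integral>\<^sup>+x. ennreal ((norm (F n x))\<^sup>2) \<partial>M) \<le> ennreal (B\<^sup>2)"
      using B(1) by eventually_elim (simp add: nn_integral_L2_norm F power_mono)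
    then have "liminf (\<lambda>n. \<integral>\<^sup>+x. ennreal ((norm (F n x))\<^sup>2) \<partial>M) \<le> liminf (\<lambda>n::nat. ennreal (B\<^sup>2))"
      by (rule Liminf_mono)
    then show ?thesis by (simp add: Liminf_const)
  qed
  finally have le: "(\<integral>\<^sup>+x. ennreal ((norm (h x))\<^sup>2) \<partial>M) \<le> ennreal (B\<^sup>2)" .
  show hL: "h \<in> L2 M"
    using le by (intro L2_I h integrableI_bounded) (auto intro: le_less_trans)
  have "(L2_norm M h)\<^sup>2 \<le> B\<^sup>2"
    using le nn_integral_L2_norm[OF hL] by simp
  then show "L2_norm M h \<le> B" using B(2) by (rule power2_le_imp_le)
qed

text \<open>Applying Fatou's lemma to $F_n - f$ avoids passing to an almost everywhere convergent
  subsequence.\<close>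

lemma tendsto_L2_pointwise_AE:
  assumes F: "tendsto_L2 M F f" and g: "g \<in> borel_measurable M"
    and lim: "AE x in M. (\<lambda>n. F n x) \<longlonglongrightarrow> g x"
  shows "AE x in M. f x = g x"
proof -
  note F' = tendsto_L2_D[OF F]
  have m: "(\<lambda>x. g x - f x) \<in> borel_measurable M"
    using g L2_D(1)[OF F'(2)] by measurable
  have l: "AE x in M. (\<lambda>n. F n x - f x) \<longlonglongrightarrow> g x - f x"
    using lim by eventually_elim (intro tendsto_intros)
  have d: "(\<lambda>x. F n x - f x) \<in> L2 M" for n by (intro L2_diff F')
  have gf: "(\<lambda>x. g x - f x) \<in> L2 M"
    and le: "L2_norm M (\<lambda>x. g x - f x) \<le> e" if "e > 0" for e
    using L2_Fatou[OF d m l, of e] that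
      eventually_mono[OF order_tendstoD(2)[OF F'(3) \<open>e > 0\<close>], of "\<lambda>n. L2_norm M (\<lambda>x. F n x - f x) \<le> e"]
    by auto
  have "L2_norm M (\<lambda>x. g x - f x) = 0"
    using le by (metis L2_norm_nonneg antisym_conv2 dense not_le)
  then show ?thesis using L2_norm_zero_AE[OF gf[OF zero_less_one]] by (auto elim!: eventually_mono)
qed

lemma tendsto_L2_dominated:
  fixes f :: "'a \<Rightarrow> 'b::euclidean_space"
  assumes F: "\<And>n. F n \<in> borel_measurable M" and w: "w \<in> L2 M" and f: "f \<in> borel_measurable M"
    and lim: "AE x in M. (\<lambda>n. F n x) \<longlonglongrightarrow> f x"
    and dom: "\<And>n. AE x in M. norm (F n x) \<le> norm (w x)"
  shows "tendsto_L2 M F f"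
proof -
  note [measurable] = F f L2_D(1)[OF w]
  have FL: "F n \<in> L2 M" for n
    by (rule L2_bound[OF w F, where C=1]) (use dom in simp)
  have domf: "AE x in M. norm (f x) \<le> norm (w x)"
  proof -
    have "AE x in M. \<forall>n. norm (F n x) \<le> norm (w x)" using dom by (simp add: AE_all_countable)
    then show ?thesis using lim
      by eventually_elim (auto intro!: tendsto_le[OF _ tendsto_const tendsto_norm])
  qed
  have fL: "f \<in> L2 M"
    by (rule L2_bound[OF w f, where C=1]) (use domf in simp)
  have "(\<lambda>n. \<integral>x. (norm (F n x - f x))\<^sup>2 \<partial>M) \<longlonglongrightarrow> (\<integral>x. 0 \<partial>M)"
  proof (rule integral_dominated_convergence)
    show "integrable M (\<lambda>x. 4 * (norm (w x))\<^sup>2)" using L2_D(2)[OF w] by simp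
    show "AE x in M. (\<lambda>n. (norm (F n x - f x))\<^sup>2) \<longlonglongrightarrow> 0"
      using lim
    proof eventually_elim
      case (elim x)
      then have "(\<lambda>n. (norm (F n x - f x))\<^sup>2) \<longlonglongrightarrow> (norm (f x - f x))\<^sup>2" by (intro tendsto_intros)
      then show ?case by simp
    qed
    show "AE x in M. norm ((norm (F n x - f x))\<^sup>2) \<le> 4 * (norm (w x))\<^sup>2" for n
      using dom[of n] domf
    proof eventually_elim
      case (elim x)
      have "(norm (F n x - f x))\<^sup>2 \<le> (2 * norm (w x))\<^sup>2"
        using elim norm_triangle_ineq4[of "F n x" "f x"] by (intro power_mono) auto
      then show ?case by (simp add: power_mult_distrib)
    qed
  qed measurable
  then have "(\<lambda>n. sqrt (\<integral>x. (norm (F n x - f x))\<^sup>2 \<partial>M)) \<longlonglongrightarrow> sqrt 0"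
    by (intro tendsto_real_sqrt) simp
  then show ?thesis by (simp add: tendsto_L2_def L2_norm_def FL fL)
qed

lemma L2_Cauchy_of_tendsto:
  assumes F: "tendsto_L2 M F f" and "e > 0"
  shows "\<exists>N. \<forall>n\<ge>N. \<forall>k\<ge>N. L2_norm M (\<lambda>x. F n x - F k x) < e"
proof -
  note F' = tendsto_L2_D[OF F]
  obtain N where N: "\<And>n. n \<ge> N \<Longrightarrow> L2_norm M (\<lambda>x. F n x - f x) < e/2"
    using order_tendstoD(2)[OF F'(3), of "e/2"] \<open>e > 0\<close> by (auto simp: eventually_sequentially)
  have "L2_norm M (\<lambda>x. F n x - F k x) < e" if "n \<ge> N" "k \<ge> N" for n k
    using L2_norm_triangle_diff[OF F'(1,2,1), of n k] N[OF that(1)] N[OF that(2)]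
      L2_norm_minus_commute[of M f "F k"] by simp
  then show ?thesis by blast
qed

text \<open>Along a subsequence with $\|F_{r(k+1)} - F_{r(k)}\|^2 \le 8^{-k}$ the series
  $\sum_k 4^k |F_{r(k+1)} - F_{r(k)}|^2$ has finite integral, hence is finite almost everywhere,
  which forces pointwise convergence at a geometric rate; Fatou's lemma turns the pointwise limit
  into a limit in norm.\<close>

lemma L2_complete:
  fixes F :: "nat \<Rightarrow> 'a \<Rightarrow> 'b::euclidean_space"
  assumes F: "\<And>n. F n \<in> L2 M"
    and Cauchy: "\<And>e. e > 0 \<Longrightarrow> \<exists>N. \<forall>n\<ge>N. \<forall>k\<ge>N. L2_norm M (\<lambda>x. F n x - F k x) < e"
  shows "\<exists>f. tendsto_L2 M F f"
proof -
  note [measurable] = L2_D(1)[OF F]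
  have "\<exists>N. \<forall>k. (\<forall>n\<ge>N k. \<forall>j\<ge>N k. L2_norm M (\<lambda>x. F n x - F j x) < sqrt ((1/8)^k))"
    by (intro choice allI Cauchy) simp
  then obtain N where N: "\<And>k n j. n \<ge> N k \<Longrightarrow> j \<ge> N k \<Longrightarrow> L2_norm M (\<lambda>x. F n x - F j x) < sqrt ((1/8)^k)"
    by blast
  \<comment> \<open>the sum makes $r(k)$ and $r(k+1)$ both exceed the threshold $N_k$; the summand $k$ makes $r$ unbounded\<close>
  define r where "r k = k + (\<Sum>i\<le>k. N i)" for k
  have r: "r k \<ge> N k" "r k \<ge> k" for k
    unfolding r_def using member_le_sum[of k "{..k}" N] by auto
  have rS: "r (Suc k) \<ge> N k" for k
    unfolding r_def using member_le_sum[of k "{..Suc k}" N] by auto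
  define d where "d k x = F (r (Suc k)) x - F (r k) x" for k x
  have [measurable]: "d k \<in> borel_measurable M" for k unfolding d_def by measurable
  have dL: "d k \<in> L2 M" for k unfolding d_def by (intro L2_diff F)
  have dn: "(L2_norm M (d k))\<^sup>2 \<le> (1/8)^k" for k
    using N[OF rS r(1), of k] unfolding d_def[symmetric]
    by (metis L2_norm_nonneg less_imp_le real_sqrt_le_iff real_sqrt_unique)
  have "(\<integral>\<^sup>+x. (\<Sum>k. ennreal (4^k * (norm (d k x))\<^sup>2)) \<partial>M)
      = (\<Sum>k. \<integral>\<^sup>+x. ennreal (4^k * (norm (d k x))\<^sup>2) \<partial>M)"
    by (rule nn_integral_suminf) measurable
  also have "\<dots> = (\<Sum>k. ennreal (4^k * (L2_norm M (d k))\<^sup>2))"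
    by (intro suminf_cong) (simp add: ennreal_mult nn_integral_cmult nn_integral_L2_norm dL)
  also have "\<dots> \<le> (\<Sum>k. ennreal ((1/2)^k))"
  proof (intro suminf_le ennreal_leI)
    fix k
    have "4^k * (L2_norm M (d k))\<^sup>2 \<le> 4^k * (1/8)^k" by (intro mult_left_mono dn) simp
    also have "\<dots> = (1/2::real)^k" by (simp flip: power_mult_distrib)
    finally show "4^k * (L2_norm M (d k))\<^sup>2 \<le> (1/2)^k" .
  qed auto
  also have "\<dots> = ennreal (\<Sum>k. (1/2)^k)"
    by (rule suminf_ennreal2) auto
  also have "\<dots> < \<infinity>" by simp
  finally have "AE x in M. (\<Sum>k. ennreal (4^k * (norm (d k x))\<^sup>2)) \<noteq> \<infinity>"
    by (intro nn_integral_PInf_AE) auto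
  then have conv: "AE x in M. convergent (\<lambda>k. F (r k) x)"
  proof eventually_elim
    case (elim x)
    define S where "S = enn2real (\<Sum>k. ennreal (4^k * (norm (d k x))\<^sup>2))"
    have S: "4^k * (norm (d k x))\<^sup>2 \<le> S" for k
    proof -
      have "ennreal (4^k * (norm (d k x))\<^sup>2) \<le> (\<Sum>k. ennreal (4^k * (norm (d k x))\<^sup>2))"
        by (rule ennreal_le_suminf)
      also have "\<dots> = ennreal S" unfolding S_def using elim by (simp add: less_top)
      finally show ?thesis by (subst (asm) ennreal_le_iff) (simp_all add: S_def)
    qed
    have nd: "norm (d k x) \<le> sqrt S * (1/2)^k" for k
    proof (rule power2_le_imp_le)
      have "S \<ge> 0" unfolding S_def by simp
      have "(norm (d k x))\<^sup>2 = (4^k * (norm (d k x))\<^sup>2) * (1/4)^k"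
        by (simp add: power_one_over)
      also have "\<dots> \<le> S * (1/4)^k" by (intro mult_right_mono S) simp
      also have "(1/4::real)^k = ((1/2)^k)\<^sup>2"
        by (simp add: power2_eq_square flip: power_mult_distrib)
      also have "S * ((1/2)^k)\<^sup>2 = (sqrt S * (1/2)^k)\<^sup>2"
        using \<open>S \<ge> 0\<close> by (simp add: power_mult_distrib del: power_divide)
      finally show "(norm (d k x))\<^sup>2 \<le> (sqrt S * (1/2)^k)\<^sup>2" .
    qed (simp add: S_def)
    have "summable (\<lambda>k. d k x)"
      by (rule summable_comparison_test'[OF _ nd]) (intro summable_mult summable_geometric, simp)
    then have "convergent (\<lambda>n. (\<Sum>k<n. d k x) + F (r 0) x)"
      by (intro convergent_add convergent_const) (simp add: summable_iff_convergent)
    moreover have "(\<Sum>k<n. d k x) + F (r 0) x = F (r n) x" for n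
      unfolding d_def by (subst sum_lessThan_telescope) simp
    ultimately show ?case by simp
  qed
  define f where "f x = lim (\<lambda>k. F (r k) x)" for x
  have [measurable]: "f \<in> borel_measurable M" unfolding f_def by measurable
  have lim: "AE x in M. (\<lambda>k. F (r k) x) \<longlonglongrightarrow> f x"
    using conv by eventually_elim (simp add: f_def convergent_LIMSEQ_iff)
  have key: "(\<lambda>x. F n x - f x) \<in> L2 M \<and> L2_norm M (\<lambda>x. F n x - f x) \<le> e"
    if "e > 0" and n: "\<forall>n\<ge>K. \<forall>k\<ge>K. L2_norm M (\<lambda>x. F n x - F k x) < e" "n \<ge> K" for e n K
  proof -
    have ev: "\<forall>\<^sub>F k in sequentially. L2_norm M (\<lambda>x. F n x - F (r k) x) \<le> e"
      using eventually_ge_at_top[of K]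
      by eventually_elim (use n order_trans[OF _ r(2)] in \<open>auto intro!: less_imp_le\<close>)
    have l: "AE x in M. (\<lambda>k. F n x - F (r k) x) \<longlonglongrightarrow> F n x - f x"
      using lim by eventually_elim (intro tendsto_intros)
    show ?thesis
      using L2_Fatou[OF L2_diff[OF F F] _ l ev] \<open>e > 0\<close> by auto
  qed
  have fL: "f \<in> L2 M"
  proof -
    obtain K where "\<forall>n\<ge>K. \<forall>k\<ge>K. L2_norm M (\<lambda>x. F n x - F k x) < 1" using Cauchy[of 1] by auto
    then have "(\<lambda>x. F K x - f x) \<in> L2 M" using key[of 1 K K] by simp
    from L2_diff[OF F[of K] this] show ?thesis by simp
  qed
  have "(\<lambda>n. L2_norm M (\<lambda>x. F n x - f x)) \<longlonglongrightarrow> 0"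
  proof (rule LIMSEQ_I)
    fix e :: real assume e: "e > 0"
    then obtain K where K: "\<forall>n\<ge>K. \<forall>k\<ge>K. L2_norm M (\<lambda>x. F n x - F k x) < e/2"
      using Cauchy[of "e/2"] by auto
    have "L2_norm M (\<lambda>x. F n x - f x) < e" if "n \<ge> K" for n
      using key[of "e/2" K n] K that e by auto
    then show "\<exists>K. \<forall>n\<ge>K. norm (L2_norm M (\<lambda>x. F n x - f x) - 0) < e" by auto
  qed
  with fL F show ?thesis by (auto simp: tendsto_L2_def)
qed

text \<open>All limits below that are defined by choice (the transform on $L_2$, the map $Q$) exist for this
  reason.\<close>

lemma L2_isometric_image_converges:
  fixes G :: "nat \<Rightarrow> 'b \<Rightarrow> 'd::euclidean_space"
  assumes F: "tendsto_L2 M F f" and G: "\<And>n. G n \<in> L2 N" and c: "c > 0"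
    and iso: "\<And>n k. L2_norm N (\<lambda>x. G n x - G k x) = c * L2_norm M (\<lambda>x. F n x - F k x)"
  shows "\<exists>g. tendsto_L2 N G g"
proof (rule L2_complete[OF G])
  fix e :: real assume "e > 0"
  then obtain K where K: "\<forall>n\<ge>K. \<forall>k\<ge>K. L2_norm M (\<lambda>x. F n x - F k x) < e / c"
    using L2_Cauchy_of_tendsto[OF F, of "e / c"] c by auto
  show "\<exists>K. \<forall>n\<ge>K. \<forall>k\<ge>K. L2_norm N (\<lambda>x. G n x - G k x) < e"
    unfolding iso using K c by (auto simp: less_divide_eq mult.commute intro!: exI[of _ K])
qed

section \<open>Generating real $L_2(\<real>)$ from intervals\<close>

lemma L2_indicator:
  assumes "A \<in> sets M" "emeasure M A < \<infinity>"
  shows "(indicator A :: 'a \<Rightarrow> real) \<in> L2 M"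
proof (rule L2_I)
  have "(\<lambda>x. (norm (indicator A x :: real))\<^sup>2) = indicator A"
    by (auto simp: indicator_def)
  then show "integrable M (\<lambda>x. (norm (indicator A x :: real))\<^sup>2)"
    using assms by (simp add: integrable_real_indicator)
qed (use assms in measurable)

lemma indicator_interval_L2 [simp]:
  "(indicator {a..b::real} :: real \<Rightarrow> real) \<in> L2 lborel"
  by (rule L2_indicator) (auto simp: emeasure_lborel_Icc_eq)

text \<open>Within the window $[-n,n]$ complements and countable disjoint unions stay
  square-integrable, so Dynkin's lemma applies to the intersection-stable generator of closed
  intervals.\<close>

lemma L2_lborel_induct_bounded_set:
  fixes P :: "(real \<Rightarrow> real) \<Rightarrow> bool"
  assumes interval: "\<And>a b. P (indicator {a..b})"
    and add: "\<And>f g. f \<in> L2 lborel \<Longrightarrow> g \<in> L2 lborel \<Longrightarrow> P f \<Longrightarrow> P g \<Longrightarrow> P (\<lambda>x. f x + g x)"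
    and scale: "\<And>c f. f \<in> L2 lborel \<Longrightarrow> P f \<Longrightarrow> P (\<lambda>x. c * f x)"
    and lim: "\<And>F f. tendsto_L2 lborel F f \<Longrightarrow> (\<And>n. P (F n)) \<Longrightarrow> P f"
    and A: "A \<in> sets borel"
  shows "P (indicator (A \<inter> {-real n..real n}))"
proof -
  let ?I = "{-real n..real n}" and ?G = "range (\<lambda>(a,b). {a..b::real})"
  have zero: "P (\<lambda>x. 0)" using interval[of 1 0] by (simp add: indicator_def[abs_def])
  have L2: "(indicator (S \<inter> ?I) :: real \<Rightarrow> real) \<in> L2 lborel" if "S \<in> sets borel" for S
  proof (rule L2_indicator)
    have "emeasure lborel (S \<inter> ?I) \<le> emeasure lborel ?I" by (rule emeasure_mono) auto
    also have "\<dots> < \<infinity>" by simp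
    finally show "emeasure lborel (S \<inter> ?I) < \<infinity>" .
  qed (use that in auto)
  have sb: "sigma_sets UNIV ?G = sets borel"
    by (simp add: borel_eq_atLeastAtMost)
  have "Int_stable ?G"
  proof (safe intro!: Int_stableI)
    fix a b c d :: real
    have "{a..b} \<inter> {c..d} = {max a c..min b d}" by auto
    then show "{a..b} \<inter> {c..d} \<in> ?G" by auto
  qed
  moreover have "?G \<subseteq> Pow UNIV" by simp
  moreover have "A \<in> sigma_sets UNIV ?G"
    using A sb by simp
  ultimately show ?thesis
  proof (induction rule: sigma_sets_induct_disjoint)
    case (basic S)
    then obtain a b where S: "S = {a..b}" by auto
    have "S \<inter> ?I = {max a (-real n)..min b (real n)}" unfolding S by auto
    then show ?case using interval by simp
  next
    case empty
    show ?case using zero by (simp add: indicator_def[abs_def])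
  next
    case (compl S)
    have S: "S \<in> sets borel" using compl(1) by (simp only: sb)
    have "P (\<lambda>x. indicator ?I x + (-1) * indicator (S \<inter> ?I) x)"
      by (intro add scale L2_cmult L2 S interval compl) simp
    also have "(\<lambda>x. indicator ?I x + (-1) * indicator (S \<inter> ?I) x) = (indicator ((UNIV - S) \<inter> ?I) :: real \<Rightarrow> real)"
      by (auto simp: indicator_def fun_eq_iff)
    finally show ?case .
  next
    case (union S)
    have S: "S k \<in> sets borel" for k
      using union(2) by (auto simp only: sb)
    define F where "F k x = (\<Sum>i<k. indicator (S i \<inter> ?I) x :: real)" for k x
    have F: "F k \<in> L2 lborel \<and> P (F k)" for k
    proof (induction k)
      case 0
      show ?case using zero by (simp add: F_def[abs_def])
    next
      case (Suc k)
      have "F (Suc k) = (\<lambda>x. F k x + indicator (S k \<inter> ?I) x)" by (auto simp: F_def)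
      then show ?case using Suc add[of "F k" "indicator (S k \<inter> ?I)"] L2[OF S] union(3)
        by (auto intro: L2_add)
    qed
    have F_eq: "F k x = indicator ((\<Union>i<k. S i) \<inter> ?I) x" for k x
    proof -
      have "disjoint_family_on S {..<k}"
        using union(1) by (rule disjoint_family_on_mono[rotated]) auto
      then have "indicator (\<Union>i<k. S i) x = (\<Sum>i<k. indicator (S i) x :: real)"
        by (intro indicator_UN_disjoint) auto
      then show ?thesis by (simp add: F_def indicator_inter_arith sum_distrib_right)
    qed
    show ?case
    proof (rule lim)
      show "tendsto_L2 lborel F (indicator (\<Union> (range S) \<inter> ?I))"
      proof (rule tendsto_L2_dominated)
        show "F k \<in> borel_measurable lborel" for k using F[of k] by (auto dest: L2_D)
        show "(indicator ?I :: real \<Rightarrow> real) \<in> L2 lborel" by simp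
        show "(indicator (\<Union> (range S) \<inter> ?I) :: real \<Rightarrow> real) \<in> borel_measurable lborel"
          using S by (intro borel_measurable_indicator) auto
        show "AE x in lborel. norm (F k x) \<le> norm (indicator ?I x :: real)" for k
          by (rule AE_I2) (auto simp: F_eq indicator_def)
        show "AE x in lborel. (\<lambda>k. F k x) \<longlonglongrightarrow> indicator (\<Union> (range S) \<inter> ?I) x"
        proof (rule AE_I2)
          fix x :: real
          have "(\<lambda>k. indicator (\<Union>i<k. S i \<inter> ?I) x :: real) \<longlonglongrightarrow> indicator (\<Union>i. S i \<inter> ?I) x"
            by (rule LIMSEQ_indicator_UN)
          then show "(\<lambda>k. F k x) \<longlonglongrightarrow> indicator (\<Union> (range S) \<inter> ?I) x"
            by (simp add: F_eq)
        qed
      qed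
    qed (use F in auto)
  qed
qed

text \<open>Intervals generate everything: bounded Borel sets by Dynkin's lemma, sets of finite measure by
  cutting off at $\pm n$, and a general $f$ by simple functions bounded by $2|f|$; each step is
  a dominated limit.\<close>

theorem L2_lborel_induct [consumes 1, case_names interval add scale lim]:
  fixes P :: "(real \<Rightarrow> real) \<Rightarrow> bool"
  assumes f: "f \<in> L2 lborel"
    and interval: "\<And>a b. P (indicator {a..b})"
    and add: "\<And>f g. f \<in> L2 lborel \<Longrightarrow> g \<in> L2 lborel \<Longrightarrow> P f \<Longrightarrow> P g \<Longrightarrow> P (\<lambda>x. f x + g x)"
    and scale: "\<And>c f. f \<in> L2 lborel \<Longrightarrow> P f \<Longrightarrow> P (\<lambda>x. c * f x)"
    and lim: "\<And>F f. tendsto_L2 lborel F f \<Longrightarrow> (\<And>n. P (F n)) \<Longrightarrow> P f"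
  shows "P f"
proof -
  have zero: "P (\<lambda>x. 0)" using interval[of 1 0] by (simp add: indicator_def[abs_def])
  have fin: "P (indicator A)" if A[measurable]: "A \<in> sets borel" and A': "emeasure lborel A < \<infinity>" for A
  proof (rule lim)
    show "tendsto_L2 lborel (\<lambda>n. indicator (A \<inter> {-real n..real n})) (indicator A :: real \<Rightarrow> real)"
    proof (rule tendsto_L2_dominated)
      show "(indicator A :: real \<Rightarrow> real) \<in> L2 lborel" using A A' by (intro L2_indicator) auto
      show "AE x in lborel. (\<lambda>n. indicator (A \<inter> {-real n..real n}) x :: real) \<longlonglongrightarrow> indicator A x"
      proof (rule AE_I2, rule tendsto_eventually)
        fix x :: real
        obtain N where "\<bar>x\<bar> \<le> real N" using real_arch_simple by blast
        then show "\<forall>\<^sub>F n in sequentially. indicator (A \<inter> {-real n..real n}) x = (indicator A x :: real)"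
          by (intro eventually_sequentiallyI[of N]) (auto simp: indicator_def)
      qed
    qed (auto simp: indicator_def)
    show "P (indicator (A \<inter> {-real n..real n}))" for n
      by (rule L2_lborel_induct_bounded_set[of P, OF interval add scale lim A])
  qed
  have step: "P s" if s: "simple_function lborel s" and sL: "s \<in> L2 lborel" for s :: "real \<Rightarrow> real"
  proof -
    have fr: "finite (range s)" and m: "s -` {y} \<in> sets borel" for y
      using simple_functionD[OF s] by auto
    \<comment> \<open>the level set of $0$ may have infinite measure, but it does not contribute to $s$\<close>
    have fm: "emeasure lborel (s -` {y}) < \<infinity>" if "y \<noteq> 0" for y
    proof -
      have "(indicator (s -` {y}) :: real \<Rightarrow> real) \<in> L2 lborel"
        by (rule L2_bound[OF sL, where C="1/\<bar>y\<bar>"]) (use m that in \<open>auto simp: indicator_def\<close>)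
      then have "integrable lborel (\<lambda>x. (norm (indicator (s -` {y}) x :: real))\<^sup>2)" by (rule L2_D)
      also have "(\<lambda>x. (norm (indicator (s -` {y}) x :: real))\<^sup>2) = indicator (s -` {y})"
        by (auto simp: indicator_def)
      finally show ?thesis by (simp add: integrable_indicator_iff)
    qed
    have *: "(\<lambda>x. \<Sum>y\<in>Y. y * indicator (s -` {y}) x) \<in> L2 lborel \<and> P (\<lambda>x. \<Sum>y\<in>Y. y * indicator (s -` {y}) x)"
      if "finite Y" for Y
      using that
    proof (induction Y)
      case empty
      show ?case using zero by simp
    next
      case (insert y Y)
      have "(\<lambda>x. y * indicator (s -` {y}) x) \<in> L2 lborel \<and> P (\<lambda>x. y * indicator (s -` {y}) x)"
      proof (cases "y = 0")
        case False
        then show ?thesis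
          using m fm[OF False] by (intro conjI L2_cmult scale fin L2_indicator) auto
      qed (use zero in simp)
      with insert.IH show ?case
        by (simp only: sum.insert[OF insert.hyps]) (elim conjE, intro conjI L2_add add)
    qed
    have "s x = (\<Sum>y\<in>range s. y * indicator (s -` {y}) x)" for x
    proof -
      have "(\<Sum>y\<in>range s. y * indicator (s -` {y}) x) = (\<Sum>y\<in>range s. if s x = y then y else 0)"
        by (intro sum.cong) (auto simp: indicator_def)
      also have "\<dots> = s x" using fr by (simp add: sum.delta)
      finally show ?thesis by simp
    qed
    then have "s = (\<lambda>x. \<Sum>y\<in>range s. y * indicator (s -` {y}) x)" by blast
    then show "P s" using *[OF fr] by simp
  qed
  obtain s where s: "\<And>i. simple_function lborel (s i)" "\<And>x. (\<lambda>i. s i x) \<longlonglongrightarrow> f x"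
      "\<And>i x. dist (s i x) 0 \<le> 2 * dist (f x) 0"
    using borel_measurable_implies_sequence_metric[OF L2_D(1)[OF f], of 0] by auto
  have sm: "s i \<in> borel_measurable lborel" for i using s(1) by (rule borel_measurable_simple_function)
  have lims: "tendsto_L2 lborel s f"
    by (rule tendsto_L2_dominated[where w="\<lambda>x. 2 * f x"])
      (use sm s f L2_D(1)[OF f] in \<open>auto intro: L2_cmult simp: abs_mult\<close>)
  show "P f"
    by (rule lim[OF lims]) (use step s(1) tendsto_L2_D(1)[OF lims] in auto)
qed

section \<open>Complex inner products and closures\<close>

definition L2_inner :: "'a measure \<Rightarrow> ('a \<Rightarrow> complex) \<Rightarrow> ('a \<Rightarrow> complex) \<Rightarrow> complex" where
  "L2_inner M f g = (\<integral>x. f x * cnj (g x) \<partial>M)"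

lemma bounded_bilinear_mult_cnj: "bounded_bilinear (\<lambda>a b. a * cnj b)"
  by (rule bounded_bilinear.comp[OF bounded_bilinear_mult bounded_linear_ident bounded_linear_cnj])

lemma L2_inner_integrable: "f \<in> L2 M \<Longrightarrow> g \<in> L2 M \<Longrightarrow> integrable M (\<lambda>x. f x * cnj (g x))"
  by (rule L2_integrable_bilinear[OF bounded_bilinear_mult_cnj])

lemma L2_inner_tendsto:
  "tendsto_L2 M F f \<Longrightarrow> tendsto_L2 M G g \<Longrightarrow> (\<lambda>n. L2_inner M (F n) (G n)) \<longlonglongrightarrow> L2_inner M f g"
  unfolding L2_inner_def by (rule tendsto_L2_bilinear[OF bounded_bilinear_mult_cnj])

lemma L2_inner_add_left:
  "f \<in> L2 M \<Longrightarrow> g \<in> L2 M \<Longrightarrow> h \<in> L2 M \<Longrightarrow>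
    L2_inner M (\<lambda>x. f x + g x) h = L2_inner M f h + L2_inner M g h"
  by (simp add: L2_inner_def distrib_right L2_inner_integrable)

lemma L2_inner_diff_left:
  "f \<in> L2 M \<Longrightarrow> g \<in> L2 M \<Longrightarrow> h \<in> L2 M \<Longrightarrow>
    L2_inner M (\<lambda>x. f x - g x) h = L2_inner M f h - L2_inner M g h"
  by (simp add: L2_inner_def left_diff_distrib L2_inner_integrable)

lemma L2_inner_cmult_left: "L2_inner M (\<lambda>x. c * f x) g = c * L2_inner M f g"
  by (simp add: L2_inner_def mult.assoc)

lemma L2_inner_commute: "L2_inner M g f = cnj (L2_inner M f g)"
  by (simp add: L2_inner_def mult.commute flip: Bochner_Integration.integral_cnj)

lemma L2_inner_add_right:
  "f \<in> L2 M \<Longrightarrow> g \<in> L2 M \<Longrightarrow> h \<in> L2 M \<Longrightarrow>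
    L2_inner M f (\<lambda>x. g x + h x) = L2_inner M f g + L2_inner M f h"
  using L2_inner_add_left[of g M h f] L2_inner_commute[of M f] by simp

lemma L2_inner_diff_right:
  "f \<in> L2 M \<Longrightarrow> g \<in> L2 M \<Longrightarrow> h \<in> L2 M \<Longrightarrow>
    L2_inner M f (\<lambda>x. g x - h x) = L2_inner M f g - L2_inner M f h"
  using L2_inner_diff_left[of g M h f] L2_inner_commute[of M f] by simp

lemma L2_inner_cmult_right: "L2_inner M f (\<lambda>x. c * g x) = cnj c * L2_inner M f g"
  using L2_inner_cmult_left[of M c g f] L2_inner_commute[of M f] by simp

lemma L2_inner_self: "L2_inner M f f = of_real ((L2_norm M f)\<^sup>2)"
  by (simp add: L2_inner_def L2_norm_sq complex_norm_square[symmetric] flip: of_real_power)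

lemma L2_inner_cong_AE:
  assumes "AE x in M. f x = f' x" "AE x in M. g x = g' x"
    and "f \<in> L2 M" "f' \<in> L2 M" "g \<in> L2 M" "g' \<in> L2 M"
  shows "L2_inner M f g = L2_inner M f' g'"
proof -
  show ?thesis unfolding L2_inner_def
    by (intro integral_cong_AE borel_measurable_integrable L2_inner_integrable assms(3-6))
      (use assms(1,2) in auto)
qed

lemma tendsto_L2_cong_AE:
  assumes "tendsto_L2 M F f" "AE x in M. f x = g x" "g \<in> borel_measurable M"
  shows "tendsto_L2 M F g"
proof -
  note F = tendsto_L2_D[OF assms(1)]
  have g: "g \<in> L2 M"
    by (rule L2_bound[OF F(2) assms(3), where C=1]) (use assms(2) in auto)
  have "L2_norm M (\<lambda>x. F n x - g x) = L2_norm M (\<lambda>x. F n x - f x)" for n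
    by (rule L2_norm_cong_norm) (use assms(2) F g in \<open>auto intro!: L2_D(1) L2_diff\<close>)
  with F g show ?thesis by (simp add: tendsto_L2_def)
qed

definition L2_closure :: "'a measure \<Rightarrow> ('a \<Rightarrow> 'b::euclidean_space) set \<Rightarrow> ('a \<Rightarrow> 'b) set" where
  "L2_closure M S = {f. \<exists>F. (\<forall>n. F n \<in> S) \<and> tendsto_L2 M F f}"

text \<open>The sequential definition is convenient for linear images; this form with a tolerance is
  what makes the closure closed.\<close>

lemma L2_closure_iff:
  "f \<in> L2_closure M S \<longleftrightarrow> f \<in> L2 M \<and> (\<forall>e>0. \<exists>s\<in>S. s \<in> L2 M \<and> L2_norm M (\<lambda>x. s x - f x) < e)"
proof
  assume "f \<in> L2_closure M S"
  then obtain F where S: "\<And>n. F n \<in> S" and F: "tendsto_L2 M F f" by (auto simp: L2_closure_def)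
  note F' = tendsto_L2_D[OF F]
  have "\<exists>s\<in>S. s \<in> L2 M \<and> L2_norm M (\<lambda>x. s x - f x) < e" if "e > 0" for e
    using order_tendstoD(2)[OF F'(3) that] S F'(1) by (auto simp: eventually_sequentially)
  with F' show "f \<in> L2 M \<and> (\<forall>e>0. \<exists>s\<in>S. s \<in> L2 M \<and> L2_norm M (\<lambda>x. s x - f x) < e)" by blast
next
  assume *: "f \<in> L2 M \<and> (\<forall>e>0. \<exists>s\<in>S. s \<in> L2 M \<and> L2_norm M (\<lambda>x. s x - f x) < e)"
  have "\<exists>F. \<forall>n. F n \<in> S \<and> F n \<in> L2 M \<and> L2_norm M (\<lambda>x. F n x - f x) < 1 / real (Suc n)"
    by (intro choice allI) (use * in \<open>auto simp: Bex_def conj_assoc\<close>)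
  then obtain F where F: "\<And>n. F n \<in> S" "\<And>n. F n \<in> L2 M"
    "\<And>n. L2_norm M (\<lambda>x. F n x - f x) < 1 / real (Suc n)" by blast
  have "tendsto_L2 M F f"
  proof (rule tendsto_L2_I)
    show "(\<lambda>n. 1 / real (Suc n)) \<longlonglongrightarrow> 0" by (rule LIMSEQ_Suc[OF lim_1_over_n])
    show "\<forall>\<^sub>F n in sequentially. L2_norm M (\<lambda>x. F n x - f x) \<le> 1 / real (Suc n)"
      using F(3) by (intro always_eventually allI less_imp_le)
  qed (use F(2) * in auto)
  with F(1) show "f \<in> L2_closure M S" by (auto simp: L2_closure_def)
qed

lemma L2_closure_closed:
  assumes F: "tendsto_L2 M F f" and cl: "\<And>n. F n \<in> L2_closure M S"
  shows "f \<in> L2_closure M S"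
proof -
  note F' = tendsto_L2_D[OF F]
  have "\<exists>s\<in>S. s \<in> L2 M \<and> L2_norm M (\<lambda>x. s x - f x) < e" if e: "e > 0" for e
  proof -
    obtain n where n: "L2_norm M (\<lambda>x. F n x - f x) < e/2"
      using eventually_happens'[OF sequentially_bot order_tendstoD(2)[OF F'(3), of "e/2"]] e by auto
    obtain s where s: "s \<in> S" "s \<in> L2 M" "L2_norm M (\<lambda>x. s x - F n x) < e/2"
      using cl[of n] e unfolding L2_closure_iff by (metis half_gt_zero)
    show ?thesis
      using L2_norm_triangle_diff[OF s(2) F'(1) F'(2), of n] n s by force
  qed
  with F' show ?thesis unfolding L2_closure_iff by blast
qed

lemma L2_closure_add:
  assumes "\<And>s t. s \<in> S \<Longrightarrow> t \<in> S \<Longrightarrow> (\<lambda>x. s x + t x) \<in> S"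
    and "f \<in> L2_closure M S" "g \<in> L2_closure M S"
  shows "(\<lambda>x. f x + g x) \<in> L2_closure M S"
proof -
  obtain F G where "\<And>n. F n \<in> S" "tendsto_L2 M F f" "\<And>n. G n \<in> S" "tendsto_L2 M G g"
    using assms(2,3) unfolding L2_closure_def by auto
  then show ?thesis
    unfolding L2_closure_def
    by (intro CollectI exI[of _ "\<lambda>n x. F n x + G n x"] conjI allI assms(1) tendsto_L2_add)
qed

lemma L2_closure_linear_image:
  assumes "bounded_linear h" "\<And>s. s \<in> S \<Longrightarrow> (\<lambda>x. h (s x)) \<in> T"
    and "f \<in> L2_closure M S"
  shows "(\<lambda>x. h (f x)) \<in> L2_closure M T"
proof -
  obtain F where "\<And>n. F n \<in> S" "tendsto_L2 M F f"
    using assms(3) unfolding L2_closure_def by auto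
  then show ?thesis
    unfolding L2_closure_def
    by (intro CollectI exI[of _ "\<lambda>n x. h (F n x)"] conjI allI assms(2) tendsto_L2_linear_image[OF assms(1)])
qed

section \<open>Fourier transforms of intervals\<close>

text \<open>$\mathrm{Si}(u) - (1 - \cos u)/u$ is an antiderivative that tends to $\pi/2$ at
  infinity, by Dirichlet's integral.\<close>

lemma one_minus_cos_integral_unit:
  "has_bochner_integral lborel (\<lambda>u::real. (1 - cos u) / u\<^sup>2) pi"
proof -
  \<comment> \<open>the value $1/2$ at $0$ makes the antiderivative differentiable on all of $[0,\infty)$\<close>
  define g :: "real \<Rightarrow> real" where "g u = (if u = 0 then 1/2 else (1 - cos u) / u\<^sup>2)" for u
  define F :: "real \<Rightarrow> real" where "F u = Si u - (1 - cos u) / u" for u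
  have [measurable]: "g \<in> borel_measurable borel" unfolding g_def by measurable
  have nonneg: "0 \<le> g u" for u by (simp add: g_def)
  have D0: "((\<lambda>u::real. (1 - cos u) / u) has_real_derivative 1/2) (at 0)"
  proof -
    have "((\<lambda>h::real. (1 - cos h) / h / h) \<longlongrightarrow> 1/2) (at 0)" by real_asymp
    then show ?thesis by (simp add: DERIV_def)
  qed
  have D: "(F has_real_derivative g u) (at u)" for u
  proof (cases "u = 0")
    case True
    have "(F has_real_derivative (1 - 1/2)) (at 0)"
      unfolding F_def using DERIV_diff[OF DERIV_Si[of 0] D0] by simp
    then show ?thesis using True by (simp add: g_def)
  next
    case False
    have "(F has_real_derivative sin u / u - (sin u * u - (1 - cos u)) / u\<^sup>2) (at u)"
      unfolding F_def using False DERIV_Si[of u]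
      by (auto intro!: derivative_eq_intros simp: power2_eq_square)
    also have "sin u / u - (sin u * u - (1 - cos u)) / u\<^sup>2 = g u"
      using False by (simp add: g_def field_simps power2_eq_square)
    finally show ?thesis .
  qed
  have "((\<lambda>u::real. (1 - cos u) / u) \<longlongrightarrow> 0) at_top"
  proof (rule Lim_null_comparison)
    show "\<forall>\<^sub>F u::real in at_top. norm ((1 - cos u) / u) \<le> 2 / u"
      using eventually_gt_at_top[of 0]
    proof eventually_elim
      case (elim u)
      have "\<bar>1 - cos u\<bar> \<le> 2" using cos_ge_minus_one[of u] cos_le_one[of u] by linarith
      then show ?case using elim by (simp add: divide_right_mono)
    qed
    show "((\<lambda>u::real. 2 / u) \<longlongrightarrow> 0) at_top" by real_asymp
  qed
  then have "(F \<longlongrightarrow> pi / 2) at_top"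
    unfolding F_def using tendsto_diff[OF Si_at_top] by fastforce
  then have "(\<integral>\<^sup>+x. ennreal (g x) * indicator {0..} x \<partial>lborel) = ennreal (pi / 2 - F 0)"
    by (intro nn_integral_FTC_atLeast D nonneg) auto
  moreover have "F 0 = 0" by (simp add: F_def Si_def zero_ereal_def)
  moreover have "ennreal (g x) * indicator {0..} x = ennreal (indicator {0..} x *\<^sub>R g x)" for x
    by (simp add: indicator_def)
  ultimately have "(\<integral>\<^sup>+x. ennreal (indicator {0..} x *\<^sub>R g x) \<partial>lborel) = ennreal (pi / 2)" by simp
  then have "has_bochner_integral lborel (\<lambda>x. indicator {0..} x *\<^sub>R g x) (pi / 2)"
    by (intro has_bochner_integral_nn_integral) (auto simp: nonneg indicator_def)
  then have "has_bochner_integral lborel g (2 *\<^sub>R (pi / 2))"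
    by (rule has_bochner_integral_even_function) (simp add: g_def)
  moreover have "AE u in lborel. g u = (1 - cos u) / u\<^sup>2"
    using AE_lborel_singleton[of 0] by eventually_elim (simp add: g_def)
  ultimately show ?thesis
    by (subst has_bochner_integral_cong_AE[symmetric, of g]) auto
qed

lemma one_minus_cos_integral:
  "has_bochner_integral lborel (\<lambda>u::real. (1 - cos (t * u)) / u\<^sup>2) (pi * \<bar>t\<bar>)"
proof (cases "t = 0")
  case False
  have "has_bochner_integral lborel (\<lambda>u. (1 - cos (t * u)) / (t * u)\<^sup>2) (pi / \<bar>t\<bar>)"
    using lborel_has_bochner_integral_real_affine_iff[of t "\<lambda>u. (1 - cos u) / u\<^sup>2" pi 0]
      one_minus_cos_integral_unit False by (simp add: divide_inverse mult.commute)
  then have "has_bochner_integral lborel (\<lambda>u. t\<^sup>2 * ((1 - cos (t * u)) / (t * u)\<^sup>2)) (t\<^sup>2 * (pi / \<bar>t\<bar>))"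
    by (rule has_bochner_integral_mult_right)
  moreover have "t\<^sup>2 * (pi / \<bar>t\<bar>) = pi * \<bar>t\<bar>"
    using False by (simp add: power2_eq_square abs_if)
  ultimately show ?thesis using False by (simp add: power_mult_distrib)
qed (simp add: has_bochner_integral_zero)

lemma fourier_measurable [measurable]:
  assumes "f \<in> borel_measurable lborel"
  shows "fourier f \<in> borel_measurable lborel"
proof -
  have [measurable]: "f \<in> borel_measurable borel" using assms by simp
  show ?thesis unfolding fourier_def by measurable
qed

lemma fourier_integrable:
  assumes "integrable lborel f"
  shows "integrable lborel (\<lambda>x. exp (- \<i> * complex_of_real (u * x)) * f x)"
proof (rule Bochner_Integration.integrable_bound[OF assms])
  have [measurable]: "f \<in> borel_measurable borel" using assms by auto
  show "(\<lambda>x. exp (- \<i> * complex_of_real (u * x)) * f x) \<in> borel_measurable lborel" by measurable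
qed (simp add: norm_mult)

lemma fourier_add:
  "integrable lborel f \<Longrightarrow> integrable lborel g \<Longrightarrow> fourier (\<lambda>x. f x + g x) = (\<lambda>u. fourier f u + fourier g u)"
  using fourier_integrable[of f] fourier_integrable[of g]
  by (simp add: fourier_def fun_eq_iff distrib_left)

lemma fourier_diff:
  "integrable lborel f \<Longrightarrow> integrable lborel g \<Longrightarrow> fourier (\<lambda>x. f x - g x) = (\<lambda>u. fourier f u - fourier g u)"
  using fourier_integrable[of f] fourier_integrable[of g]
  by (simp add: fourier_def fun_eq_iff right_diff_distrib)

lemma fourier_cmult: "fourier (\<lambda>x. c * f x) = (\<lambda>u. c * fourier f u)"
  by (simp add: fourier_def fun_eq_iff mult.left_commute)

lemma fourier_cnj: "fourier (\<lambda>x. cnj (f x)) (- u) = cnj (fourier f u)"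
  by (simp add: fourier_def exp_cnj flip: Bochner_Integration.integral_cnj)

lemma fourier_norm_le:
  assumes "integrable lborel f"
  shows "cmod (fourier f u) \<le> (\<integral>x. cmod (f x) \<partial>lborel)"
  unfolding fourier_def
  using integral_norm_bound[of lborel "\<lambda>x. exp (- \<i> * complex_of_real (u * x)) * f x"]
  by (simp add: norm_mult)

lemma fourier_interval:
  assumes "a \<le> b" "u \<noteq> 0"
  shows "fourier (indicator {a..b}) u
    = (exp (- \<i> * of_real (u * a)) - exp (- \<i> * of_real (u * b))) / (\<i> * of_real u)"
proof -
  have ii: "- (\<i> * (z * \<i>)) = z" for z by (simp add: complex_eq_iff)
  have frac: "z / (- c) - w / (- c) = (w - z) / c" for z w c :: complex
    by (simp add: diff_divide_distrib)
  let ?F = "\<lambda>x. exp (- \<i> * complex_of_real (u * x)) / (- \<i> * of_real u)"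
  have "has_bochner_integral lborel (\<lambda>x. indicator {a..b} x *\<^sub>R exp (- \<i> * complex_of_real (u * x))) (?F b - ?F a)"
  proof (rule has_bochner_integral_FTC_Icc)
    fix x
    have "((\<lambda>z. exp (- \<i> * (of_real u * z)) / (- \<i> * of_real u)) has_field_derivative
        exp (- \<i> * (of_real u * of_real x))) (at (of_real x))"
      using assms(2) by (auto intro!: derivative_eq_intros simp: ii)
    then have "(?F has_vector_derivative exp (- \<i> * complex_of_real (u * x))) (at x)"
      using has_vector_derivative_real_field by fastforce
    then show "(?F has_vector_derivative exp (- \<i> * complex_of_real (u * x))) (at x within {a..b})"
      by (rule has_vector_derivative_at_within)
  qed (use assms in \<open>auto intro!: continuous_intros\<close>)
  moreover have "(\<lambda>x. indicator {a..b} x *\<^sub>R exp (- \<i> * complex_of_real (u * x)))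
      = (\<lambda>x. exp (- \<i> * complex_of_real (u * x)) * indicator {a..b} x)"
    by (auto simp: indicator_def)
  ultimately have "fourier (indicator {a..b}) u = ?F b - ?F a"
    unfolding fourier_def by (simp only: has_bochner_integral_integral_eq)
  also have "\<dots> = (exp (- \<i> * of_real (u * a)) - exp (- \<i> * of_real (u * b))) / (\<i> * of_real u)"
    using frac[of _ "\<i> * of_real u"] by (simp only: mult_minus_left)
  finally show ?thesis .
qed

lemma integrable_interval [simp]: "integrable lborel (indicator {a..b::real} :: real \<Rightarrow> complex)"
proof -
  have "integrable lborel (\<lambda>x. complex_of_real (indicator {a..b} x))"
    by (intro integrable_of_real integrable_real_indicator) (auto simp: emeasure_lborel_Icc_eq)
  then show ?thesis by (simp add: of_real_indicator)
qed

lemma interval_L2 [simp]: "(indicator {a..b::real} :: real \<Rightarrow> complex) \<in> L2 lborel"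
  using L2_of_real[OF indicator_interval_L2[of a b]] by (simp add: of_real_indicator)

lemma cnj_indicator [simp]: "cnj (indicator A x) = indicator A x"
  by (simp add: indicator_def)

lemma fourier_interval_L2: "fourier (indicator {a..b}) \<in> L2 lborel"
proof (cases "a \<le> b")
  case True
  show ?thesis
  proof (rule L2_I)
    \<comment> \<open>$|e^{-iua} - e^{-iub}|^2 = 2\,(1 - \cos((b-a)u))$\<close>
    have "AE u in lborel. 2 * ((1 - cos ((b - a) * u)) / u\<^sup>2) = (cmod (fourier (indicator {a..b}) u))\<^sup>2"
      using AE_lborel_singleton[of 0]
    proof eventually_elim
      case (elim u)
      have "exp (- \<i> * of_real (u * a)) - exp (- \<i> * of_real (u * b))
          = Complex (cos (u * a) - cos (u * b)) (sin (u * b) - sin (u * a))"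
        by (simp add: complex_eq_iff Re_exp Im_exp)
      then have "(cmod (exp (- \<i> * of_real (u * a)) - exp (- \<i> * of_real (u * b))))\<^sup>2
          = (cos (u * a) - cos (u * b))\<^sup>2 + (sin (u * b) - sin (u * a))\<^sup>2"
        by (simp add: cmod_power2)
      also have "\<dots> = ((sin (u * a))\<^sup>2 + (cos (u * a))\<^sup>2) + ((sin (u * b))\<^sup>2 + (cos (u * b))\<^sup>2)
          - 2 * (cos (u * b) * cos (u * a) + sin (u * b) * sin (u * a))"
        by (simp add: power2_eq_square algebra_simps)
      also have "\<dots> = 2 * (1 - cos (u * b - u * a))"
        by (simp add: cos_diff)
      finally show ?case
        using True elim by (simp add: fourier_interval norm_divide norm_mult power_divide algebra_simps)
    qed
    moreover have "integrable lborel (\<lambda>u. 2 * ((1 - cos ((b - a) * u)) / u\<^sup>2))"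
      using one_minus_cos_integral[of "b - a"] by (intro integrable_mult_right) (rule has_bochner_integral_iff[THEN iffD1, THEN conjunct1])
    ultimately show "integrable lborel (\<lambda>u. (cmod (fourier (indicator {a..b}) u))\<^sup>2)"
      by (subst integrable_cong_AE[symmetric]) auto
  qed measurable
next
  case False
  then have "fourier (indicator {a..b}) = (\<lambda>u. 0)" by (simp add: fourier_def fun_eq_iff)
  then show ?thesis by simp
qed

lemma fourier_interval_product:
  assumes "a \<le> b" "c \<le> d" "u \<noteq> 0"
  shows "fourier (indicator {a..b}) u * cnj (fourier (indicator {c..d}) u)
    = (exp (\<i> * of_real ((c - a) * u)) - exp (\<i> * of_real ((d - a) * u))
       - exp (\<i> * of_real ((c - b) * u)) + exp (\<i> * of_real ((d - b) * u))) / of_real (u\<^sup>2)"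
proof -
  have e: "exp (- \<i> * of_real (u * x)) * exp (\<i> * of_real (u * y)) = exp (\<i> * of_real ((y - x) * u))" for x y
    by (simp add: exp_add[symmetric] algebra_simps)
  have c: "cnj (exp (- (\<i> * (of_real u * of_real y)))) = exp (\<i> * (of_real u * of_real y))" for y
    by (simp add: exp_cnj)
  have ii: "\<i> * z * (\<i> * z) = - (z * z)" for z
    by (simp add: complex_eq_iff)
  have "fourier (indicator {a..b}) u * cnj (fourier (indicator {c..d}) u)
    = (exp (- \<i> * of_real (u * a)) - exp (- \<i> * of_real (u * b)))
       * (exp (\<i> * of_real (u * c)) - exp (\<i> * of_real (u * d))) / of_real (u\<^sup>2)"
    using assms by (simp add: fourier_interval c ii power2_eq_square)
  also have "(exp (- \<i> * of_real (u * a)) - exp (- \<i> * of_real (u * b)))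
       * (exp (\<i> * of_real (u * c)) - exp (\<i> * of_real (u * d)))
    = exp (\<i> * of_real ((c - a) * u)) - exp (\<i> * of_real ((d - a) * u))
       - exp (\<i> * of_real ((c - b) * u)) + exp (\<i> * of_real ((d - b) * u))"
    by (simp only: left_diff_distrib right_diff_distrib e) (simp add: algebra_simps)
  finally show ?thesis .
qed

text \<open>The product of the two transforms is a combination of functions $e^{ixu}/u^2$, where $x$
  runs over the four differences of endpoints. Its integral is real, as the integrand turns into its
  conjugate under $u \mapsto -u$, and the real parts integrate to multiples of $\pi|x|$. The
  resulting combination of absolute values is twice the length of the overlap of the
  intervals.\<close>

lemma Parseval_intervals:
  "L2_inner lborel (fourier (indicator {a..b})) (fourier (indicator {c..d}))
    = of_real (2 * pi) * L2_inner lborel (indicator {a..b}) (indicator {c..d})"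
proof (cases "a \<le> b \<and> c \<le> d")
  case False
  have "fourier (indicator {}) = (\<lambda>u. 0)" by (simp add: fourier_def fun_eq_iff)
  with False show ?thesis by (auto simp: L2_inner_def)
next
  case True
  let ?h = "\<lambda>u. fourier (indicator {a..b}) u * cnj (fourier (indicator {c..d}) u)"
  have int: "integrable lborel ?h"
    by (intro L2_inner_integrable fourier_interval_L2)
  have sym: "fourier (indicator {a..b}) (-u) = cnj (fourier (indicator {a..b}) u)" for a b u
    using fourier_cnj[of "indicator {a..b}" u] by (simp add: cnj_indicator)
  have "(\<integral>u. ?h u \<partial>lborel) = (\<integral>u. ?h (- u) \<partial>lborel)"
    using lborel_integral_real_affine[of "-1" ?h 0] by simp
  also have "\<dots> = cnj (\<integral>u. ?h u \<partial>lborel)"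
    by (simp add: sym flip: Bochner_Integration.integral_cnj)
  finally have im: "Im (\<integral>u. ?h u \<partial>lborel) = 0"
    by (simp add: complex_eq_iff)
  have "has_bochner_integral lborel
      (\<lambda>u. (1 - cos ((d - a) * u)) / u\<^sup>2 + (1 - cos ((c - b) * u)) / u\<^sup>2
         - (1 - cos ((c - a) * u)) / u\<^sup>2 - (1 - cos ((d - b) * u)) / u\<^sup>2)
      (pi * \<bar>d - a\<bar> + pi * \<bar>c - b\<bar> - pi * \<bar>c - a\<bar> - pi * \<bar>d - b\<bar>)"
    by (intro has_bochner_integral_add has_bochner_integral_diff one_minus_cos_integral)
  then have "(\<integral>u. (1 - cos ((d - a) * u)) / u\<^sup>2 + (1 - cos ((c - b) * u)) / u\<^sup>2
         - (1 - cos ((c - a) * u)) / u\<^sup>2 - (1 - cos ((d - b) * u)) / u\<^sup>2 \<partial>lborel)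
      = pi * \<bar>d - a\<bar> + pi * \<bar>c - b\<bar> - pi * \<bar>c - a\<bar> - pi * \<bar>d - b\<bar>"
    by (rule has_bochner_integral_integral_eq)
  moreover have "(\<integral>u. Re (?h u) \<partial>lborel) = (\<integral>u. (1 - cos ((d - a) * u)) / u\<^sup>2 + (1 - cos ((c - b) * u)) / u\<^sup>2
         - (1 - cos ((c - a) * u)) / u\<^sup>2 - (1 - cos ((d - b) * u)) / u\<^sup>2 \<partial>lborel)"
  proof (rule integral_cong_AE)
    show "AE u in lborel. Re (?h u) = (1 - cos ((d - a) * u)) / u\<^sup>2 + (1 - cos ((c - b) * u)) / u\<^sup>2
         - (1 - cos ((c - a) * u)) / u\<^sup>2 - (1 - cos ((d - b) * u)) / u\<^sup>2"
      using AE_lborel_singleton[of 0]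
    proof eventually_elim
      case (elim u)
      have "Re (?h u) = (cos ((c - a) * u) - cos ((d - a) * u) - cos ((c - b) * u) + cos ((d - b) * u)) / u\<^sup>2"
        using True elim by (subst fourier_interval_product) (simp_all add: Re_exp flip: of_real_power of_real_mult)
      then show ?case by (simp add: diff_divide_distrib add_divide_distrib)
    qed
  qed (use int in auto)
  ultimately have re: "Re (\<integral>u. ?h u \<partial>lborel) = pi * \<bar>d - a\<bar> + pi * \<bar>c - b\<bar> - pi * \<bar>c - a\<bar> - pi * \<bar>d - b\<bar>"
    unfolding integral_Re[OF int, symmetric] by (simp only:)
  have "L2_inner lborel (indicator {a..b}) (indicator {c..d}) = (\<integral>x. of_real (indicator ({a..b} \<inter> {c..d}) x) \<partial>lborel)"
    unfolding L2_inner_def by (intro Bochner_Integration.integral_cong) (auto simp: indicator_def)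
  also have "\<dots> = of_real (measure lborel ({a..b} \<inter> {c..d}))"
    by (subst integral_complex_of_real) simp
  also have "{a..b} \<inter> {c..d} = {max a c..min b d}" by auto
  also have "measure lborel {max a c..min b d} = max 0 (min b d - max a c)"
    by (auto simp: measure_def emeasure_lborel_Icc_eq max_def)
  finally have *: "L2_inner lborel (indicator {a..b}) (indicator {c..d}) = of_real (max 0 (min b d - max a c))" .
  have "2 * max 0 (min b d - max a c) = \<bar>d - a\<bar> + \<bar>c - b\<bar> - \<bar>c - a\<bar> - \<bar>d - b\<bar>"
    using True by (auto simp: max_def min_def abs_if)
  then have "2 * pi * max 0 (min b d - max a c) = pi * \<bar>d - a\<bar> + pi * \<bar>c - b\<bar> - pi * \<bar>c - a\<bar> - pi * \<bar>d - b\<bar>"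
    by (metis (no_types) distrib_left mult.assoc mult.commute right_diff_distrib)
  then show ?thesis
    unfolding * using re im by (simp add: L2_inner_def complex_eq_iff)
qed

section \<open>Plancherel's theorem\<close>

text \<open>Step functions are kept as a span, rather than as explicit finite sums, so that bilinear
  identities follow from the case of two intervals by induction in each argument.\<close>

inductive_set step_functions :: "(real \<Rightarrow> complex) set" where
  interval: "indicator {a..b} \<in> step_functions"
| add: "f \<in> step_functions \<Longrightarrow> g \<in> step_functions \<Longrightarrow> (\<lambda>x. f x + g x) \<in> step_functions"
| scale: "f \<in> step_functions \<Longrightarrow> (\<lambda>x. c * f x) \<in> step_functions"

lemma step_functions_integrable: "f \<in> step_functions \<Longrightarrow> integrable lborel f"
  by (induction rule: step_functions.induct) auto

lemma step_functions_L2: "f \<in> step_functions \<Longrightarrow> f \<in> L2 lborel"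
  by (induction rule: step_functions.induct) (auto intro: L2_add L2_cmult)

lemma step_functions_fourier_L2: "f \<in> step_functions \<Longrightarrow> fourier f \<in> L2 lborel"
  by (induction rule: step_functions.induct)
    (auto intro: L2_add L2_cmult fourier_interval_L2 simp: fourier_add fourier_cmult step_functions_integrable)

lemma step_functions_diff:
  "f \<in> step_functions \<Longrightarrow> g \<in> step_functions \<Longrightarrow> (\<lambda>x. f x - g x) \<in> step_functions"
  using step_functions.add[OF _ step_functions.scale[of g "-1"], of f] by simp

lemma step_functions_truncate:
  "f \<in> step_functions \<Longrightarrow> (\<lambda>x. indicator {l..r} x * f x) \<in> step_functions"
proof (induction rule: step_functions.induct)
  case (interval a b)
  have "(\<lambda>x. indicator {l..r} x * indicator {a..b} x :: complex) = indicator {max l a..min r b}"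
    by (auto simp: indicator_def fun_eq_iff)
  then show ?case by (simp add: step_functions.interval)
next
  case (add f g)
  then show ?case using step_functions.add[of "\<lambda>x. indicator {l..r} x * f x" "\<lambda>x. indicator {l..r} x * g x"]
    by (simp add: distrib_left)
next
  case (scale f c)
  then show ?case using step_functions.scale[of "\<lambda>x. indicator {l..r} x * f x" c]
    by (simp add: mult.left_commute)
qed

lemma Parseval_step_functions:
  assumes "f \<in> step_functions" "g \<in> step_functions"
  shows "L2_inner lborel (fourier f) (fourier g) = of_real (2 * pi) * L2_inner lborel f g"
  using assms
proof (induction arbitrary: g rule: step_functions.induct)
  case (interval a b)
  from \<open>g \<in> step_functions\<close> show ?case
  proof (induction rule: step_functions.induct)
    case (interval c d)
    show ?case by (rule Parseval_intervals)
  next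
    case (add f g)
    then show ?case
      by (simp add: fourier_add step_functions_integrable L2_inner_add_right step_functions_fourier_L2
          fourier_interval_L2 step_functions_L2 distrib_left)
  next
    case (scale f c)
    then show ?case by (simp add: fourier_cmult L2_inner_cmult_right)
  qed
next
  case (add f g h)
  then show ?case
    by (simp add: fourier_add step_functions_integrable L2_inner_add_left step_functions_fourier_L2
        step_functions_L2 distrib_left)
next
  case (scale f c g)
  then show ?case by (simp add: fourier_cmult L2_inner_cmult_left)
qed

lemma step_functions_dense_real:
  assumes "f \<in> L2 lborel"
  shows "(\<lambda>x. complex_of_real (f x)) \<in> L2_closure lborel step_functions"
  using assms
proof (induction rule: L2_lborel_induct)
  case (interval a b)
  have "indicator {a..b} \<in> L2_closure lborel step_functions"
    using tendsto_L2_const[OF interval_L2[of a b]] step_functions.interval[of a b]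
    by (auto simp: L2_closure_def)
  then show ?case by (simp add: of_real_indicator)
next
  case (add f g)
  show ?case
    unfolding of_real_add by (rule L2_closure_add[of step_functions, OF step_functions.add add(3,4)])
next
  case (scale c f)
  show ?case
    unfolding of_real_mult
    by (rule L2_closure_linear_image[OF bounded_linear_mult_right step_functions.scale scale(2)])
next
  case (lim F f)
  show ?case
    by (rule L2_closure_closed[OF tendsto_L2_linear_image[OF bounded_linear_of_real lim(1)] lim(2)])
qed

lemma step_functions_dense:
  assumes "f \<in> L2 lborel"
  shows "f \<in> L2_closure lborel step_functions"
proof -
  have im: "(\<lambda>x. \<i> * complex_of_real (Im (f x))) \<in> L2_closure lborel step_functions"
    by (rule L2_closure_linear_image[OF bounded_linear_mult_right step_functions.scale
          step_functions_dense_real[OF L2_Im[OF assms]]])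
  have "(\<lambda>x. complex_of_real (Re (f x)) + \<i> * complex_of_real (Im (f x))) \<in> L2_closure lborel step_functions"
    by (rule L2_closure_add[of step_functions, OF step_functions.add step_functions_dense_real[OF L2_Re[OF assms]] im])
  then show ?thesis by (simp flip: complex_eq)
qed

abbreviation truncate :: "nat \<Rightarrow> (real \<Rightarrow> complex) \<Rightarrow> real \<Rightarrow> complex" where
  "truncate n f \<equiv> (\<lambda>x. indicator {- real n..real n} x * f x)"

lemma truncate_L2: "f \<in> L2 lborel \<Longrightarrow> truncate n f \<in> L2 lborel"
  by (rule L2_indicator_mult) auto

lemma truncate_integrable: "f \<in> L2 lborel \<Longrightarrow> integrable lborel (truncate n f)"
  by (rule L2_integrable_bilinear[OF bounded_bilinear_mult interval_L2])

lemma truncate_tendsto: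
  assumes "f \<in> L2 lborel"
  shows "tendsto_L2 lborel (\<lambda>n. truncate n f) f"
proof (rule tendsto_L2_dominated)
  show "f \<in> L2 lborel" by fact
  show "AE x in lborel. (\<lambda>n. truncate n f x) \<longlonglongrightarrow> f x"
  proof (rule AE_I2, rule tendsto_eventually)
    fix x :: real
    obtain N where "\<bar>x\<bar> \<le> real N" using real_arch_simple by blast
    then show "\<forall>\<^sub>F n in sequentially. truncate n f x = f x"
      by (intro eventually_sequentiallyI[of N]) (auto simp: indicator_def)
  qed
  show "truncate n f \<in> borel_measurable lborel" for n by (rule L2_D(1)[OF truncate_L2[OF assms]])
  show "f \<in> borel_measurable lborel" by (rule L2_D(1)[OF assms])
qed (auto simp: indicator_def)

lemma sqrt_scale: "x\<^sup>2 = c * y\<^sup>2 \<Longrightarrow> 0 \<le> x \<Longrightarrow> 0 \<le> y \<Longrightarrow> x = sqrt c * y" for x y c :: real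
  by (metis abs_of_nonneg real_sqrt_abs real_sqrt_mult)

text \<open>On a bounded window $L_2$-convergence implies $L_1$-convergence, hence pointwise convergence of
  the transforms; their $L_2$-limit exists by Parseval's identity and completeness, and the two
  limits must agree.\<close>

lemma fourier_truncate_tendsto:
  assumes f: "f \<in> L2 lborel" and s: "\<And>k. s k \<in> step_functions" and lim: "tendsto_L2 lborel s f"
  shows "tendsto_L2 lborel (\<lambda>k. truncate n (s k)) (truncate n f)"
    and "tendsto_L2 lborel (\<lambda>k. fourier (truncate n (s k))) (fourier (truncate n f))"
proof -
  note lim' = tendsto_L2_D[OF lim]
  have st: "truncate n (s k) \<in> step_functions" for k by (rule step_functions_truncate[OF s])
  have le: "L2_norm lborel (\<lambda>x. truncate n (s k) x - truncate n f x) \<le> L2_norm lborel (\<lambda>x. s k x - f x)" for k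
    by (intro L2_norm_mono L2_D(1)[OF L2_diff] L2_diff truncate_L2 f lim') (auto simp: indicator_def)
  show lt: "tendsto_L2 lborel (\<lambda>k. truncate n (s k)) (truncate n f)"
    by (rule tendsto_L2_I[OF _ _ lim'(3)]) (intro always_eventually allI le truncate_L2 f lim')+
  have iso: "L2_norm lborel (\<lambda>u. fourier (truncate n (s k)) u - fourier (truncate n (s j)) u)
      = sqrt (2 * pi) * L2_norm lborel (\<lambda>x. truncate n (s k) x - truncate n (s j) x)" for k j
  proof -
    have "complex_of_real ((L2_norm lborel (fourier (\<lambda>x. truncate n (s k) x - truncate n (s j) x)))\<^sup>2)
       = of_real (2 * pi * (L2_norm lborel (\<lambda>x. truncate n (s k) x - truncate n (s j) x))\<^sup>2)"
      using Parseval_step_functions[OF step_functions_diff[OF st st] step_functions_diff[OF st st], of k j k j]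
      by (simp add: L2_inner_self)
    then have "(L2_norm lborel (fourier (\<lambda>x. truncate n (s k) x - truncate n (s j) x)))\<^sup>2
       = 2 * pi * (L2_norm lborel (\<lambda>x. truncate n (s k) x - truncate n (s j) x))\<^sup>2"
      by (simp only: of_real_eq_iff)
    then have "L2_norm lborel (fourier (\<lambda>x. truncate n (s k) x - truncate n (s j) x))
       = sqrt (2 * pi) * L2_norm lborel (\<lambda>x. truncate n (s k) x - truncate n (s j) x)"
      by (rule sqrt_scale) simp_all
    then show ?thesis
      by (simp add: fourier_diff step_functions_integrable[OF st])
  qed
  have "\<exists>F. tendsto_L2 lborel (\<lambda>k. fourier (truncate n (s k))) F"
    by (rule L2_isometric_image_converges[OF lt step_functions_fourier_L2[OF st] _ iso]) simp
  then obtain F where F: "tendsto_L2 lborel (\<lambda>k. fourier (truncate n (s k))) F" by blast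
  have m: "fourier (truncate n f) \<in> borel_measurable lborel"
    by (intro fourier_measurable L2_D(1) truncate_L2 f)
  have pw: "(\<lambda>k. fourier (truncate n (s k)) u) \<longlonglongrightarrow> fourier (truncate n f) u" for u
  proof (rule LIM_zero_cancel, rule Lim_null_comparison)
    let ?c = "L2_norm lborel (indicator {- real n..real n} :: real \<Rightarrow> complex)"
    have "cmod (fourier (truncate n (s k)) u - fourier (truncate n f) u) \<le> ?c * L2_norm lborel (\<lambda>x. s k x - f x)" for k
    proof -
      have "fourier (truncate n (s k)) u - fourier (truncate n f) u = fourier (\<lambda>x. truncate n (s k) x - truncate n f x) u"
        by (simp add: fourier_diff truncate_integrable f lim')
      also have "cmod \<dots> \<le> (\<integral>x. cmod (truncate n (s k) x - truncate n f x) \<partial>lborel)"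
        by (intro fourier_norm_le Bochner_Integration.integrable_diff truncate_integrable f lim')
      also have "\<dots> = (\<integral>x. cmod (indicator {- real n..real n} x) * cmod (s k x - f x) \<partial>lborel)"
        by (simp add: norm_mult flip: right_diff_distrib)
      also have "\<dots> \<le> ?c * L2_norm lborel (\<lambda>x. s k x - f x)"
        by (intro L2_Cauchy_Schwarz L2_diff f lim') simp
      finally show ?thesis .
    qed
    then show "\<forall>\<^sub>F k in sequentially. cmod (fourier (truncate n (s k)) u - fourier (truncate n f) u)
        \<le> ?c * L2_norm lborel (\<lambda>x. s k x - f x)" by (intro always_eventually allI)
    show "(\<lambda>k. ?c * L2_norm lborel (\<lambda>x. s k x - f x)) \<longlonglongrightarrow> 0"
      by (rule tendsto_mult_right_zero[OF lim'(3)])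
  qed
  show "tendsto_L2 lborel (\<lambda>k. fourier (truncate n (s k))) (fourier (truncate n f))"
    by (rule tendsto_L2_cong_AE[OF F tendsto_L2_pointwise_AE[OF F m] m]) (use pw in auto)
qed

lemma fourier_truncate_L2:
  assumes "f \<in> L2 lborel"
  shows "fourier (truncate n f) \<in> L2 lborel"
proof -
  obtain s where "\<And>k. s k \<in> step_functions" "tendsto_L2 lborel s f"
    using step_functions_dense[OF assms] by (auto simp: L2_closure_def)
  then show ?thesis by (rule tendsto_L2_D(2)[OF fourier_truncate_tendsto(2)[OF assms]])
qed

lemma Parseval_truncate:
  assumes f: "f \<in> L2 lborel" and g: "g \<in> L2 lborel"
  shows "L2_inner lborel (fourier (truncate n f)) (fourier (truncate n g))
    = of_real (2 * pi) * L2_inner lborel (truncate n f) (truncate n g)"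
proof -
  obtain s t where s: "\<And>k. s k \<in> step_functions" "tendsto_L2 lborel s f"
    and t: "\<And>k. t k \<in> step_functions" "tendsto_L2 lborel t g"
    using step_functions_dense[OF f] step_functions_dense[OF g] by (auto simp: L2_closure_def)
  note s' = fourier_truncate_tendsto[OF f s, of n] and t' = fourier_truncate_tendsto[OF g t, of n]
  have "(\<lambda>k. L2_inner lborel (fourier (truncate n (s k))) (fourier (truncate n (t k))))
      \<longlonglongrightarrow> L2_inner lborel (fourier (truncate n f)) (fourier (truncate n g))"
    by (rule L2_inner_tendsto[OF s'(2) t'(2)])
  moreover have "(\<lambda>k. of_real (2 * pi) * L2_inner lborel (truncate n (s k)) (truncate n (t k)))
      \<longlonglongrightarrow> of_real (2 * pi) * L2_inner lborel (truncate n f) (truncate n g)"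
    by (intro tendsto_mult tendsto_const L2_inner_tendsto[OF s'(1) t'(1)])
  ultimately show ?thesis
    by (simp only: Parseval_step_functions[OF step_functions_truncate[OF s(1)] step_functions_truncate[OF t(1)]])
      (rule LIMSEQ_unique)
qed

text \<open>Truncations lie in $L_1$, so their transforms are genuine integrals. Any two truncations
  live in a common window, where Parseval's identity is known, so their transforms form a Cauchy
  sequence: the choice in the definition of the transform on $L_2$ has a witness.\<close>

lemma fourier_L2_tendsto:
  assumes f: "f \<in> L2 lborel"
  shows "tendsto_L2 lborel (\<lambda>n. fourier (truncate n f)) (fourier_L2 f)"
proof -
  have iso: "L2_norm lborel (\<lambda>u. fourier (truncate n f) u - fourier (truncate k f) u)
      = sqrt (2 * pi) * L2_norm lborel (\<lambda>x. truncate n f x - truncate k f x)" for n k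
  proof -
    let ?g = "\<lambda>x. truncate n f x - truncate k f x"
    have g: "?g \<in> L2 lborel" by (intro L2_diff truncate_L2 f)
    have tg: "truncate (max n k) ?g = ?g"
      by (auto simp: indicator_def fun_eq_iff)
    have "complex_of_real ((L2_norm lborel (fourier ?g))\<^sup>2) = of_real (2 * pi * (L2_norm lborel ?g)\<^sup>2)"
      using Parseval_truncate[OF g g, of "max n k"] unfolding tg by (simp add: L2_inner_self)
    then have "(L2_norm lborel (fourier ?g))\<^sup>2 = 2 * pi * (L2_norm lborel ?g)\<^sup>2"
      by (simp only: of_real_eq_iff)
    then have "L2_norm lborel (fourier ?g) = sqrt (2 * pi) * L2_norm lborel ?g"
      by (rule sqrt_scale) simp_all
    then show ?thesis by (simp add: fourier_diff truncate_integrable[OF f])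
  qed
  have "\<exists>F. tendsto_L2 lborel (\<lambda>n. fourier (truncate n f)) F"
    by (rule L2_isometric_image_converges[OF truncate_tendsto[OF f] fourier_truncate_L2[OF f] _ iso]) simp
  then show ?thesis unfolding fourier_L2_def by (rule someI_ex)
qed

lemma fourier_L2_in_L2: "f \<in> L2 lborel \<Longrightarrow> fourier_L2 f \<in> L2 lborel"
  by (rule tendsto_L2_D(2)[OF fourier_L2_tendsto])

theorem Parseval:
  assumes f: "f \<in> L2 lborel" and g: "g \<in> L2 lborel"
  shows "L2_inner lborel (fourier_L2 f) (fourier_L2 g) = of_real (2 * pi) * L2_inner lborel f g"
proof -
  have "(\<lambda>n. L2_inner lborel (fourier (truncate n f)) (fourier (truncate n g)))
      \<longlonglongrightarrow> L2_inner lborel (fourier_L2 f) (fourier_L2 g)"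
    by (rule L2_inner_tendsto[OF fourier_L2_tendsto[OF f] fourier_L2_tendsto[OF g]])
  moreover have "(\<lambda>n. of_real (2 * pi) * L2_inner lborel (truncate n f) (truncate n g))
      \<longlonglongrightarrow> of_real (2 * pi) * L2_inner lborel f g"
    by (intro tendsto_mult tendsto_const L2_inner_tendsto truncate_tendsto f g)
  ultimately show ?thesis
    by (simp only: Parseval_truncate[OF f g]) (rule LIMSEQ_unique)
qed

text \<open>The transforms of the truncations converge pointwise by dominated convergence, and in
  $L_2$ by definition.\<close>

lemma fourier_L2_eq_fourier:
  assumes f: "f \<in> L2 lborel" and i: "integrable lborel f"
  shows "AE u in lborel. fourier_L2 f u = fourier f u"
proof (rule tendsto_L2_pointwise_AE[OF fourier_L2_tendsto[OF f]])
  have [measurable]: "f \<in> borel_measurable borel" using i by auto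
  show "fourier f \<in> borel_measurable lborel" by measurable
  show "AE u in lborel. (\<lambda>n. fourier (truncate n f) u) \<longlonglongrightarrow> fourier f u"
  proof (rule AE_I2)
    fix u
    show "(\<lambda>n. fourier (truncate n f) u) \<longlonglongrightarrow> fourier f u"
      unfolding fourier_def
    proof (rule integral_dominated_convergence)
      show "integrable lborel (\<lambda>x. cmod (f x))" using i by simp
      show "AE x in lborel. (\<lambda>n. exp (- \<i> * complex_of_real (u * x)) * truncate n f x)
          \<longlonglongrightarrow> exp (- \<i> * complex_of_real (u * x)) * f x"
      proof (rule AE_I2, rule tendsto_eventually)
        fix x :: real
        obtain N where "\<bar>x\<bar> \<le> real N" using real_arch_simple by blast
        then show "\<forall>\<^sub>F n in sequentially. exp (- \<i> * complex_of_real (u * x)) * truncate n f x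
            = exp (- \<i> * complex_of_real (u * x)) * f x"
          by (intro eventually_sequentiallyI[of N]) (auto simp: indicator_def)
      qed
      show "AE x in lborel. cmod (exp (- \<i> * complex_of_real (u * x)) * truncate n f x) \<le> cmod (f x)" for n
        by (rule AE_I2) (auto simp: norm_mult indicator_def)
    qed measurable
  qed
qed

text \<open>The kernel $e^{-iux}$ is symmetric in $u$ and $x$, so this is Fubini's theorem.\<close>

lemma fourier_multiplication_formula:
  assumes f: "integrable lborel f" and g: "integrable lborel g"
  shows "(\<integral>u. fourier f u * g u \<partial>lborel) = (\<integral>x. f x * fourier g x \<partial>lborel)"
proof -
  have [measurable]: "f \<in> borel_measurable borel" "g \<in> borel_measurable borel" using f g by auto
  let ?k = "\<lambda>u x. exp (- \<i> * complex_of_real (u * x)) * f x * g u"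
  have int: "integrable (lborel \<Otimes>\<^sub>M lborel) (\<lambda>(u, x). ?k u x)"
  proof (rule lborel_pair.Fubini_integrable)
    show "(\<lambda>(u, x). ?k u x) \<in> borel_measurable (lborel \<Otimes>\<^sub>M lborel)" by measurable
    have "integrable lborel (\<lambda>u. (\<integral>x. cmod (f x) \<partial>lborel) * cmod (g u))" using g by simp
    then show "integrable lborel (\<lambda>u. \<integral>x. norm ((\<lambda>(u, x). ?k u x) (u, x)) \<partial>lborel)"
      by (simp add: norm_mult)
    show "AE u in lborel. integrable lborel (\<lambda>x. (\<lambda>(u, x). ?k u x) (u, x))"
      using fourier_integrable[OF f] by (intro AE_I2) simp
  qed
  have "(\<integral>u. fourier f u * g u \<partial>lborel) = (\<integral>u. (\<integral>x. ?k u x \<partial>lborel) \<partial>lborel)"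
    by (simp add: fourier_def)
  also have "\<dots> = (\<integral>x. (\<integral>u. ?k u x \<partial>lborel) \<partial>lborel)"
    by (rule lborel_pair.Fubini_integral[symmetric, OF int])
  also have "\<dots> = (\<integral>x. f x * fourier g x \<partial>lborel)"
  proof (intro Bochner_Integration.integral_cong refl)
    fix x
    have "(\<integral>u. ?k u x \<partial>lborel) = (\<integral>u. f x * (exp (- \<i> * complex_of_real (x * u)) * g u) \<partial>lborel)"
      by (intro Bochner_Integration.integral_cong refl) (simp add: mult_ac)
    then show "(\<integral>u. ?k u x \<partial>lborel) = f x * fourier g x" by (simp add: fourier_def)
  qed
  finally show ?thesis .
qed

lemma fourier_L2_multiplication_formula:
  assumes f: "f \<in> L2 lborel" and g: "g \<in> L2 lborel"
  shows "(\<integral>u. fourier_L2 f u * g u \<partial>lborel) = (\<integral>x. f x * fourier_L2 g x \<partial>lborel)"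
proof -
  note tf = truncate_tendsto[OF f] fourier_L2_tendsto[OF f]
  note tg = truncate_tendsto[OF g] fourier_L2_tendsto[OF g]
  have "(\<lambda>n. \<integral>u. fourier (truncate n f) u * truncate n g u \<partial>lborel) \<longlonglongrightarrow> (\<integral>u. fourier_L2 f u * g u \<partial>lborel)"
    by (rule tendsto_L2_bilinear[OF bounded_bilinear_mult tf(2) tg(1)])
  moreover have "(\<lambda>n. \<integral>x. truncate n f x * fourier (truncate n g) x \<partial>lborel) \<longlonglongrightarrow> (\<integral>x. f x * fourier_L2 g x \<partial>lborel)"
    by (rule tendsto_L2_bilinear[OF bounded_bilinear_mult tf(1) tg(2)])
  ultimately show ?thesis
    by (simp only: fourier_multiplication_formula[OF truncate_integrable[OF f] truncate_integrable[OF g]])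
      (rule LIMSEQ_unique)
qed

text \<open>The integrals of $H$ against the transforms of the translates of $[0,1]$ are the Fourier
  transform of $G = H\,\overline{\widehat{1_{[0,1]}}}$, which lies in $L_1 \cap L_2$; so $G = 0$ by Parseval's
  identity, and the zeros of $\widehat{1_{[0,1]}}$ form a null set.\<close>

lemma orthogonal_to_fourier_intervals:
  assumes H: "H \<in> L2 lborel"
    and orth: "\<And>a b. L2_inner lborel H (fourier (indicator {a..b})) = 0"
  shows "AE u in lborel. H u = 0"
proof -
  let ?E = "fourier (indicator {0..1})"
  define G where "G u = H u * cnj (?E u)" for u
  have Gi: "integrable lborel G" unfolding G_def by (intro L2_inner_integrable H fourier_interval_L2)
  have E1: "cmod (?E u) \<le> 1" for u
  proof -
    have "cmod (?E u) \<le> (\<integral>x. cmod (indicator {0..1::real} x) \<partial>lborel)"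
      by (rule fourier_norm_le) simp
    also have "\<dots> = (\<integral>x. indicator {0..1::real} x \<partial>lborel)"
      by (intro Bochner_Integration.integral_cong) (auto simp: indicator_def)
    finally show ?thesis by simp
  qed
  have G2: "G \<in> L2 lborel"
    by (rule L2_bound[OF H, where C=1])
      (use Gi E1 in \<open>auto simp: G_def norm_mult mult_left_le\<close>)
  \<comment> \<open>only the point $u = 0$ is excluded, where the formula for the transform divides by $0$\<close>
  have E_shift: "fourier (indicator {a..a+1}) u = exp (- \<i> * of_real (u * a)) * ?E u" if "u \<noteq> 0" for a u
    using that by (simp add: fourier_interval right_diff_distrib ring_distribs exp_diff exp_add exp_minus)
      (simp add: field_simps)
  have "fourier G (- a) = 0" for a
  proof -
    have "fourier G (- a) = L2_inner lborel H (fourier (indicator {a..a+1}))"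
      unfolding fourier_def[of G] L2_inner_def
    proof (rule integral_cong_AE)
      show "AE u in lborel. exp (- \<i> * complex_of_real (- a * u)) * G u = H u * cnj (fourier (indicator {a..a + 1}) u)"
        using AE_lborel_singleton[of 0]
        by eventually_elim (simp add: E_shift G_def exp_cnj mult_ac)
    qed (use fourier_integrable[OF Gi, of "-a"] L2_inner_integrable[OF H fourier_interval_L2] in auto)
    then show ?thesis by (simp add: orth)
  qed
  then have F0: "fourier G u = 0" for u by (metis minus_minus)
  have U0: "AE u in lborel. fourier_L2 G u = 0"
    using fourier_L2_eq_fourier[OF G2 Gi] by (simp add: F0)
  have "L2_inner lborel (fourier_L2 G) (fourier_L2 G) = L2_inner lborel (\<lambda>u::real. 0) (\<lambda>u. 0)"
    by (intro L2_inner_cong_AE U0 fourier_L2_in_L2 G2 L2_zero)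
  then have "of_real (2 * pi) * L2_inner lborel G G = 0"
    using Parseval[OF G2 G2] by (simp add: L2_inner_def)
  then have "L2_norm lborel G = 0" by (simp add: L2_inner_self)
  then have "AE u in lborel. G u = 0" by (rule L2_norm_zero_AE[OF G2])
  moreover have "AE u in lborel. ?E u \<noteq> 0"
  proof (rule AE_I)
    let ?N = "range (\<lambda>k::int. 2 * pi * of_int k)"
    show "{u \<in> space lborel. \<not> ?E u \<noteq> 0} \<subseteq> ?N"
    proof
      fix u assume "u \<in> {u \<in> space lborel. \<not> ?E u \<noteq> 0}"
      then have u: "?E u = 0" by simp
      show "u \<in> ?N"
      proof (cases "u = 0")
        case False
        then have "exp (- (\<i> * of_real u)) = 1" using u by (simp add: fourier_interval)
        then have "Re (exp (- (\<i> * of_real u))) = 1" by simp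
        then have "cos u = 1" by (simp add: Re_exp)
        then show ?thesis unfolding cos_one_2pi_int by (auto simp: mult_ac) 
      qed (auto intro: image_eqI[of _ _ 0])
    qed
    show "emeasure lborel ?N = 0" by (intro emeasure_lborel_countable) simp
  qed (auto intro: sets.countable)
  ultimately show ?thesis by eventually_elim (simp add: G_def)
qed

text \<open>The inverse transform of $F$ is $\frac{1}{2\pi}\overline{U\overline{F}}$, where $U$ is the Fourier
  transform: by the multiplication formula, $U$ of it has the same inner products as $F$ with
  the transforms of all intervals.\<close>

theorem fourier_L2_surj:
  assumes F: "F \<in> L2 lborel"
  shows "\<exists>g\<in>L2 lborel. AE u in lborel. fourier_L2 g u = F u"
proof
  define W where "W = fourier_L2 (\<lambda>u. cnj (F u))"
  define g where "g x = of_real (1 / (2 * pi)) * cnj (W x)" for x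
  have W: "W \<in> L2 lborel" unfolding W_def by (intro fourier_L2_in_L2 L2_cnj F)
  show g: "g \<in> L2 lborel" unfolding g_def[abs_def] by (intro L2_cmult L2_cnj W)
  note Ug = fourier_L2_in_L2[OF g]
  have "L2_inner lborel (fourier_L2 g) (fourier (indicator {a..b})) = L2_inner lborel F (fourier (indicator {a..b}))" for a b
  proof -
    let ?I = "indicator {a..b} :: real \<Rightarrow> complex"
    have E: "AE u in lborel. fourier_L2 ?I u = fourier ?I u"
      by (rule fourier_L2_eq_fourier) auto
    note UI = fourier_L2_in_L2[OF interval_L2[of a b]]
    have "L2_inner lborel (fourier_L2 g) (fourier ?I) = L2_inner lborel (fourier_L2 g) (fourier_L2 ?I)"
      using E by (intro L2_inner_cong_AE Ug UI fourier_interval_L2) auto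
    also have "\<dots> = of_real (2 * pi) * L2_inner lborel g ?I" by (rule Parseval[OF g interval_L2])
    also have "\<dots> = (\<integral>x. cnj (W x * ?I x) \<partial>lborel)"
      by (simp add: g_def[abs_def] L2_inner_cmult_left) (simp add: L2_inner_def)
    also have "\<dots> = cnj (\<integral>x. W x * ?I x \<partial>lborel)" by (rule Bochner_Integration.integral_cnj)
    also have "\<dots> = cnj (\<integral>u. cnj (F u) * fourier_L2 ?I u \<partial>lborel)"
      unfolding W_def by (subst fourier_L2_multiplication_formula) (auto intro: L2_cnj F)
    also have "\<dots> = L2_inner lborel F (fourier_L2 ?I)"
      by (simp add: L2_inner_def flip: Bochner_Integration.integral_cnj)
    also have "\<dots> = L2_inner lborel F (fourier ?I)"
      using E by (intro L2_inner_cong_AE F UI fourier_interval_L2) auto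
    finally show ?thesis .
  qed
  then have "AE u in lborel. fourier_L2 g u - F u = 0"
    by (intro orthogonal_to_fourier_intervals L2_diff Ug F)
      (simp add: L2_inner_diff_left Ug F fourier_interval_L2)
  then show "AE u in lborel. fourier_L2 g u = F u" by simp
qed

section \<open>Density of the Schwartz functions\<close>

text \<open>Each factor $x$ costs half of the Gaussian decay that is left.\<close>

lemma poly_gauss_bounded:
  fixes p :: "real poly"
  shows "a > 0 \<Longrightarrow> \<exists>C. \<forall>x. \<bar>poly p x\<bar> * exp (- a * x\<^sup>2) \<le> C"
proof (induction p arbitrary: a)
  case 0
  show ?case by (intro exI[of _ 0]) simp
next
  case (pCons c p)
  define b where "b = a / 2"
  have b: "b > 0" using pCons(3) by (simp add: b_def)
  obtain C where C: "\<And>x. \<bar>poly p x\<bar> * exp (- b * x\<^sup>2) \<le> C" using pCons(2)[OF b] by blast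
  have x: "\<bar>x\<bar> * exp (- b * x\<^sup>2) \<le> 1 + 1 / b" for x
  proof -
    have "\<bar>x\<bar> \<le> 1 + x\<^sup>2" using sum_squares_bound[of "\<bar>x\<bar>" 1] by simp
    also have "\<dots> \<le> (1 + 1 / b) * (1 + b * x\<^sup>2)" using b by (simp add: field_simps)
    also have "\<dots> \<le> (1 + 1 / b) * exp (b * x\<^sup>2)"
      using b by (intro mult_left_mono exp_ge_add_one_self) simp
    finally show ?thesis by (simp add: exp_minus field_simps)
  qed
  have "\<bar>poly (pCons c p) x\<bar> * exp (- a * x\<^sup>2) \<le> \<bar>c\<bar> + (1 + 1 / b) * C" for x
  proof -
    have e: "exp (- a * x\<^sup>2) = exp (- b * x\<^sup>2) * exp (- b * x\<^sup>2)"
      by (simp add: b_def flip: exp_add)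
    have "\<bar>poly (pCons c p) x\<bar> * exp (- a * x\<^sup>2) \<le> (\<bar>c\<bar> + \<bar>x\<bar> * \<bar>poly p x\<bar>) * exp (- a * x\<^sup>2)"
      by (intro mult_right_mono) (auto simp: abs_mult intro: order_trans[OF abs_triangle_ineq])
    also have "\<dots> = \<bar>c\<bar> * exp (- a * x\<^sup>2) + (\<bar>x\<bar> * exp (- b * x\<^sup>2)) * (\<bar>poly p x\<bar> * exp (- b * x\<^sup>2))"
      unfolding distrib_right e by (simp only: mult_ac)
    also have "\<dots> \<le> \<bar>c\<bar> * 1 + (1 + 1 / b) * C"
    proof (intro add_mono mult_left_mono mult_mono x C)
      show "exp (- a * x\<^sup>2) \<le> 1" using pCons(3) by simp
    qed (use b in auto)
    finally show ?thesis by simp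
  qed
  then show ?case by blast
qed

text \<open>This reduces a Gaussian with any centre to one centred at $0$, at the price of half the
  decay rate.\<close>

lemma shifted_gauss_le:
  fixes a c x :: real
  assumes "a > 0"
  shows "exp (- a * (x - c)\<^sup>2) \<le> exp (a * c\<^sup>2) * exp (- (a / 2) * x\<^sup>2)"
proof -
  have "x\<^sup>2 \<le> 2 * (x - c)\<^sup>2 + 2 * c\<^sup>2"
    using sum_squares_bound[of "x - c" c] by (simp add: power2_eq_square algebra_simps)
  then have "a * x\<^sup>2 \<le> a * (2 * (x - c)\<^sup>2 + 2 * c\<^sup>2)" using assms by (intro mult_left_mono) auto
  then show ?thesis by (simp add: algebra_simps flip: exp_add)
qed

text \<open>Polynomials times a fixed Gaussian are closed under differentiation.\<close>

lemma higher_deriv_poly_gauss: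
  fixes p :: "real poly"
  shows "\<exists>q. (deriv ^^ k) (\<lambda>x. poly p x * exp (- a * (x - c)\<^sup>2)) = (\<lambda>x. poly q x * exp (- a * (x - c)\<^sup>2))"
proof (induction k)
  case 0
  show ?case by auto
next
  case (Suc k)
  then obtain q where q: "(deriv ^^ k) (\<lambda>x. poly p x * exp (- a * (x - c)\<^sup>2)) = (\<lambda>x. poly q x * exp (- a * (x - c)\<^sup>2))"
    by blast
  have "((\<lambda>x. poly q x * exp (- a * (x - c)\<^sup>2)) has_real_derivative
      poly (pderiv q - smult (2 * a) ([:-c, 1:] * q)) x * exp (- a * (x - c)\<^sup>2)) (at x)" for x
    by (auto intro!: derivative_eq_intros simp: algebra_simps)
  then have "deriv (\<lambda>x. poly q x * exp (- a * (x - c)\<^sup>2))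
      = (\<lambda>x. poly (pderiv q - smult (2 * a) ([:-c, 1:] * q)) x * exp (- a * (x - c)\<^sup>2))"
    by (auto intro!: DERIV_imp_deriv)
  then have "(deriv ^^ Suc k) (\<lambda>x. poly p x * exp (- a * (x - c)\<^sup>2))
      = (\<lambda>x. poly (pderiv q - smult (2 * a) ([:-c, 1:] * q)) x * exp (- a * (x - c)\<^sup>2))"
    by (simp only: funpow.simps o_def q)
  then show ?case by blast
qed

lemma is_schwartz_poly_gauss:
  assumes "a > 0"
  shows "is_schwartz (\<lambda>x. poly p x * exp (- a * (x - c)\<^sup>2))"
  unfolding is_schwartz_def
proof (intro conjI allI)
  fix k x
  obtain q where q: "(deriv ^^ k) (\<lambda>x. poly p x * exp (- a * (x - c)\<^sup>2)) = (\<lambda>x. poly q x * exp (- a * (x - c)\<^sup>2))"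
    using higher_deriv_poly_gauss by blast
  have "((\<lambda>x. poly q x * exp (- a * (x - c)\<^sup>2)) has_real_derivative
      poly (pderiv q - smult (2 * a) ([:-c, 1:] * q)) x * exp (- a * (x - c)\<^sup>2)) (at x)"
    by (auto intro!: derivative_eq_intros simp: algebra_simps)
  then show "(deriv ^^ k) (\<lambda>x. poly p x * exp (- a * (x - c)\<^sup>2)) field_differentiable at x"
    unfolding q field_differentiable_def by blast
next
  fix j k
  obtain q where q: "(deriv ^^ k) (\<lambda>x. poly p x * exp (- a * (x - c)\<^sup>2)) = (\<lambda>x. poly q x * exp (- a * (x - c)\<^sup>2))"
    using higher_deriv_poly_gauss by blast
  obtain C where C: "\<And>x. \<bar>poly (monom 1 j * q) x\<bar> * exp (- (a / 2) * x\<^sup>2) \<le> C"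
    using poly_gauss_bounded[of "a / 2" "monom 1 j * q"] assms by auto
  have "\<bar>x ^ j * (poly q x * exp (- a * (x - c)\<^sup>2))\<bar> \<le> exp (a * c\<^sup>2) * C" for x
  proof -
    have "\<bar>x ^ j * (poly q x * exp (- a * (x - c)\<^sup>2))\<bar> = \<bar>poly (monom 1 j * q) x\<bar> * exp (- a * (x - c)\<^sup>2)"
      by (simp add: abs_mult poly_monom)
    also have "\<dots> \<le> \<bar>poly (monom 1 j * q) x\<bar> * (exp (a * c\<^sup>2) * exp (- (a / 2) * x\<^sup>2))"
      by (intro mult_left_mono shifted_gauss_le assms) simp
    also have "\<dots> = exp (a * c\<^sup>2) * (\<bar>poly (monom 1 j * q) x\<bar> * exp (- (a / 2) * x\<^sup>2))"
      by simp
    also have "\<dots> \<le> exp (a * c\<^sup>2) * C" by (intro mult_left_mono C) simp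
    finally show ?thesis .
  qed
  then show "\<exists>C. \<forall>x. \<bar>x ^ j * (deriv ^^ k) (\<lambda>x. poly p x * exp (- a * (x - c)\<^sup>2)) x\<bar> \<le> C"
    unfolding q by blast
qed

text \<open>An antiderivative of a Schwartz function need not decay at both ends, so only the bounds
  on the function itself remain to be supplied.\<close>

lemma is_schwartz_antiderivative:
  assumes G: "is_schwartz G" and F: "\<And>x. (F has_real_derivative G x) (at x)"
    and bound: "\<And>j. \<exists>C. \<forall>x. \<bar>x ^ j * F x\<bar> \<le> C"
  shows "is_schwartz F"
proof -
  have dF: "deriv F = G" using F by (auto intro!: DERIV_imp_deriv)
  have S: "(deriv ^^ Suc k) F = (deriv ^^ k) G" for k
    by (simp only: funpow_Suc_right o_def dF)
  show ?thesis
    unfolding is_schwartz_def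
  proof (intro conjI allI)
    fix k x
    show "(deriv ^^ k) F field_differentiable at x"
    proof (cases k)
      case 0
      then show ?thesis using F[of x] by (auto simp: field_differentiable_def)
    next
      case (Suc n)
      then show ?thesis using G unfolding Suc S is_schwartz_def by blast
    qed
  next
    fix j k
    show "\<exists>C. \<forall>x. \<bar>x ^ j * (deriv ^^ k) F x\<bar> \<le> C"
    proof (cases k)
      case 0
      then show ?thesis using bound by simp
    next
      case (Suc n)
      then show ?thesis using G unfolding Suc S is_schwartz_def by blast
    qed
  qed
qed

text \<open>The probability that $x + \sigma Z$ lies in $[l,r]$ for a standard normal $Z$, that is,
  the convolution of the indicator of $[l,r]$ with a centred Gaussian of standard deviation
  $\sigma$.\<close>

definition smoothed_interval :: "real \<Rightarrow> real \<Rightarrow> real \<Rightarrow> real \<Rightarrow> real" where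
  "smoothed_interval l r \<sigma> x = (\<integral>z. indicator {l..r} (x + \<sigma> * z) * std_normal_density z \<partial>lborel)"

lemma std_normal_antiderivative:
  "\<exists>\<Phi>. \<forall>t. (\<Phi> has_real_derivative std_normal_density t) (at t)"
proof (intro exI allI)
  fix t :: real
  have "continuous_on {min 0 t - 1..max 0 t + 1} std_normal_density"
    unfolding std_normal_density_def by (intro continuous_intros) auto
  then have "((\<lambda>u. LBINT y=0..u. std_normal_density y) has_vector_derivative std_normal_density t)
      (at t within {min 0 t - 1..max 0 t + 1})"
    using interval_integral_FTC2[of "min 0 t - 1" 0 "max 0 t + 1" std_normal_density t]
    by (simp add: zero_ereal_def)
  moreover have "at t within {min 0 t - 1..max 0 t + 1} = at t"
    by (rule at_within_interior) auto
  ultimately show "((\<lambda>u. LBINT y=0..u. std_normal_density y) has_real_derivative std_normal_density t) (at t)"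
    by (simp add: has_real_derivative_iff_has_vector_derivative)
qed

lemma smoothed_interval_eq:
  assumes \<Phi>: "\<And>t. (\<Phi> has_real_derivative std_normal_density t) (at t)" and "\<sigma> > 0" "l \<le> r"
  shows "smoothed_interval l r \<sigma> x = \<Phi> ((r - x) / \<sigma>) - \<Phi> ((l - x) / \<sigma>)"
proof -
  have hb: "has_bochner_integral lborel (\<lambda>z. indicator {(l - x) / \<sigma>..(r - x) / \<sigma>} z *\<^sub>R std_normal_density z)
      (\<Phi> ((r - x) / \<sigma>) - \<Phi> ((l - x) / \<sigma>))"
  proof (rule has_bochner_integral_FTC_Icc)
    show "(l - x) / \<sigma> \<le> (r - x) / \<sigma>" using assms by (intro divide_right_mono) auto
    show "(\<Phi> has_vector_derivative std_normal_density t) (at t within {(l - x) / \<sigma>..(r - x) / \<sigma>})" for t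
      using \<Phi>[of t] by (auto simp: has_real_derivative_iff_has_vector_derivative intro: has_vector_derivative_at_within)
    show "continuous_on {(l - x) / \<sigma>..(r - x) / \<sigma>} std_normal_density"
      unfolding std_normal_density_def by (intro continuous_intros) auto
  qed
  have eq: "indicator {(l - x) / \<sigma>..(r - x) / \<sigma>} z *\<^sub>R std_normal_density z
      = indicator {l..r} (x + \<sigma> * z) * std_normal_density z" for z
    using assms(2) by (auto simp: indicator_def field_simps)
  show ?thesis
    using has_bochner_integral_integral_eq[OF hb] unfolding eq smoothed_interval_def .
qed

text \<open>The derivative is a difference of two Gaussians, centred at $l$ and at $r$. By the mean
  value theorem in the endpoint, the function itself is $r - l$ times a Gaussian with some centre in
  $[l,r]$, which gives the decay.\<close>

lemma is_schwartz_smoothed_interval: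
  assumes "\<sigma> > 0" "l \<le> r"
  shows "is_schwartz (smoothed_interval l r \<sigma>)"
proof -
  obtain \<Phi> where \<Phi>: "\<And>t. (\<Phi> has_real_derivative std_normal_density t) (at t)"
    using std_normal_antiderivative by blast
  have eq: "smoothed_interval l r \<sigma> = (\<lambda>x. \<Phi> ((r - x) / \<sigma>) - \<Phi> ((l - x) / \<sigma>))"
    using smoothed_interval_eq[OF \<Phi> assms] by blast
  define a where "a = 1 / (2 * \<sigma>\<^sup>2)"
  have a: "a > 0" using assms by (simp add: a_def)
  define K where "K = 1 / (sqrt (2 * pi) * \<sigma>)"
  have K: "K \<ge> 0" using assms by (simp add: K_def)
  have dens: "std_normal_density ((c - x) / \<sigma>) / \<sigma> = K * exp (- a * (x - c)\<^sup>2)" for c x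
    using assms by (simp add: std_normal_density_def K_def a_def power_divide power2_commute[of c] field_simps)
  have d: "((\<lambda>x. \<Phi> ((c - x) / \<sigma>)) has_real_derivative - (K * exp (- a * (x - c)\<^sup>2))) (at x)" for c x
  proof -
    have "((\<lambda>x. (c - x) / \<sigma>) has_real_derivative - 1 / \<sigma>) (at x)"
      using assms by (auto intro!: derivative_eq_intros)
    from DERIV_chain2[OF \<Phi> this]
    show ?thesis unfolding dens[symmetric] by simp
  qed
  show ?thesis
  proof (rule is_schwartz_antiderivative)
    show "is_schwartz (\<lambda>x. poly [:K:] x * exp (- a * (x - l)\<^sup>2) + poly [:-K:] x * exp (- a * (x - r)\<^sup>2))"
      by (intro is_schwartz_add is_schwartz_poly_gauss a)
    show "(smoothed_interval l r \<sigma> has_real_derivative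
        poly [:K:] x * exp (- a * (x - l)\<^sup>2) + poly [:-K:] x * exp (- a * (x - r)\<^sup>2)) (at x)" for x
      unfolding eq using DERIV_diff[OF d[of r x] d[of l x]] by (simp add: algebra_simps)
    fix j
    define M where "M = max \<bar>l\<bar> \<bar>r\<bar>"
    obtain C where C: "\<And>x. \<bar>poly (monom 1 j) x\<bar> * exp (- (a / 2) * x\<^sup>2) \<le> C"
      using poly_gauss_bounded[of "a / 2" "monom 1 j"] a by auto
    have "\<bar>x ^ j * smoothed_interval l r \<sigma> x\<bar> \<le> (r - l) * K * exp (a * M\<^sup>2) * C" for x
    proof -
      have "\<exists>c. l \<le> c \<and> c \<le> r \<and> smoothed_interval l r \<sigma> x = (r - l) * (K * exp (- a * (x - c)\<^sup>2))"
      proof (cases "l = r")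
        case False
        then have "l < r" using assms by simp
        have "((\<lambda>c. \<Phi> ((c - x) / \<sigma>)) has_real_derivative K * exp (- a * (x - c)\<^sup>2)) (at c)" for c
        proof -
          have "((\<lambda>c. (c - x) / \<sigma>) has_real_derivative 1 / \<sigma>) (at c)"
            using assms by (auto intro!: derivative_eq_intros)
          from DERIV_chain2[OF \<Phi> this]
          show ?thesis unfolding dens[symmetric] by simp
        qed
        from MVT2[OF \<open>l < r\<close> this] show ?thesis unfolding eq by (meson less_imp_le)
      qed (use eq in auto)
      then obtain c where c: "l \<le> c" "c \<le> r" "smoothed_interval l r \<sigma> x = (r - l) * (K * exp (- a * (x - c)\<^sup>2))"
        by blast
      have "exp (- a * (x - c)\<^sup>2) \<le> exp (a * c\<^sup>2) * exp (- (a / 2) * x\<^sup>2)" by (rule shifted_gauss_le[OF a])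
      also have "\<dots> \<le> exp (a * M\<^sup>2) * exp (- (a / 2) * x\<^sup>2)"
      proof (intro mult_right_mono)
        have "\<bar>c\<bar> \<le> \<bar>M\<bar>" unfolding M_def using c by auto
        then have "c\<^sup>2 \<le> M\<^sup>2" by (simp add: abs_le_square_iff)
        then show "exp (a * c\<^sup>2) \<le> exp (a * M\<^sup>2)" using a by simp
      qed simp
      finally have e: "exp (- a * (x - c)\<^sup>2) \<le> exp (a * M\<^sup>2) * exp (- (a / 2) * x\<^sup>2)" .
      have "\<bar>x ^ j * smoothed_interval l r \<sigma> x\<bar> = ((r - l) * K) * (\<bar>x ^ j\<bar> * exp (- a * (x - c)\<^sup>2))"
        using K assms by (simp add: c(3) abs_mult)
      also have "\<dots> \<le> ((r - l) * K) * (\<bar>x ^ j\<bar> * (exp (a * M\<^sup>2) * exp (- (a / 2) * x\<^sup>2)))"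
        using K assms by (intro mult_left_mono e) auto
      also have "\<dots> = ((r - l) * K * exp (a * M\<^sup>2)) * (\<bar>poly (monom 1 j) x\<bar> * exp (- (a / 2) * x\<^sup>2))"
        by (simp add: poly_monom)
      also have "\<dots> \<le> ((r - l) * K * exp (a * M\<^sup>2)) * C"
        using K assms by (intro mult_left_mono C) auto
      finally show ?thesis .
    qed
    then show "\<exists>C. \<forall>x. \<bar>x ^ j * smoothed_interval l r \<sigma> x\<bar> \<le> C" by blast
  qed
qed

text \<open>Boundedness of $f$ and $x^2 f$ gives $|f| \le C/(1+x^2)$.\<close>

lemma is_schwartz_L2:
  assumes "is_schwartz f"
  shows "f \<in> L2 lborel"
proof -
  have "f field_differentiable at x" for x
    using assms funpow_0[of deriv f] unfolding is_schwartz_def by metis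
  then have "continuous_on UNIV f"
    by (auto intro!: continuous_at_imp_continuous_on field_differentiable_imp_continuous_at)
  then have [measurable]: "f \<in> borel_measurable borel" by (rule borel_measurable_continuous_onI)
  have bd: "\<exists>C. \<forall>x. \<bar>x ^ j * f x\<bar> \<le> C" for j
    using assms funpow_0[of deriv f] unfolding is_schwartz_def by metis
  obtain A B where A: "\<And>x. \<bar>x ^ 0 * f x\<bar> \<le> A" and B: "\<And>x. \<bar>x ^ 2 * f x\<bar> \<le> B"
    using bd[of 0] bd[of 2] by blast
  have f: "\<bar>f x\<bar> \<le> (A + B) * inverse (1 + x\<^sup>2)" for x
  proof -
    have "(1 + x\<^sup>2) * \<bar>f x\<bar> \<le> A + B" using A[of x] B[of x] by (simp add: distrib_right abs_mult)
    moreover have "1 + x\<^sup>2 > 0" by (simp add: add_pos_nonneg)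
    ultimately show ?thesis by (simp add: field_simps)
  qed
  have i: "integrable lborel (\<lambda>x::real. inverse (1 + x\<^sup>2))"
    using integrable_inverse_1_plus_square by (simp add: set_integrable_def)
  show ?thesis
  proof (rule L2_I)
    show "integrable lborel (\<lambda>x. (norm (f x))\<^sup>2)"
    proof (rule Bochner_Integration.integrable_bound)
      show "integrable lborel (\<lambda>x. A * (A + B) * inverse (1 + x\<^sup>2))" using i by simp
      show "AE x in lborel. norm ((norm (f x))\<^sup>2) \<le> norm (A * (A + B) * inverse (1 + x\<^sup>2))"
      proof (rule AE_I2)
        fix x
        have A': "\<bar>f x\<bar> \<le> A" using A[of x] by simp
        have "(norm (f x))\<^sup>2 = \<bar>f x\<bar> * \<bar>f x\<bar>" by (simp add: power2_eq_square)
        also have "\<dots> \<le> A * ((A + B) * inverse (1 + x\<^sup>2))"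
          using A' f[of x] by (intro mult_mono) auto
        finally have "(norm (f x))\<^sup>2 \<le> A * ((A + B) * inverse (1 + x\<^sup>2))" .
        then show "norm ((norm (f x))\<^sup>2) \<le> norm (A * (A + B) * inverse (1 + x\<^sup>2))"
          by (simp add: mult.assoc)
      qed
    qed measurable
  qed simp
qed

text \<open>Where $1_{[l,r]}(x + h) \ne 1_{[l,r]}(x)$, the point $x$ lies within $|h|$ of an endpoint; integrating
  this over $x$ and averaging over $h = \sigma z$ gives an error of order $\sigma$.\<close>

lemma smoothed_interval_error:
  assumes "\<sigma> > 0" "l \<le> r"
  shows "(L2_norm lborel (\<lambda>x. smoothed_interval l r \<sigma> x - indicator {l..r} x))\<^sup>2
    \<le> \<sigma> * (4 * (\<integral>z. std_normal_density z * \<bar>z\<bar> \<partial>lborel))"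
proof -
  let ?F = "smoothed_interval l r \<sigma>" and ?\<phi> = std_normal_density
  define B :: "real \<Rightarrow> real \<Rightarrow> real" where
    "B h x = indicator {l - \<bar>h\<bar>..l + \<bar>h\<bar>} x + indicator {r - \<bar>h\<bar>..r + \<bar>h\<bar>} x" for h x
  have B0: "0 \<le> B h x" for h x by (simp add: B_def)
  have B1: "\<bar>indicator {l..r} (x + h) - indicator {l..r} x\<bar> \<le> B h x" for x h
    by (auto simp: B_def indicator_def split: if_splits)
  have Bm: "(\<lambda>(x, z). ennreal (B (\<sigma> * z) x * ?\<phi> z)) \<in> borel_measurable (lborel \<Otimes>\<^sub>M lborel)"
  proof -
    have "(\<lambda>(x, z). B (\<sigma> * z) x) = (\<lambda>w. (if l - \<bar>\<sigma> * snd w\<bar> \<le> fst w \<and> fst w \<le> l + \<bar>\<sigma> * snd w\<bar> then 1 else 0)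
        + (if r - \<bar>\<sigma> * snd w\<bar> \<le> fst w \<and> fst w \<le> r + \<bar>\<sigma> * snd w\<bar> then 1 else 0))"
      by (auto simp: B_def indicator_def fun_eq_iff)
    also have "\<dots> \<in> borel_measurable (lborel \<Otimes>\<^sub>M lborel)" by measurable
    finally have [measurable]: "(\<lambda>(x, z). B (\<sigma> * z) x) \<in> borel_measurable (lborel \<Otimes>\<^sub>M lborel)" .
    have "(\<lambda>w. ennreal ((case w of (x, z) \<Rightarrow> B (\<sigma> * z) x) * ?\<phi> (snd w))) \<in> borel_measurable (lborel \<Otimes>\<^sub>M lborel)"
      by measurable
    then show ?thesis by (simp add: case_prod_unfold)
  qed
  have ind_int: "integrable lborel (\<lambda>z. indicator {l..r} (x + \<sigma> * z) * ?\<phi> z)" for x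
    by (rule Bochner_Integration.integrable_bound[OF integrable_normal_density[where \<mu>=0 and \<sigma>=1]])
      (auto simp: indicator_def)
  have F01: "0 \<le> ?F x" "?F x \<le> 1" for x
  proof -
    show "0 \<le> ?F x" unfolding smoothed_interval_def by (intro Bochner_Integration.integral_nonneg) simp
    have "?F x \<le> (\<integral>z. ?\<phi> z \<partial>lborel)"
      unfolding smoothed_interval_def by (intro integral_mono ind_int) (auto simp: indicator_def)
    then show "?F x \<le> 1" by simp
  qed
  have pw: "ennreal ((norm (?F x - indicator {l..r} x))\<^sup>2) \<le> (\<integral>\<^sup>+z. ennreal (B (\<sigma> * z) x * ?\<phi> z) \<partial>lborel)" for x
  proof -
    \<comment> \<open>both functions take values in $[0,1]$, so the square is bounded by the absolute value\<close>
    have "\<bar>?F x - indicator {l..r} x\<bar> \<le> 1"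
      using F01[of x] by (auto simp: indicator_def)
    then have sq: "(norm (?F x - indicator {l..r} x))\<^sup>2 \<le> norm (?F x - indicator {l..r} x)"
      unfolding power2_eq_square by (intro mult_left_le) auto
    have "?F x - indicator {l..r} x = (\<integral>z. (indicator {l..r} (x + \<sigma> * z) - indicator {l..r} x) * ?\<phi> z \<partial>lborel)"
      unfolding smoothed_interval_def left_diff_distrib
      by (subst Bochner_Integration.integral_diff) (auto intro: ind_int)
    with sq have "ennreal ((norm (?F x - indicator {l..r} x))\<^sup>2)
        \<le> ennreal (norm (\<integral>z. (indicator {l..r} (x + \<sigma> * z) - indicator {l..r} x) * ?\<phi> z \<partial>lborel))"
      by (simp add: ennreal_leI)
    also have "\<dots> \<le> (\<integral>\<^sup>+z. ennreal (norm ((indicator {l..r} (x + \<sigma> * z) - indicator {l..r} x) * ?\<phi> z)) \<partial>lborel)"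
      unfolding left_diff_distrib
      by (intro integral_norm_bound_ennreal Bochner_Integration.integrable_diff ind_int) auto
    also have "\<dots> \<le> (\<integral>\<^sup>+z. ennreal (B (\<sigma> * z) x * ?\<phi> z) \<partial>lborel)"
      by (intro nn_integral_mono ennreal_leI) (auto simp: abs_mult intro!: mult_right_mono B1)
    finally show ?thesis .
  qed
  have FL: "(\<lambda>x. ?F x - indicator {l..r} x) \<in> L2 lborel"
    by (intro L2_diff is_schwartz_L2[OF is_schwartz_smoothed_interval[OF assms]] indicator_interval_L2)
  have "ennreal ((L2_norm lborel (\<lambda>x. ?F x - indicator {l..r} x))\<^sup>2)
      = (\<integral>\<^sup>+x. ennreal ((norm (?F x - indicator {l..r} x))\<^sup>2) \<partial>lborel)"
    by (rule nn_integral_L2_norm[OF FL, symmetric])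
  also have "\<dots> \<le> (\<integral>\<^sup>+x. (\<integral>\<^sup>+z. ennreal (B (\<sigma> * z) x * ?\<phi> z) \<partial>lborel) \<partial>lborel)"
    by (intro nn_integral_mono pw)
  also have "\<dots> = (\<integral>\<^sup>+z. (\<integral>\<^sup>+x. ennreal (B (\<sigma> * z) x * ?\<phi> z) \<partial>lborel) \<partial>lborel)"
    using lborel_pair.Fubini'[OF Bm] by simp
  also have "\<dots> = (\<integral>\<^sup>+z. ennreal (\<sigma> * (4 * (?\<phi> z * \<bar>z\<bar>))) \<partial>lborel)"
  proof (intro nn_integral_cong)
    fix z :: real
    have hb: "has_bochner_integral lborel (\<lambda>x. B h x) (4 * \<bar>h\<bar>)" for h
    proof -
      have "has_bochner_integral lborel (indicator {c - \<bar>h\<bar>..c + \<bar>h\<bar>} :: real \<Rightarrow> real) (2 * \<bar>h\<bar>)" for c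
        using has_bochner_integral_real_indicator[of "{c - \<bar>h\<bar>..c + \<bar>h\<bar>}" lborel]
        by (simp add: emeasure_lborel_Icc_eq)
      from has_bochner_integral_add[OF this[of l] this[of r]] show ?thesis by (simp add: B_def)
    qed
    have "has_bochner_integral lborel (\<lambda>x. B (\<sigma> * z) x * ?\<phi> z) (4 * \<bar>\<sigma> * z\<bar> * ?\<phi> z)"
      by (rule has_bochner_integral_mult_left) (rule hb)
    then have "(\<integral>\<^sup>+x. ennreal (B (\<sigma> * z) x * ?\<phi> z) \<partial>lborel) = ennreal (4 * \<bar>\<sigma> * z\<bar> * ?\<phi> z)"
      using B0 by (subst nn_integral_eq_integral) (auto simp: has_bochner_integral_iff)
    then show "(\<integral>\<^sup>+x. ennreal (B (\<sigma> * z) x * ?\<phi> z) \<partial>lborel) = ennreal (\<sigma> * (4 * (?\<phi> z * \<bar>z\<bar>)))"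
      using assms(1) by (simp add: abs_mult mult_ac)
  qed
  also have "\<dots> = ennreal (\<integral>z. \<sigma> * (4 * (?\<phi> z * \<bar>z\<bar>)) \<partial>lborel)"
    using integrable_std_normal_moment_abs[of 1] assms(1) by (intro nn_integral_eq_integral) auto
  also have "(\<integral>z. \<sigma> * (4 * (?\<phi> z * \<bar>z\<bar>)) \<partial>lborel) = \<sigma> * (4 * (\<integral>z. ?\<phi> z * \<bar>z\<bar> \<partial>lborel))"
    by simp
  finally show ?thesis
    by (subst (asm) ennreal_le_iff)
      (use assms in \<open>auto intro!: mult_nonneg_nonneg Bochner_Integration.integral_nonneg\<close>)
qed

theorem schwartz_dense:
  assumes "f \<in> L2 lborel"
  shows "f \<in> L2_closure lborel {f. is_schwartz f}"
  using assms
proof (induction rule: L2_lborel_induct)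
  case (interval l r)
  show ?case
  proof (cases "l \<le> r")
    case True
    define C where "C = 4 * (\<integral>z. std_normal_density z * \<bar>z\<bar> \<partial>lborel)"
    define F where "F n = smoothed_interval l r (1 / real (Suc n))" for n
    have S: "is_schwartz (F n)" for n
      unfolding F_def by (rule is_schwartz_smoothed_interval) (use True in auto)
    have "tendsto_L2 lborel F (indicator {l..r})"
    proof (rule tendsto_L2_I)
      have "(\<lambda>n. sqrt (1 / real (Suc n) * C)) \<longlonglongrightarrow> sqrt (0 * C)"
        by (intro tendsto_real_sqrt tendsto_mult tendsto_const LIMSEQ_Suc[OF lim_1_over_n])
      then show "(\<lambda>n. sqrt (1 / real (Suc n) * C)) \<longlonglongrightarrow> 0" by simp
      have "L2_norm lborel (\<lambda>x. F n x - indicator {l..r} x) \<le> sqrt (1 / real (Suc n) * C)" for n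
        unfolding F_def C_def using smoothed_interval_error[of "1 / real (Suc n)" l r] True
        by (intro real_le_rsqrt) simp
      then show "\<forall>\<^sub>F n in sequentially. L2_norm lborel (\<lambda>x. F n x - indicator {l..r} x) \<le> sqrt (1 / real (Suc n) * C)"
        by (intro always_eventually allI)
    qed (auto intro: is_schwartz_L2 S)
    with S show ?thesis by (auto simp: L2_closure_def)
  next
    case False
    have "(\<lambda>x. 0) \<in> L2_closure lborel {f. is_schwartz f}"
      using tendsto_L2_const[OF L2_zero, of "lborel :: real measure"] is_schwartz_zero
      by (auto simp: L2_closure_def)
    then show ?thesis using False by (simp add: indicator_def[abs_def])
  qed
next
  case (add f g)
  show ?case by (rule L2_closure_add[OF _ add(3,4)]) (auto intro: is_schwartz_add)
next
  case (scale c f)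
  show ?case by (rule L2_closure_linear_image[OF bounded_linear_mult_right _ scale(2)]) (auto intro: is_schwartz_scale)
next
  case (lim F f)
  then show ?case by (rule L2_closure_closed)
qed

section \<open>The white noise isometry\<close>

lemma Rep_schwartz_L2: "Rep_schwartz s \<in> L2 lborel"
  using Rep_schwartz[of s] by (intro is_schwartz_L2) simp

context
  fixes P :: "(schwartz \<Rightarrow> real) measure"
  assumes P: "white_noise_measure P"
begin

lemma white_noise_prob_space: "prob_space P"
  using P by (simp add: white_noise_measure_def)

lemma space_white_noise: "space P = tempered"
proof -
  have "sets P = sets (restrict_space borel tempered)" using P by (simp add: white_noise_measure_def)
  then have "space P = space (restrict_space borel tempered)" by (rule sets_eq_imp_space_eq)
  then show ?thesis by (simp add: space_restrict_space)
qed

lemma evaluation_linear: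
  assumes "\<omega> \<in> space P"
  shows "\<omega> (s + t) = \<omega> s + \<omega> t" "\<omega> (s - t) = \<omega> s - \<omega> t" "\<omega> (c *\<^sub>R s) = c * \<omega> s"
  using assms by (auto simp: space_white_noise tempered_def linear_add linear_diff linear_scale)

lemma evaluation_measurable: "(\<lambda>\<omega>. \<omega> s) \<in> borel_measurable P"
proof -
  have "(\<lambda>\<omega>::schwartz \<Rightarrow> real. \<omega> s) \<in> borel_measurable borel"
    by (intro borel_measurable_continuous_onI continuous_on_product_coordinates)
  then have "(\<lambda>\<omega>. \<omega> s) \<in> borel_measurable (restrict_space borel tempered)"
    by (rule measurable_restrict_space1)
  moreover have "sets P = sets (restrict_space borel tempered)" using P by (simp add: white_noise_measure_def)
  ultimately show ?thesis by (simp cong: measurable_cong_sets)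
qed

text \<open>Scaling the test function turns the characteristic functional into the characteristic
  function of $\omega \mapsto \omega(s)$, so by the uniqueness theorem for the latter this is a centred
  Gaussian of standard deviation $\|s\|$ (possibly $0$).\<close>

lemma evaluation_distribution:
  "distr P borel (\<lambda>\<omega>. \<omega> s) = distr std_normal_distribution borel (\<lambda>x. L2_norm lborel (Rep_schwartz s) * x)"
    (is "?A = ?B")
proof (rule Levy_uniqueness)
  let ?n = "L2_norm lborel (Rep_schwartz s)"
  interpret prob_space P by (rule white_noise_prob_space)
  interpret N: real_distribution std_normal_distribution by (rule real_dist_normal_dist)
  show "real_distribution ?A" by (rule real_distribution_distr[OF evaluation_measurable])
  show "real_distribution ?B" by (rule N.real_distribution_distr) measurable
  show "char ?A = char ?B"
  proof
    fix t :: real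
    have "char ?A t = (\<integral>\<omega>. exp (\<i> * complex_of_real (t * \<omega> s)) \<partial>P)"
      unfolding char_def by (subst integral_distr[OF evaluation_measurable]) auto
    also have "\<dots> = (\<integral>\<omega>. exp (\<i> * complex_of_real (\<omega> (t *\<^sub>R s))) \<partial>P)"
      by (intro Bochner_Integration.integral_cong) (simp_all add: evaluation_linear)
    also have "\<dots> = of_real (exp (- (L2_norm lborel (Rep_schwartz (t *\<^sub>R s)))\<^sup>2 / 2))"
      using P by (simp add: white_noise_measure_def)
    also have "(L2_norm lborel (Rep_schwartz (t *\<^sub>R s)))\<^sup>2 = (?n * t)\<^sup>2"
      by (simp add: L2_norm_sq scaleR_schwartz.rep_eq power_mult_distrib mult.commute)
    also have "of_real (exp (- (?n * t)\<^sup>2 / 2)) = char std_normal_distribution (?n * t)"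
      by (simp add: char_std_normal_distribution)
    also have "\<dots> = char ?B t"
      unfolding char_def by (subst integral_distr) (auto simp: mult_ac)
    finally show "char ?A t = char ?B t" .
  qed
qed

lemma evaluation_second_moment:
  "integrable P (\<lambda>\<omega>. (\<omega> s)\<^sup>2)" "(\<integral>\<omega>. (\<omega> s)\<^sup>2 \<partial>P) = (L2_norm lborel (Rep_schwartz s))\<^sup>2"
proof -
  let ?n = "L2_norm lborel (Rep_schwartz s)"
  have "integrable std_normal_distribution (\<lambda>x. ?n\<^sup>2 * x\<^sup>2)"
    using integrable_std_normal_distribution_moment[of 2] by simp
  then have "integrable (distr std_normal_distribution borel (\<lambda>x. ?n * x)) (\<lambda>x. x\<^sup>2)"
    by (subst integrable_distr_eq) (auto simp: power_mult_distrib)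
  then show "integrable P (\<lambda>\<omega>. (\<omega> s)\<^sup>2)"
    unfolding evaluation_distribution[symmetric] by (subst (asm) integrable_distr_eq[OF evaluation_measurable]) auto
  have "(\<integral>\<omega>. (\<omega> s)\<^sup>2 \<partial>P) = (\<integral>x. x\<^sup>2 \<partial>distr P borel (\<lambda>\<omega>. \<omega> s))"
    by (subst integral_distr[OF evaluation_measurable]) auto
  also have "\<dots> = (\<integral>x. ?n\<^sup>2 * x\<^sup>2 \<partial>std_normal_distribution)"
    unfolding evaluation_distribution by (subst integral_distr) (auto simp: power_mult_distrib)
  also have "\<dots> = ?n\<^sup>2"
    using std_normal_distribution_even_moments(1)[of 1] by (simp add: numeral_2_eq_2)
  finally show "(\<integral>\<omega>. (\<omega> s)\<^sup>2 \<partial>P) = ?n\<^sup>2" .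
qed

lemma evaluation_L2: "(\<lambda>\<omega>. \<omega> s) \<in> L2 P"
  by (rule L2_I) (use evaluation_second_moment(1) evaluation_measurable in simp_all)

lemma evaluation_diff_norm:
  "L2_norm P (\<lambda>\<omega>. \<omega> s - \<omega> t) = L2_norm lborel (\<lambda>x. Rep_schwartz s x - Rep_schwartz t x)"
proof -
  have "L2_norm P (\<lambda>\<omega>. \<omega> s - \<omega> t) = sqrt (\<integral>\<omega>. (\<omega> (s - t))\<^sup>2 \<partial>P)"
    unfolding L2_norm_def
    by (intro arg_cong[where f=sqrt] Bochner_Integration.integral_cong) (simp_all add: evaluation_linear)
  also have "\<dots> = L2_norm lborel (Rep_schwartz (s - t))"
    by (simp add: evaluation_second_moment)
  finally show ?thesis by (simp add: minus_schwartz.rep_eq)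
qed

lemma evaluation_inner:
  "(\<integral>\<omega>. \<omega> s * \<omega> t \<partial>P) = (\<integral>x. Rep_schwartz s x * Rep_schwartz t x \<partial>lborel)"
proof -
  let ?s = "Rep_schwartz s" and ?t = "Rep_schwartz t"
  have sq: "(x + y)\<^sup>2 - (x - y)\<^sup>2 = 4 * (x * y)" for x y :: real
    by (simp add: power2_eq_square algebra_simps)
  note i1 = L2_D(2)[OF L2_add[OF Rep_schwartz_L2[of s] Rep_schwartz_L2[of t]]]
    and i2 = L2_D(2)[OF L2_diff[OF Rep_schwartz_L2[of s] Rep_schwartz_L2[of t]]]
  have "4 * (\<integral>\<omega>. \<omega> s * \<omega> t \<partial>P) = (\<integral>\<omega>. (\<omega> (s + t))\<^sup>2 - (\<omega> (s - t))\<^sup>2 \<partial>P)"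
    unfolding integral_mult_right_zero[symmetric]
    by (intro Bochner_Integration.integral_cong) (simp_all add: evaluation_linear sq)
  also have "\<dots> = (L2_norm lborel (Rep_schwartz (s + t)))\<^sup>2 - (L2_norm lborel (Rep_schwartz (s - t)))\<^sup>2"
    by (simp add: evaluation_second_moment)
  also have "\<dots> = (\<integral>x. (?s x + ?t x)\<^sup>2 - (?s x - ?t x)\<^sup>2 \<partial>lborel)"
    using i1 i2 by (simp add: L2_norm_sq plus_schwartz.rep_eq minus_schwartz.rep_eq)
  also have "\<dots> = 4 * (\<integral>x. ?s x * ?t x \<partial>lborel)"
    by (simp add: sq)
  finally show ?thesis by simp
qed

text \<open>Evaluation is an isometry from the Schwartz functions, so it maps an approximating
  sequence to a Cauchy sequence: the choice in the definition of \<open>Q_real\<close> has a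
  witness. The witness need not be the limit along the sequence taken here, but every admissible
  choice comes with some approximating sequence.\<close>

lemma Q_real_approximation:
  assumes f: "f \<in> L2 lborel"
  shows "\<exists>s. tendsto_L2 lborel (\<lambda>n. Rep_schwartz (s n)) f \<and> tendsto_L2 P (\<lambda>n \<omega>. \<omega> (s n)) (Q_real P f)"
proof -
  obtain F where F: "\<And>n. is_schwartz (F n)" "tendsto_L2 lborel F f"
    using schwartz_dense[OF f] by (auto simp: L2_closure_def)
  define s where "s n = Abs_schwartz (F n)" for n
  have Rs: "Rep_schwartz (s n) = F n" for n
    unfolding s_def using F(1) by (simp add: Abs_schwartz_inverse)
  have "\<exists>X. tendsto_L2 P (\<lambda>n \<omega>. \<omega> (s n)) X"
    by (rule L2_isometric_image_converges[OF F(2) evaluation_L2, of 1]) (simp_all add: evaluation_diff_norm Rs)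
  moreover have "tendsto_L2 lborel (\<lambda>n. Rep_schwartz (s n)) f"
    using F(2) by (simp add: Rs)
  ultimately have "\<exists>X. \<exists>s. tendsto_L2 lborel (\<lambda>n. Rep_schwartz (s n)) f \<and> tendsto_L2 P (\<lambda>n \<omega>. \<omega> (s n)) X"
    by blast
  then show ?thesis unfolding Q_real_def by (rule someI_ex)
qed

lemma Q_real_L2: "f \<in> L2 lborel \<Longrightarrow> Q_real P f \<in> L2 P"
  using Q_real_approximation tendsto_L2_D(2) by blast

lemma Q_real_isometry:
  assumes f: "f \<in> L2 lborel" and g: "g \<in> L2 lborel"
  shows "(\<integral>\<omega>. Q_real P f \<omega> * Q_real P g \<omega> \<partial>P) = (\<integral>x. f x * g x \<partial>lborel)"
proof -
  obtain s where s: "tendsto_L2 lborel (\<lambda>n. Rep_schwartz (s n)) f" "tendsto_L2 P (\<lambda>n \<omega>. \<omega> (s n)) (Q_real P f)"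
    using Q_real_approximation[OF f] by blast
  obtain t where t: "tendsto_L2 lborel (\<lambda>n. Rep_schwartz (t n)) g" "tendsto_L2 P (\<lambda>n \<omega>. \<omega> (t n)) (Q_real P g)"
    using Q_real_approximation[OF g] by blast
  have "(\<lambda>n. \<integral>\<omega>. \<omega> (s n) * \<omega> (t n) \<partial>P) \<longlonglongrightarrow> (\<integral>\<omega>. Q_real P f \<omega> * Q_real P g \<omega> \<partial>P)"
    by (rule tendsto_L2_bilinear[OF bounded_bilinear_mult s(2) t(2)])
  moreover have "(\<lambda>n. \<integral>x. Rep_schwartz (s n) x * Rep_schwartz (t n) x \<partial>lborel) \<longlonglongrightarrow> (\<integral>x. f x * g x \<partial>lborel)"
    by (rule tendsto_L2_bilinear[OF bounded_bilinear_mult s(1) t(1)])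
  ultimately show ?thesis
    unfolding evaluation_inner by (rule LIMSEQ_unique)
qed

lemma Q_L2: "f \<in> L2 lborel \<Longrightarrow> Q P f \<in> L2 P"
  unfolding Q_def[abs_def] by (intro L2_add L2_cmult L2_of_real Q_real_L2 L2_Re L2_Im)

text \<open>Applied on both sides of the real isometry, this yields the complex one.\<close>

lemma L2_inner_real_parts:
  assumes "a \<in> L2 M" "b \<in> L2 M" "c \<in> L2 M" "d \<in> L2 M"
  shows "L2_inner M (\<lambda>x. of_real (a x) + \<i> * of_real (b x)) (\<lambda>x. of_real (c x) + \<i> * of_real (d x))
    = of_real ((\<integral>x. a x * c x \<partial>M) + (\<integral>x. b x * d x \<partial>M))
      + \<i> * of_real ((\<integral>x. b x * c x \<partial>M) - (\<integral>x. a x * d x \<partial>M))"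
proof -
  have r: "L2_inner M (\<lambda>x. of_real (f x)) (\<lambda>x. of_real (g x)) = of_real (\<integral>x. f x * g x \<partial>M)" for f g
    by (simp add: L2_inner_def flip: of_real_mult)
  note L = assms[THEN L2_of_real]
    L2_cmult[OF L2_of_real[OF assms(2)], of \<i>] L2_cmult[OF L2_of_real[OF assms(4)], of \<i>]
  show ?thesis
    by (simp add: L2_inner_add_left L2_inner_add_right L2_add L L2_inner_cmult_left L2_inner_cmult_right r
        algebra_simps)
qed

theorem Q_isometry:
  assumes "f \<in> L2 lborel" "g \<in> L2 lborel"
  shows "L2_inner P (Q P f) (Q P g) = L2_inner lborel f g"
proof -
  note ri = L2_Re[OF assms(1)] L2_Im[OF assms(1)] L2_Re[OF assms(2)] L2_Im[OF assms(2)]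
  have "L2_inner P (Q P f) (Q P g)
    = L2_inner lborel (\<lambda>x. of_real (Re (f x)) + \<i> * of_real (Im (f x))) (\<lambda>x. of_real (Re (g x)) + \<i> * of_real (Im (g x)))"
    unfolding Q_def[abs_def]
    by (simp only: L2_inner_real_parts ri Q_real_L2 Q_real_isometry)
  then show ?thesis by (simp flip: complex_eq)
qed

end

section \<open>The covariance of the process\<close>

lemma I_fun_L2: "I_fun t \<in> L2 lborel"
  unfolding I_fun_def using L2_minus[OF interval_L2[of t 0]] by auto

lemma I_fun_integrable: "integrable lborel (I_fun t)"
  unfolding I_fun_def by auto

lemma I_fun_measurable [measurable]: "I_fun t \<in> borel_measurable lborel"
  by (rule L2_D(1)[OF I_fun_L2])

lemma borel_measurable_cnj [measurable]: "cnj \<in> borel_measurable borel"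
  by (intro borel_measurable_continuous_onI continuous_intros)

text \<open>Thanks to the sign of $I_t$ for $t < 0$, one formula covers all $t$.\<close>

lemma fourier_I_fun:
  assumes "u \<noteq> 0"
  shows "fourier (I_fun t) u = (1 - exp (- \<i> * of_real (u * t))) / (\<i> * of_real u)"
proof -
  consider "t > 0" | "t = 0" | "t < 0" by linarith
  then show ?thesis
  proof cases
    case 1
    then have "I_fun t = indicator {0..t}" by (simp add: I_fun_def)
    with 1 show ?thesis using fourier_interval[of 0 t u] assms by simp
  next
    case 2
    then show ?thesis by (simp add: I_fun_def fourier_def)
  next
    case 3
    then have "I_fun t = (\<lambda>x. (-1) * indicator {t..0} x)" by (simp add: I_fun_def)
    then have "fourier (I_fun t) u = - fourier (indicator {t..0}) u" by (simp only: fourier_cmult) simp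
    with 3 show ?thesis using fourier_interval[of t 0 u] assms
      by (simp add: minus_divide_left)
  qed
qed

text \<open>Both $|1 - e^{-iut}| \le |ut|$ and $|1 - e^{-iut}| \le 2$ are used, near $0$ and at
  infinity.\<close>

lemma fourier_I_fun_decay:
  assumes "u \<noteq> 0"
  shows "(cmod (fourier (I_fun t) u))\<^sup>2 \<le> (t\<^sup>2 + 4) / (u\<^sup>2 + 1)"
proof -
  let ?e = "cmod (1 - exp (- \<i> * of_real (u * t)))"
  have 1: "?e \<le> \<bar>u * t\<bar>"
    using iexp_approx1[of "- (u * t)" 0] by (simp add: norm_minus_commute)
  have 2: "?e \<le> 2"
    using norm_triangle_ineq4[of 1 "exp (- \<i> * of_real (u * t))"] by simp
  have "?e\<^sup>2 \<le> (u * t)\<^sup>2" using power_mono[OF 1, of 2] by simp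
  moreover have "?e\<^sup>2 \<le> 4" using power_mono[OF 2, of 2] by simp
  ultimately have "?e\<^sup>2 * (u\<^sup>2 + 1) \<le> 4 * u\<^sup>2 + (u * t)\<^sup>2"
    using mult_right_mono[of "?e\<^sup>2" 4 "u\<^sup>2"] by (simp add: distrib_left)
  also have "\<dots> = (t\<^sup>2 + 4) * u\<^sup>2" by (simp add: power_mult_distrib algebra_simps)
  finally have "?e\<^sup>2 / u\<^sup>2 \<le> (t\<^sup>2 + 4) / (u\<^sup>2 + 1)"
    using assms by (simp add: divide_le_eq le_divide_eq add_pos_nonneg pos_divide_le_eq pos_le_divide_eq)
  then show ?thesis
    using assms by (simp add: fourier_I_fun norm_divide norm_mult power_divide)
qed

lemma fourier_I_fun_product:
  assumes "u \<noteq> 0"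
  shows "fourier (I_fun t) u * cnj (fourier (I_fun s) u)
    = (1 - exp (- \<i> * of_real (u * t)) - exp (\<i> * of_real (u * s)) + exp (\<i> * of_real (u * (s - t)))) / of_real (u\<^sup>2)"
proof -
  have ii: "\<i> * z * (- \<i> * z) = z * z" for z by (simp add: complex_eq_iff)
  have c: "cnj (fourier (I_fun s) u) = (1 - exp (\<i> * of_real (u * s))) / (- \<i> * of_real u)"
    using assms by (simp add: fourier_I_fun exp_cnj)
  have e: "exp (- \<i> * of_real (u * t)) * exp (\<i> * of_real (u * s)) = exp (\<i> * of_real (u * (s - t)))"
    by (simp add: algebra_simps flip: exp_add)
  have "fourier (I_fun t) u * cnj (fourier (I_fun s) u)
    = (1 - exp (- \<i> * of_real (u * t))) * (1 - exp (\<i> * of_real (u * s))) / (\<i> * of_real u * (- \<i> * of_real u))"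
    unfolding c unfolding fourier_I_fun[OF assms] times_divide_times_eq ..
  also have "\<dots> = (1 - exp (- \<i> * of_real (u * t))) * (1 - exp (\<i> * of_real (u * s))) / of_real (u\<^sup>2)"
    unfolding ii by (simp add: power2_eq_square)
  also have "(1 - exp (- \<i> * of_real (u * t))) * (1 - exp (\<i> * of_real (u * s)))
    = 1 - exp (- \<i> * of_real (u * t)) - exp (\<i> * of_real (u * s)) + exp (- \<i> * of_real (u * t)) * exp (\<i> * of_real (u * s))"
    by (simp add: algebra_simps)
  finally show ?thesis unfolding e .
qed

text \<open>The integrand of $r$, without its sign.\<close>

definition r_kernel :: "real \<Rightarrow> real \<Rightarrow> complex" where
  "r_kernel t u = (exp (\<i> * of_real (t * u)) - 1 - \<i> * of_real (t * u / (u\<^sup>2 + 1))) / of_real (u\<^sup>2)"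

lemma r_kernel_measurable [measurable]: "r_kernel t \<in> borel_measurable borel"
  unfolding r_kernel_def[abs_def] by measurable

text \<open>Subtracting $itu/(u^2+1)$ rather than $itu$ leaves an error of the order of $u^2$ near $0$ and of a
  bounded function at infinity.\<close>

lemma r_kernel_bound: "cmod (r_kernel t u) \<le> (t\<^sup>2 + 4 * \<bar>t\<bar> + 4) / (u\<^sup>2 + 1)"
proof (cases "u = 0")
  case False
  let ?n = "exp (\<i> * of_real (t * u)) - 1 - \<i> * of_real (t * u / (u\<^sup>2 + 1))"
  have u2: "u\<^sup>2 > 0" "u\<^sup>2 + 1 > 0" using False by (auto simp: add_pos_nonneg)
  have r: "cmod (r_kernel t u) = cmod ?n / u\<^sup>2"
    by (simp add: r_kernel_def norm_divide norm_power)
  have ci: "cmod (\<i> * of_real x) = \<bar>x\<bar>" for x by (simp add: norm_mult)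
  have n1: "cmod ?n \<le> (t * u)\<^sup>2 / 2 + \<bar>t\<bar> * \<bar>u\<bar> * u\<^sup>2 / (u\<^sup>2 + 1)"
  proof -
    have "?n = (exp (\<i> * of_real (t * u)) - (1 + \<i> * of_real (t * u))) + \<i> * of_real (t * u * u\<^sup>2 / (u\<^sup>2 + 1))"
    proof -
      have "t * u - t * u / (u\<^sup>2 + 1) = t * u * u\<^sup>2 / (u\<^sup>2 + 1)"
        using u2 by (simp add: field_simps)
      then have d: "complex_of_real (t * u * u\<^sup>2 / (u\<^sup>2 + 1)) = of_real (t * u) - of_real (t * u / (u\<^sup>2 + 1))"
        by (metis of_real_diff)
      have alg: "e - 1 - \<i> * y = (e - (1 + \<i> * x)) + \<i> * (x - y)" for e x y :: complex
        by (simp add: algebra_simps)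
      show ?thesis unfolding d by (rule alg)
    qed
    also have "cmod \<dots> \<le> cmod (exp (\<i> * of_real (t * u)) - (1 + \<i> * of_real (t * u))) + \<bar>t * u * u\<^sup>2 / (u\<^sup>2 + 1)\<bar>"
      by (rule order_trans[OF norm_triangle_ineq]) (simp only: ci order_refl)
    also have "cmod (exp (\<i> * of_real (t * u)) - (1 + \<i> * of_real (t * u))) \<le> (t * u)\<^sup>2 / 2"
      using iexp_approx1[of "t * u" 1] by (simp add: numeral_2_eq_2)
    finally show ?thesis using u2 by (simp add: abs_mult)
  qed
  have n2: "cmod ?n \<le> 2 + \<bar>t\<bar> * \<bar>u\<bar> / (u\<^sup>2 + 1)"
  proof -
    have "cmod ?n \<le> cmod (exp (\<i> * of_real (t * u)) - 1) + cmod (\<i> * of_real (t * u / (u\<^sup>2 + 1)))"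
      by (rule norm_triangle_ineq4)
    also have "cmod (exp (\<i> * of_real (t * u)) - 1) \<le> 2"
      using norm_triangle_ineq4[of "exp (\<i> * of_real (t * u))" 1] by simp
    finally have "cmod ?n \<le> 2 + \<bar>t * u / (u\<^sup>2 + 1)\<bar>" by (simp only: ci)
    also have "\<bar>t * u / (u\<^sup>2 + 1)\<bar> = \<bar>t\<bar> * \<bar>u\<bar> / (u\<^sup>2 + 1)" using u2 by (simp add: abs_mult)
    finally show ?thesis .
  qed
  show ?thesis
  proof (cases "\<bar>u\<bar> \<le> 1")
    case True
    then have u1: "u\<^sup>2 \<le> 1" by (simp add: abs_square_le_1)
    have "\<bar>t\<bar> * \<bar>u\<bar> * u\<^sup>2 / (u\<^sup>2 + 1) \<le> \<bar>t\<bar> * 1 * u\<^sup>2 / 1"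
      using True by (intro frac_le mult_right_mono mult_left_mono) auto
    with n1 have "cmod ?n \<le> (t\<^sup>2 / 2 + \<bar>t\<bar>) * u\<^sup>2"
      by (simp add: power_mult_distrib algebra_simps)
    then have "cmod (r_kernel t u) \<le> t\<^sup>2 / 2 + \<bar>t\<bar>" unfolding r using u2 by (simp add: divide_le_eq)
    also have "\<dots> \<le> (t\<^sup>2 + 4 * \<bar>t\<bar> + 4) / (u\<^sup>2 + 1)"
    proof -
      have "(t\<^sup>2 / 2 + \<bar>t\<bar>) * (u\<^sup>2 + 1) \<le> (t\<^sup>2 / 2 + \<bar>t\<bar>) * 2" using u1 by (intro mult_left_mono) auto
      then show ?thesis using u2 by (simp add: le_divide_eq)
    qed
    finally show ?thesis .
  next
    case False
    then have u1: "u\<^sup>2 \<ge> 1" using abs_square_le_1[of u] by (meson linear)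
    have "\<bar>u\<bar> \<le> u\<^sup>2 + 1" using sum_squares_bound[of "\<bar>u\<bar>" 1] by simp
    then have "\<bar>t\<bar> * \<bar>u\<bar> / (u\<^sup>2 + 1) \<le> \<bar>t\<bar>"
      using u2 by (simp add: divide_le_eq mult_left_mono)
    with n2 have "cmod ?n \<le> 2 + \<bar>t\<bar>" by simp
    then have "cmod (r_kernel t u) \<le> (2 + \<bar>t\<bar>) / u\<^sup>2" unfolding r using u2 by (simp add: divide_right_mono)
    also have "\<dots> \<le> (t\<^sup>2 + 4 * \<bar>t\<bar> + 4) / (u\<^sup>2 + 1)"
    proof -
      have "(2 + \<bar>t\<bar>) * (u\<^sup>2 + 1) \<le> (2 + \<bar>t\<bar>) * (2 * u\<^sup>2)" using u1 by (intro mult_left_mono) auto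
      also have "\<dots> \<le> (t\<^sup>2 + 4 * \<bar>t\<bar> + 4) * u\<^sup>2"
        using mult_right_mono[of "2 * (2 + \<bar>t\<bar>)" "t\<^sup>2 + 4 * \<bar>t\<bar> + 4" "u\<^sup>2"] by (simp add: algebra_simps)
      finally show ?thesis using u2 by (simp add: divide_le_eq le_divide_eq pos_divide_le_eq pos_le_divide_eq mult.commute)
    qed
    finally show ?thesis .
  qed
qed (simp add: r_kernel_def add_nonneg_nonneg)

text \<open>Conjugation flips the sign of the compensating term $itu/(u^2+1)$, so the three
  compensating terms cancel.\<close>

lemma r_kernel_combination:
  assumes "u \<noteq> 0"
  shows "r_kernel (s - t) u - r_kernel s u - cnj (r_kernel t u)
    = fourier (I_fun t) u * cnj (fourier (I_fun s) u)"
proof -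
  let ?l = "\<lambda>x. \<i> * complex_of_real (x * u / (u\<^sup>2 + 1))"
  have c: "cnj (r_kernel t u) = (exp (- \<i> * of_real (t * u)) - 1 + ?l t) / of_real (u\<^sup>2)"
    by (simp add: r_kernel_def exp_cnj)
  have l: "?l (s - t) = ?l s - ?l t"
    by (simp add: left_diff_distrib right_diff_distrib diff_divide_distrib)
  show ?thesis
    unfolding fourier_I_fun_product[OF assms] c
    unfolding r_kernel_def l diff_divide_distrib[symmetric]
    by (rule arg_cong[where f="\<lambda>z. z / complex_of_real (u\<^sup>2)"]) (simp add: algebra_simps)
qed

lemma Re_r_kernel: "Re (r_kernel t u) = - ((1 - cos (t * u)) / u\<^sup>2)"
proof -
  have "Re (r_kernel t u) = (cos (t * u) - 1) / u\<^sup>2"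
    unfolding r_kernel_def Re_divide_of_real by (simp add: Re_exp)
  then show ?thesis by (simp add: minus_divide_left)
qed

definition tail_integral :: "(real \<Rightarrow> real) \<Rightarrow> real \<Rightarrow> real" where
  "tail_integral m R = (\<integral>u. indicator {u. R < \<bar>u\<bar>} u * (m u / u\<^sup>2) \<partial>lborel)"

definition dyadic_integral :: "(real \<Rightarrow> real) \<Rightarrow> nat \<Rightarrow> real" where
  "dyadic_integral m n = (\<integral>u. indicator {u. 1 < \<bar>u\<bar> \<and> \<bar>u\<bar> \<le> 2 ^ n} u * m u \<partial>lborel)"

context
  fixes m :: "real \<Rightarrow> real"
  assumes m_meas: "m \<in> borel_measurable borel" and m_nonneg: "\<And>u. 0 \<le> m u"
    and m_int: "integrable lborel (\<lambda>u. m u / (u\<^sup>2 + 1))"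
begin

lemma m_measurable [measurable]: "m \<in> borel_measurable borel"
  by (rule m_meas)

lemma m_integrable_bound:
  fixes f :: "real \<Rightarrow> 'b::{banach, second_countable_topology}"
  assumes [measurable]: "f \<in> borel_measurable borel"
    and le: "AE u in lborel. norm (f u) \<le> C / (u\<^sup>2 + 1)"
  shows "integrable lborel (\<lambda>u. m u *\<^sub>R f u)"
proof (rule Bochner_Integration.integrable_bound)
  show "integrable lborel (\<lambda>u. C * (m u / (u\<^sup>2 + 1)))" by (intro integrable_mult_right m_int)
  show "AE u in lborel. norm (m u *\<^sub>R f u) \<le> norm (C * (m u / (u\<^sup>2 + 1)))"
    using le
  proof eventually_elim
    case (elim u)
    have "norm (m u *\<^sub>R f u) \<le> m u * (C / (u\<^sup>2 + 1))"
      using mult_left_mono[OF elim m_nonneg[of u]] m_nonneg[of u] by simp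
    also have "\<dots> = C * (m u / (u\<^sup>2 + 1))" by simp
    also have "\<dots> \<le> norm (C * (m u / (u\<^sup>2 + 1)))" by (simp only: real_norm_def abs_ge_self)
    finally show ?case .
  qed
qed measurable

lemma I_fun_T_dom: "I_fun t \<in> T_dom m"
proof -
  have [measurable]: "fourier_L2 (I_fun t) \<in> borel_measurable borel"
    using L2_D(1)[OF fourier_L2_in_L2[OF I_fun_L2]] by simp
  have "AE u in lborel. norm ((cmod (fourier_L2 (I_fun t) u))\<^sup>2) \<le> (t\<^sup>2 + 4) / (u\<^sup>2 + 1)"
    using fourier_L2_eq_fourier[OF I_fun_L2 I_fun_integrable, of t] AE_lborel_singleton[of 0]
    by eventually_elim (simp add: fourier_I_fun_decay)
  then have "integrable lborel (\<lambda>u. m u *\<^sub>R (cmod (fourier_L2 (I_fun t) u))\<^sup>2)"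
    by (intro m_integrable_bound) measurable
  then show ?thesis by (simp add: T_dom_def I_fun_L2)
qed

text \<open>The decay of $\widehat{I_t}$ puts $I_t$ into the domain of $T_m$, and surjectivity of
  the transform provides a witness for the choice in \<open>T_op\<close>.\<close>

lemma T_op_I_fun:
  shows "T_op m (I_fun t) \<in> L2 lborel"
    and "AE u in lborel. fourier_L2 (T_op m (I_fun t)) u = of_real (sqrt (m u)) * fourier (I_fun t) u"
proof -
  let ?F = "\<lambda>u. of_real (sqrt (m u)) * fourier_L2 (I_fun t) u"
  have [measurable]: "fourier_L2 (I_fun t) \<in> borel_measurable borel"
    using L2_D(1)[OF fourier_L2_in_L2[OF I_fun_L2]] by simp
  have F: "?F \<in> L2 lborel"
  proof (rule L2_I)
    show "integrable lborel (\<lambda>u. (norm (?F u))\<^sup>2)"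
      using I_fun_T_dom[of t] by (simp add: T_dom_def norm_mult power_mult_distrib m_nonneg)
  qed measurable
  have ex: "\<exists>g. g \<in> L2 lborel \<and> (AE u in lborel. fourier_L2 g u = ?F u)"
    using fourier_L2_surj[OF F] by blast
  have *: "T_op m (I_fun t) \<in> L2 lborel \<and> (AE u in lborel. fourier_L2 (T_op m (I_fun t)) u = ?F u)"
    unfolding T_op_def if_P[OF I_fun_T_dom] by (rule someI_ex[OF ex])
  then show "T_op m (I_fun t) \<in> L2 lborel" ..
  from * have "AE u in lborel. fourier_L2 (T_op m (I_fun t)) u = ?F u" ..
  then show "AE u in lborel. fourier_L2 (T_op m (I_fun t)) u = of_real (sqrt (m u)) * fourier (I_fun t) u"
    using fourier_L2_eq_fourier[OF I_fun_L2 I_fun_integrable, of t] by eventually_elim simp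
qed

lemma T_op_inner:
  "of_real (2 * pi) * L2_inner lborel (T_op m (I_fun t)) (T_op m (I_fun s))
    = (\<integral>u. m u *\<^sub>R (fourier (I_fun t) u * cnj (fourier (I_fun s) u)) \<partial>lborel)"
proof -
  let ?T = "\<lambda>t. T_op m (I_fun t)"
  have "of_real (2 * pi) * L2_inner lborel (?T t) (?T s) = L2_inner lborel (fourier_L2 (?T t)) (fourier_L2 (?T s))"
    by (rule Parseval[symmetric]) (rule T_op_I_fun)+
  also have "\<dots> = (\<integral>u. m u *\<^sub>R (fourier (I_fun t) u * cnj (fourier (I_fun s) u)) \<partial>lborel)"
    unfolding L2_inner_def
  proof (rule integral_cong_AE)
    show "(\<lambda>u. fourier_L2 (?T t) u * cnj (fourier_L2 (?T s) u)) \<in> borel_measurable lborel"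
      by (intro borel_measurable_integrable L2_inner_integrable fourier_L2_in_L2 T_op_I_fun(1))
    show "(\<lambda>u. m u *\<^sub>R (fourier (I_fun t) u * cnj (fourier (I_fun s) u))) \<in> borel_measurable lborel"
      by measurable
    show "AE u in lborel. fourier_L2 (?T t) u * cnj (fourier_L2 (?T s) u)
        = m u *\<^sub>R (fourier (I_fun t) u * cnj (fourier (I_fun s) u))"
      using T_op_I_fun(2)[of t] T_op_I_fun(2)[of s]
    proof eventually_elim
      case (elim u)
      have "complex_of_real (sqrt (m u)) * of_real (sqrt (m u)) = of_real (m u)"
        using m_nonneg[of u] by (simp flip: of_real_mult)
      then show ?case using elim by (simp add: scaleR_conv_of_real algebra_simps)
    qed
  qed
  finally show ?thesis .
qed

lemma r_kernel_integrable: "integrable lborel (\<lambda>u. m u *\<^sub>R r_kernel t u)"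
  by (rule m_integrable_bound[OF r_kernel_measurable AE_I2]) (rule r_kernel_bound)

lemma r_fun_eq:
  "r_fun m \<gamma> t = \<i> * of_real (\<gamma> * t) - of_real (1 / (2 * pi)) * (\<integral>u. m u *\<^sub>R r_kernel t u \<partial>lborel)"
proof -
  have "(\<integral>u. r_kernel t u \<partial>sigma_m m) = (\<integral>u. (m u / (2 * pi)) *\<^sub>R r_kernel t u \<partial>lborel)"
    unfolding sigma_m_def by (rule integral_density) (auto simp: m_nonneg)
  also have "\<dots> = (\<integral>u. of_real (1 / (2 * pi)) * (m u *\<^sub>R r_kernel t u) \<partial>lborel)"
    by (intro Bochner_Integration.integral_cong) (simp_all add: scaleR_conv_of_real)
  also have "\<dots> = of_real (1 / (2 * pi)) * (\<integral>u. m u *\<^sub>R r_kernel t u \<partial>lborel)"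
    by (rule integral_mult_right_zero)
  finally show ?thesis by (simp add: r_fun_def r_kernel_def)
qed

lemma r_fun_0: "r_fun m \<gamma> 0 = 0"
  by (simp add: r_fun_eq r_kernel_def)

text \<open>The linear terms $i\gamma s$, $-i\gamma t$ and $-i\gamma(s - t)$ of $K_r(s,t)$ cancel;
  what remains are the three integrals that \<open>r_kernel_combination\<close> combines.\<close>

lemma T_op_inner_eq_K:
  "L2_inner lborel (T_op m (I_fun t)) (T_op m (I_fun s)) = K_fun (r_fun m \<gamma>) s t"
proof -
  let ?R = "\<lambda>t. (\<integral>u. m u *\<^sub>R r_kernel t u \<partial>lborel)"
  let ?c = "complex_of_real (1 / (2 * pi))"
  have i: "integrable lborel (\<lambda>u. m u *\<^sub>R cnj (r_kernel t u))"
    using integrable_cnj[OF r_kernel_integrable[of t]] by simp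
  have "of_real (2 * pi) * L2_inner lborel (T_op m (I_fun t)) (T_op m (I_fun s))
     = (\<integral>u. m u *\<^sub>R (fourier (I_fun t) u * cnj (fourier (I_fun s) u)) \<partial>lborel)"
    by (rule T_op_inner)
  also have "\<dots> = (\<integral>u. m u *\<^sub>R r_kernel (s - t) u - m u *\<^sub>R r_kernel s u - m u *\<^sub>R cnj (r_kernel t u) \<partial>lborel)"
  proof (rule integral_cong_AE)
    show "AE u in lborel. m u *\<^sub>R (fourier (I_fun t) u * cnj (fourier (I_fun s) u))
       = m u *\<^sub>R r_kernel (s - t) u - m u *\<^sub>R r_kernel s u - m u *\<^sub>R cnj (r_kernel t u)"
      using AE_lborel_singleton[of 0]
      by eventually_elim (simp add: r_kernel_combination[symmetric] scaleR_diff_right)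
  qed measurable
  also have "\<dots> = ?R (s - t) - ?R s - cnj (?R t)"
    using r_kernel_integrable i
    by (simp flip: Bochner_Integration.integral_cnj)
  finally have "?c * (of_real (2 * pi) * L2_inner lborel (T_op m (I_fun t)) (T_op m (I_fun s)))
      = ?c * (?R (s - t) - ?R s - cnj (?R t))" by simp
  then have "L2_inner lborel (T_op m (I_fun t)) (T_op m (I_fun s)) = ?c * (?R (s - t) - ?R s - cnj (?R t))"
    by (simp add: mult.assoc[symmetric] flip: of_real_mult)
  also have "\<dots> = K_fun (r_fun m \<gamma>) s t"
    unfolding K_fun_def r_fun_0 unfolding r_fun_eq by (simp add: algebra_simps)
  finally show ?thesis .
qed

section \<open>Growth of the real part of $r$\<close>

lemma one_minus_cos_integrable:
  "integrable lborel (\<lambda>u. m u * ((1 - cos (t * u)) / u\<^sup>2))"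
  using integrable_Re[OF r_kernel_integrable[of t]] by (simp add: Re_r_kernel)

lemma Re_r_fun:
  "Re (r_fun m \<gamma> t) = 1 / (2 * pi) * (\<integral>u. m u * ((1 - cos (t * u)) / u\<^sup>2) \<partial>lborel)"
proof -
  have "Re (\<integral>u. m u *\<^sub>R r_kernel t u \<partial>lborel) = (\<integral>u. Re (m u *\<^sub>R r_kernel t u) \<partial>lborel)"
    by (rule integral_Re[OF r_kernel_integrable, symmetric])
  also have "\<dots> = - (\<integral>u. m u * ((1 - cos (t * u)) / u\<^sup>2) \<partial>lborel)"
    by (simp add: Re_r_kernel)
  finally show ?thesis by (simp add: r_fun_eq)
qed

lemma one_minus_cos_le:
  "(1 - cos (t * u)) / u\<^sup>2 \<le> t\<^sup>2 / 2" "(1 - cos (t * u)) / u\<^sup>2 \<le> 2 / u\<^sup>2"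
  "0 \<le> (1 - cos (t * u)) / u\<^sup>2" for t u :: real
proof -
  have "\<bar>Re (exp (\<i> * complex_of_real (t * u)) - (\<Sum>k\<le>1. (\<i> * complex_of_real (t * u)) ^ k / fact k))\<bar>
      \<le> \<bar>t * u\<bar> ^ Suc 1 / fact (Suc 1)"
    by (rule order_trans[OF abs_Re_le_cmod iexp_approx1])
  then have "1 - (t * u)\<^sup>2 / 2 \<le> cos (t * u)"
    by (simp add: Re_exp numeral_2_eq_2 abs_mult)
  then have "1 - cos (t * u) \<le> (t\<^sup>2 / 2) * u\<^sup>2" by (simp add: power_mult_distrib)
  then show "(1 - cos (t * u)) / u\<^sup>2 \<le> t\<^sup>2 / 2" by (cases "u = 0") (auto simp: divide_le_eq)
  show "(1 - cos (t * u)) / u\<^sup>2 \<le> 2 / u\<^sup>2"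
    using cos_ge_minus_one[of "t * u"] by (intro divide_right_mono) auto
  show "0 \<le> (1 - cos (t * u)) / u\<^sup>2" by simp
qed

text \<open>The integrand times $u^2 + 1$ is at most $t^2 + 4$: the factor $u^2$ is paired with the
  bound $2/u^2$ and the factor $1$ with the bound $t^2/2$.\<close>

lemma Re_r_fun_bound:
  "Re (r_fun m \<gamma> t) \<le> 1 / (2 * pi) * ((t\<^sup>2 + 4) * (\<integral>u. m u / (u\<^sup>2 + 1) \<partial>lborel))"
proof -
  have "(\<integral>u. m u * ((1 - cos (t * u)) / u\<^sup>2) \<partial>lborel) \<le> (\<integral>u. (t\<^sup>2 + 4) * (m u / (u\<^sup>2 + 1)) \<partial>lborel)"
  proof (rule integral_mono[OF one_minus_cos_integrable])
    show "integrable lborel (\<lambda>u. (t\<^sup>2 + 4) * (m u / (u\<^sup>2 + 1)))" by (intro integrable_mult_right m_int)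
    fix u :: real
    have p: "u\<^sup>2 + 1 > 0" by (simp add: add_nonneg_pos)
    have "(1 - cos (t * u)) / u\<^sup>2 * (u\<^sup>2 + 1) \<le> t\<^sup>2 + 4"
    proof -
      have "(1 - cos (t * u)) / u\<^sup>2 * u\<^sup>2 \<le> 2"
        using one_minus_cos_le(2)[of t u] cos_ge_minus_one[of "t * u"] by (cases "u = 0") auto
      then show ?thesis
        unfolding distrib_left using one_minus_cos_le(1)[of t u] zero_le_power2[of t] by linarith
    qed
    then have "(1 - cos (t * u)) / u\<^sup>2 \<le> (t\<^sup>2 + 4) / (u\<^sup>2 + 1)" using p by (simp add: le_divide_eq)
    from mult_left_mono[OF this m_nonneg[of u]]
    show "m u * ((1 - cos (t * u)) / u\<^sup>2) \<le> (t\<^sup>2 + 4) * (m u / (u\<^sup>2 + 1))" by (simp add: mult.commute)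
  qed
  also have "\<dots> = (t\<^sup>2 + 4) * (\<integral>u. m u / (u\<^sup>2 + 1) \<partial>lborel)"
    by (rule integral_mult_right_zero)
  finally show ?thesis unfolding Re_r_fun by (intro mult_left_mono) auto
qed

lemma tail_integral_integrable:
  assumes "R \<ge> 1"
  shows "integrable lborel (\<lambda>u. indicator {u. R < \<bar>u\<bar>} u * (m u / u\<^sup>2))"
proof -
  have "integrable lborel (\<lambda>u. m u *\<^sub>R (indicator {u. R < \<bar>u\<bar>} u * (1 / u\<^sup>2)))"
  proof (rule m_integrable_bound[OF _ AE_I2])
    fix u :: real
    show "norm (indicator {u. R < \<bar>u\<bar>} u * (1 / u\<^sup>2) :: real) \<le> 2 / (u\<^sup>2 + 1)"
    proof (cases "R < \<bar>u\<bar>")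
      case True
      then have "1 \<le> u\<^sup>2" using assms abs_square_less_1[of u] by (simp add: not_less[symmetric])
      then show ?thesis using True by (simp add: divide_le_eq le_divide_eq field_simps)
    qed (simp add: add_nonneg_nonneg)
  qed measurable
  then show ?thesis by (simp add: mult_ac)
qed

lemma tail_integral_nonneg: "0 \<le> tail_integral m R"
  unfolding tail_integral_def using m_nonneg by (intro Bochner_Integration.integral_nonneg) simp

lemma dyadic_integral_integrable:
  "integrable lborel (\<lambda>u. indicator {u. 1 < \<bar>u\<bar> \<and> \<bar>u\<bar> \<le> 2 ^ n} u * m u)"
proof -
  have "integrable lborel (\<lambda>u. m u *\<^sub>R (indicator {u. 1 < \<bar>u\<bar> \<and> \<bar>u\<bar> \<le> 2 ^ n} u :: real))"
  proof (rule m_integrable_bound[OF _ AE_I2])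
    fix u :: real
    have p: "u\<^sup>2 + 1 > 0" by (simp add: add_nonneg_pos)
    show "norm (indicator {u. 1 < \<bar>u\<bar> \<and> \<bar>u\<bar> \<le> 2 ^ n} u :: real) \<le> ((2 ^ n)\<^sup>2 + 1) / (u\<^sup>2 + 1)"
    proof (cases "\<bar>u\<bar> \<le> 2 ^ n")
      case True
      then have "u\<^sup>2 \<le> (2 ^ n)\<^sup>2" using power_mono[of "\<bar>u\<bar>" "2 ^ n" 2] by simp
      then have "1 \<le> ((2 ^ n)\<^sup>2 + 1) / (u\<^sup>2 + 1)" using p by (simp add: le_divide_eq)
      then show ?thesis using True by (simp add: indicator_def)
    qed (use p in simp)
  qed measurable
  then show ?thesis by (simp add: mult.commute)
qed

text \<open>On the ring $2^n < |u| \le 2^{n+1}$ the function $m$ is at most $4^{n+1}\, m/u^2$, so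
  the ring contributes at most $4^{n+1} A/2^n$; the sum of these bounds is geometric.\<close>

lemma dyadic_integral_bound:
  assumes A: "\<And>R. R \<ge> 1 \<Longrightarrow> R * tail_integral m R \<le> A"
  shows "dyadic_integral m n \<le> 4 * A * 2 ^ n"
proof (induction n)
  case 0
  have "A \<ge> 0" using A[of 1] tail_integral_nonneg[of 1] by simp
  have "{u::real. 1 < \<bar>u\<bar> \<and> \<bar>u\<bar> \<le> 2 ^ 0} = {}" by auto
  then have "dyadic_integral m 0 = 0" unfolding dyadic_integral_def by simp
  with \<open>A \<ge> 0\<close> show ?case by simp
next
  case (Suc n)
  have R: "(2::real) ^ n \<ge> 1" by simp
  have "dyadic_integral m (Suc n) \<le> (\<integral>u. indicator {u. 1 < \<bar>u\<bar> \<and> \<bar>u\<bar> \<le> 2 ^ n} u * m u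
      + (2 ^ Suc n)\<^sup>2 * (indicator {u. 2 ^ n < \<bar>u\<bar>} u * (m u / u\<^sup>2)) \<partial>lborel)"
    unfolding dyadic_integral_def
  proof (rule integral_mono[OF dyadic_integral_integrable])
    show "integrable lborel (\<lambda>u. indicator {u. 1 < \<bar>u\<bar> \<and> \<bar>u\<bar> \<le> 2 ^ n} u * m u
      + (2 ^ Suc n)\<^sup>2 * (indicator {u. 2 ^ n < \<bar>u\<bar>} u * (m u / u\<^sup>2)))"
      by (intro Bochner_Integration.integrable_add integrable_mult_right dyadic_integral_integrable tail_integral_integrable R)
    fix u :: real
    show "indicator {u. 1 < \<bar>u\<bar> \<and> \<bar>u\<bar> \<le> 2 ^ Suc n} u * m u
      \<le> indicator {u. 1 < \<bar>u\<bar> \<and> \<bar>u\<bar> \<le> 2 ^ n} u * m u + (2 ^ Suc n)\<^sup>2 * (indicator {u. 2 ^ n < \<bar>u\<bar>} u * (m u / u\<^sup>2))"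
    proof (cases "2 ^ n < \<bar>u\<bar> \<and> \<bar>u\<bar> \<le> 2 ^ Suc n")
      case True
      then have "u\<^sup>2 \<le> (2 ^ Suc n)\<^sup>2" using power_mono[of "\<bar>u\<bar>" "2 ^ Suc n" 2] by simp
      moreover have "u\<^sup>2 > 0" using True R by auto
      ultimately have "1 \<le> (2 ^ Suc n)\<^sup>2 / u\<^sup>2" by (simp only: le_divide_eq_1_pos)
      from mult_left_mono[OF this m_nonneg[of u]]
      have "m u \<le> (2 ^ Suc n)\<^sup>2 * (m u / u\<^sup>2)" by (simp only: mult_1_left mult_1_right times_divide_eq_right mult.commute[of "m u"])
      moreover have "1 < \<bar>u\<bar>" using True R by linarith
      ultimately show ?thesis using True by (simp add: indicator_def)
    qed (use m_nonneg[of u] in \<open>auto simp: indicator_def\<close>)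
  qed
  also have "\<dots> = dyadic_integral m n + (2 ^ Suc n)\<^sup>2 * tail_integral m (2 ^ n)"
  proof -
    have i: "integrable lborel (\<lambda>u. (2 ^ Suc n)\<^sup>2 * (indicator {u. 2 ^ n < \<bar>u\<bar>} u * (m u / u\<^sup>2)))"
      by (intro integrable_mult_right tail_integral_integrable R)
    show ?thesis
      unfolding dyadic_integral_def tail_integral_def
      by (simp only: Bochner_Integration.integral_add[OF dyadic_integral_integrable i] integral_mult_right_zero)
  qed
  also have "(2 ^ Suc n)\<^sup>2 * tail_integral m (2 ^ n) = 4 * 2 ^ n * (2 ^ n * tail_integral m (2 ^ n))"
    by (simp add: power2_eq_square)
  also have "\<dots> \<le> 4 * 2 ^ n * A" by (intro mult_left_mono A R) simp
  finally show ?case using Suc by (simp add: algebra_simps)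
qed

text \<open>Take $2^n \le 1/|t| < 2^{n+1}$. The integrand is at most $t^2/(u^2+1)$ for $|u| \le 1$,
  at most $t^2/2$ up to $|u| = 2^n$, and at most $2/u^2$ beyond; the last two ranges contribute
  $2A|t|$ and $4A|t|$.\<close>

lemma Re_r_fun_linear_bound:
  assumes A: "\<And>R. R \<ge> 1 \<Longrightarrow> R * tail_integral m R \<le> A" and t: "\<bar>t\<bar> < 1"
  shows "Re (r_fun m \<gamma> t) \<le> 1 / (2 * pi) * (t\<^sup>2 * (\<integral>u. m u / (u\<^sup>2 + 1) \<partial>lborel) + 6 * A * \<bar>t\<bar>)"
proof (cases "t = 0")
  case True
  then show ?thesis by (simp add: r_fun_0)
next
  case False
  let ?J = "\<integral>u. m u / (u\<^sup>2 + 1) \<partial>lborel"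
  have A0: "A \<ge> 0" using A[of 1] tail_integral_nonneg[of 1] by simp
  obtain N where N: "1 / \<bar>t\<bar> < 2 ^ N" using real_arch_pow[of 2 "1 / \<bar>t\<bar>"] by auto
  define k where "k = (LEAST k. 1 / \<bar>t\<bar> < 2 ^ k)"
  have k: "1 / \<bar>t\<bar> < 2 ^ k" unfolding k_def by (rule LeastI[of _ N]) (rule N)
  have "k \<noteq> 0" using k t False by (intro notI) (simp add: divide_less_eq)
  then obtain n where n: "k = Suc n" by (auto simp: gr0_conv_Suc)
  have "\<not> 1 / \<bar>t\<bar> < 2 ^ n" using not_less_Least[of n "\<lambda>k. 1 / \<bar>t\<bar> < 2 ^ k"] n k_def by simp
  then have n1: "2 ^ n * \<bar>t\<bar> \<le> 1" using False by (simp add: le_divide_eq not_less)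
  have n2: "1 \<le> 2 * \<bar>t\<bar> * 2 ^ n" using k False by (simp add: n divide_less_eq mult_ac)
  have R: "(2::real) ^ n \<ge> 1" by simp
  have "(\<integral>u. m u * ((1 - cos (t * u)) / u\<^sup>2) \<partial>lborel)
    \<le> (\<integral>u. t\<^sup>2 * (m u / (u\<^sup>2 + 1)) + t\<^sup>2 / 2 * (indicator {u. 1 < \<bar>u\<bar> \<and> \<bar>u\<bar> \<le> 2 ^ n} u * m u)
        + 2 * (indicator {u. 2 ^ n < \<bar>u\<bar>} u * (m u / u\<^sup>2)) \<partial>lborel)"
  proof (rule integral_mono[OF one_minus_cos_integrable])
    show "integrable lborel (\<lambda>u. t\<^sup>2 * (m u / (u\<^sup>2 + 1)) + t\<^sup>2 / 2 * (indicator {u. 1 < \<bar>u\<bar> \<and> \<bar>u\<bar> \<le> 2 ^ n} u * m u)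
        + 2 * (indicator {u. 2 ^ n < \<bar>u\<bar>} u * (m u / u\<^sup>2)))"
      by (intro Bochner_Integration.integrable_add integrable_mult_right dyadic_integral_integrable tail_integral_integrable R m_int)
    fix u :: real
    have p: "u\<^sup>2 + 1 > 0" by (simp add: add_nonneg_pos)
    have nn: "0 \<le> t\<^sup>2 * (m u / (u\<^sup>2 + 1))" using m_nonneg[of u] p by simp
    consider "\<bar>u\<bar> \<le> 1" | "1 < \<bar>u\<bar>" "\<bar>u\<bar> \<le> 2 ^ n" | "2 ^ n < \<bar>u\<bar>" by linarith
    then show "m u * ((1 - cos (t * u)) / u\<^sup>2) \<le> t\<^sup>2 * (m u / (u\<^sup>2 + 1))
        + t\<^sup>2 / 2 * (indicator {u. 1 < \<bar>u\<bar> \<and> \<bar>u\<bar> \<le> 2 ^ n} u * m u) + 2 * (indicator {u. 2 ^ n < \<bar>u\<bar>} u * (m u / u\<^sup>2))"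
    proof cases
      case 1
      then have no_tail: "\<not> 2 ^ n < \<bar>u\<bar>" using R by linarith
      from 1 have u1: "u\<^sup>2 \<le> 1" by (simp add: abs_square_le_1)
      have "t\<^sup>2 / 2 \<le> t\<^sup>2 / (u\<^sup>2 + 1)" using u1 p by (intro divide_left_mono) auto
      with one_minus_cos_le(1)[of t u] have "(1 - cos (t * u)) / u\<^sup>2 \<le> t\<^sup>2 / (u\<^sup>2 + 1)" by linarith
      from mult_left_mono[OF this m_nonneg[of u]] show ?thesis
        using 1 no_tail by (simp add: indicator_def mult.commute)
    next
      case 2
      from mult_left_mono[OF one_minus_cos_le(1)[of t u] m_nonneg[of u]] show ?thesis
        using 2 nn by (simp add: indicator_def mult.commute)
    next
      case 3
      from mult_left_mono[OF one_minus_cos_le(2)[of t u] m_nonneg[of u]] show ?thesis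
        using 3 nn R by (simp add: indicator_def mult.commute)
    qed
  qed
  also have "\<dots> = t\<^sup>2 * ?J + t\<^sup>2 / 2 * dyadic_integral m n + 2 * tail_integral m (2 ^ n)"
  proof -
    have i1: "integrable lborel (\<lambda>u. t\<^sup>2 * (m u / (u\<^sup>2 + 1)))"
      and i2: "integrable lborel (\<lambda>u. t\<^sup>2 / 2 * (indicator {u. 1 < \<bar>u\<bar> \<and> \<bar>u\<bar> \<le> 2 ^ n} u * m u))"
      and i3: "integrable lborel (\<lambda>u. 2 * (indicator {u. 2 ^ n < \<bar>u\<bar>} u * (m u / u\<^sup>2)))"
      by (intro integrable_mult_right dyadic_integral_integrable tail_integral_integrable R m_int)+
    show ?thesis
      unfolding dyadic_integral_def tail_integral_def
      by (simp only: Bochner_Integration.integral_add[OF Bochner_Integration.integrable_add[OF i1 i2] i3]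
          Bochner_Integration.integral_add[OF i1 i2] integral_mult_right_zero)
  qed
  also have "\<dots> \<le> t\<^sup>2 * ?J + 2 * A * \<bar>t\<bar> + 4 * A * \<bar>t\<bar>"
  proof (intro add_mono order_refl)
    have "t\<^sup>2 / 2 * dyadic_integral m n \<le> t\<^sup>2 / 2 * (4 * A * 2 ^ n)"
      by (intro mult_left_mono dyadic_integral_bound A) auto
    also have "\<dots> = 2 * A * \<bar>t\<bar> * (2 ^ n * \<bar>t\<bar>)" by (simp add: power2_eq_square)
    also have "\<dots> \<le> 2 * A * \<bar>t\<bar> * 1" using A0 by (intro mult_left_mono n1) auto
    finally show "t\<^sup>2 / 2 * dyadic_integral m n \<le> 2 * A * \<bar>t\<bar>" by simp
    have "2 * tail_integral m (2 ^ n) * 1 \<le> 2 * tail_integral m (2 ^ n) * (2 * \<bar>t\<bar> * 2 ^ n)"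
      using tail_integral_nonneg[of "2 ^ n"] by (intro mult_left_mono n2) auto
    also have "\<dots> = 4 * \<bar>t\<bar> * (2 ^ n * tail_integral m (2 ^ n))" by simp
    also have "\<dots> \<le> 4 * \<bar>t\<bar> * A" by (intro mult_left_mono A R) auto
    finally show "2 * tail_integral m (2 ^ n) \<le> 4 * A * \<bar>t\<bar>" by (simp add: mult_ac)
  qed
  finally have "(\<integral>u. m u * ((1 - cos (t * u)) / u\<^sup>2) \<partial>lborel) \<le> t\<^sup>2 * ?J + 6 * A * \<bar>t\<bar>" by simp
  then show ?thesis unfolding Re_r_fun by (intro mult_left_mono) auto
qed

end

section \<open>The $m$-Brownian motion\<close>

theorem lemma6p2:
  fixes m :: "real \<Rightarrow> real" and \<gamma> :: real and P :: "(schwartz \<Rightarrow> real) measure"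
  assumes "m \<in> borel_measurable borel"
    and "\<And>u. 0 \<le> m u"
    and "integrable lborel (\<lambda>u. m u / (u\<^sup>2 + 1))"
    and "white_noise_measure P"
  shows "(\<forall>t s. (\<integral>\<omega>. m_brownian P m t \<omega> * cnj (m_brownian P m s \<omega>) \<partial>P)
                  = K_fun (r_fun m \<gamma>) s t) \<and>
         (\<forall>t s. (\<integral>\<omega>. (cmod (m_brownian P m t \<omega> - m_brownian P m s \<omega>))\<^sup>2 \<partial>P)
                  = 2 * Re (r_fun m \<gamma> (t - s))) \<and>
         (\<exists>C1>0. \<exists>C2>0. \<forall>t. Re (r_fun m \<gamma> t) \<le> C1 * t\<^sup>2 + C2 * max 1 \<bar>t\<bar>) \<and>
         ((\<exists>A. \<forall>R\<ge>1. R * (LINT u:{u. R < \<bar>u\<bar>}|lborel. m u / u\<^sup>2) \<le> A) \<longrightarrow>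
            (\<exists>C1>0. \<exists>C2>0. \<forall>t. Re (r_fun m \<gamma> t) \<le> C1 * t\<^sup>2 + C2 * \<bar>t\<bar>))"
proof (intro conjI impI)
  note m = assms(1-3)
  let ?B = "m_brownian P m" and ?r = "r_fun m \<gamma>"
  define J where "J = 1 / (2 * pi) * (\<integral>u. m u / (u\<^sup>2 + 1) \<partial>lborel)"
  have J: "J \<ge> 0" unfolding J_def using assms(2) by (simp add: add_nonneg_nonneg)
  have bound: "Re (?r t) \<le> J * t\<^sup>2 + 4 * J" for t
    using Re_r_fun_bound[OF m, of \<gamma> t] unfolding J_def by (simp add: algebra_simps add_divide_distrib)
  have BL: "?B t \<in> L2 P" for t
    unfolding m_brownian_def by (rule Q_L2[OF assms(4) T_op_I_fun(1)[OF m]])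
  have cov: "L2_inner P (?B t) (?B s) = K_fun ?r s t" for t s
    unfolding m_brownian_def
    by (simp add: Q_isometry[OF assms(4)] T_op_I_fun(1)[OF m] T_op_inner_eq_K[OF m, of t s \<gamma>])
  show "\<forall>t s. (\<integral>\<omega>. ?B t \<omega> * cnj (?B s \<omega>) \<partial>P) = K_fun ?r s t"
    using cov by (simp add: L2_inner_def)
  show "\<forall>t s. (\<integral>\<omega>. (cmod (?B t \<omega> - ?B s \<omega>))\<^sup>2 \<partial>P) = 2 * Re (?r (t - s))"
  proof (intro allI)
    fix t s
    \<comment> \<open>the mixed terms produce $\mathrm{Re}\,r$ at both $s - t$ and $t - s$\<close>
    have even: "Re (?r (s - t)) = Re (?r (t - s))"
    proof -
      have "cos ((s - t) * u) = cos ((t - s) * u)" for u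
        by (metis cos_minus minus_diff_eq mult_minus_left)
      then show ?thesis unfolding Re_r_fun[OF m] by simp
    qed
    have "complex_of_real (\<integral>\<omega>. (cmod (?B t \<omega> - ?B s \<omega>))\<^sup>2 \<partial>P)
        = L2_inner P (\<lambda>\<omega>. ?B t \<omega> - ?B s \<omega>) (\<lambda>\<omega>. ?B t \<omega> - ?B s \<omega>)"
      by (simp only: L2_inner_self L2_norm_sq)
    also have "\<dots> = K_fun ?r t t - K_fun ?r s t - (K_fun ?r t s - K_fun ?r s s)"
      by (simp add: L2_inner_diff_left L2_inner_diff_right L2_diff BL cov)
    finally have "(\<integral>\<omega>. (cmod (?B t \<omega> - ?B s \<omega>))\<^sup>2 \<partial>P)
        = Re (K_fun ?r t t - K_fun ?r s t - (K_fun ?r t s - K_fun ?r s s))"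
      by (metis Re_complex_of_real)
    also have "\<dots> = 2 * Re (?r (t - s))"
      by (simp add: K_fun_def even r_fun_0[OF m])
    finally show "(\<integral>\<omega>. (cmod (?B t \<omega> - ?B s \<omega>))\<^sup>2 \<partial>P) = 2 * Re (?r (t - s))" .
  qed
  show "\<exists>C1>0. \<exists>C2>0. \<forall>t. Re (?r t) \<le> C1 * t\<^sup>2 + C2 * max 1 \<bar>t\<bar>"
  proof (rule exI[of _ "J + 1"], intro conjI exI[of _ "4 * J + 1"] allI)
    fix t :: real
    have "J * t\<^sup>2 \<le> (J + 1) * t\<^sup>2" by (intro mult_right_mono) auto
    moreover have "4 * J \<le> (4 * J + 1) * max 1 \<bar>t\<bar>"
    proof -
      have "4 * J \<le> (4 * J + 1) * 1" by simp
      also have "\<dots> \<le> (4 * J + 1) * max 1 \<bar>t\<bar>" using J by (intro mult_left_mono) auto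
      finally show ?thesis .
    qed
    ultimately have "J * t\<^sup>2 + 4 * J \<le> (J + 1) * t\<^sup>2 + (4 * J + 1) * max 1 \<bar>t\<bar>" by (rule add_mono)
    with bound[of t] show "Re (?r t) \<le> (J + 1) * t\<^sup>2 + (4 * J + 1) * max 1 \<bar>t\<bar>" by (rule order_trans)
  qed (use J in auto)
  assume "\<exists>A. \<forall>R\<ge>1. R * (LINT u:{u. R < \<bar>u\<bar>}|lborel. m u / u\<^sup>2) \<le> A"
  then obtain A where A: "\<And>R. R \<ge> 1 \<Longrightarrow> R * tail_integral m R \<le> A"
    unfolding set_lebesgue_integral_def tail_integral_def real_scaleR_def by blast
  have A0: "A \<ge> 0" using A[of 1] tail_integral_nonneg[OF m, of 1] by simp
  show "\<exists>C1>0. \<exists>C2>0. \<forall>t. Re (?r t) \<le> C1 * t\<^sup>2 + C2 * \<bar>t\<bar>"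
  proof (rule exI[of _ "J + 1"], intro conjI exI[of _ "4 * J + 6 * A + 1"] allI)
    fix t :: real
    have J1: "J * t\<^sup>2 \<le> (J + 1) * t\<^sup>2" by (intro mult_right_mono) auto
    show "Re (?r t) \<le> (J + 1) * t\<^sup>2 + (4 * J + 6 * A + 1) * \<bar>t\<bar>"
    proof (cases "\<bar>t\<bar> < 1")
      case True
      have "Re (?r t) \<le> J * t\<^sup>2 + 6 * A * \<bar>t\<bar> / (2 * pi)"
        using Re_r_fun_linear_bound[OF m A True, of \<gamma>] by (simp add: J_def algebra_simps add_divide_distrib)
      also have "6 * A * \<bar>t\<bar> / (2 * pi) \<le> 6 * A * \<bar>t\<bar> / 1"
        using A0 pi_ge_two by (intro divide_left_mono) auto
      also have "6 * A * \<bar>t\<bar> / 1 \<le> (4 * J + 6 * A + 1) * \<bar>t\<bar>" using J by (simp add: mult_right_mono)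
      finally show ?thesis using J1 by linarith
    next
      case False
      have "4 * J \<le> (4 * J + 6 * A + 1) * \<bar>t\<bar>"
        using J A0 False mult_mono[of "4 * J" "4 * J + 6 * A + 1" 1 "\<bar>t\<bar>"] by simp
      with bound[of t] J1 show ?thesis by linarith
    qed
  qed (use J A0 in auto)
qed

end
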